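(* For any $\epsilon>0$, let $(u^x_\epsilon,u^r_\epsilon,p_\epsilon)$ and $(u^x,u^r,p)$ be smooth solutions on the time interval $[0,T]$ to the axisymmetric rescaled Euler equations (AREE) with parameter $\epsilon$ and to the axisymmetric hydrostatic Euler equations (AHEE), respectively. Assume that $u^x$ satisfies the sign condition $$\frac1r\partial_r\Big(\frac1r\partial_ru^x\Big)\ge\sigma>0$$ for some constant $\sigma>0$. Put $\mathrm{w}_\epsilon:=\frac1r\partial_ru^x_\epsilon-\frac{\epsilon^2}{r}\partial_xu^r_\epsilon$ and $\mathrm{w}:=\frac1r\partial_ru^x$. If there exist constants $C_0>0$ and $\beta\in(0,4]$ such that $$\left.\int_{\mathbb{T}}\int_0^1\left\{|u^x_\epsilon-u^x|^2+\epsilon^2|u^r_\epsilon-u^r|^2+|\mathrm{w}_\epsilon-\mathrm{w}|^2\right\}r\,dr\,dx\right|_{t=0}\le C_0\epsilon^\beta,$$ then for all $t\in[0,T]$, $$\int_{\mathbb{T}}\int_0^1\left\{|u^x_\epsilon-u^x|^2+\epsilon^2|u^r_\epsilon-u^r|^2+|\mathrm{w}_\epsilon-\mathrm{w}|^2\right\}r\,dr\,dx\le\widetilde C\epsilon^\beta,$$ where the constant $\widetilde C$ depends only on $\sigma$, $u^x$, $u^r$, $\mathrm{w}$, $C_0$ and $T$, but not on $\epsilon$ nor on $(u^x_\epsilon,u^r_\epsilon,p_\epsilon)$.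
   Context: $\mathbb{T}:=\mathbb{R}/\mathbb{Z}$. (AREE) with parameter $\epsilon$: for $(t,x,r)\in(0,T)\times\mathbb{T}\times(0,1)$, unknowns $u^x_\epsilon,u^r_\epsilon,p_\epsilon$ (functions of $t,x,r$), $$\partial_tu^x_\epsilon+u^x_\epsilon\partial_xu^x_\epsilon+u^r_\epsilon\partial_ru^x_\epsilon=-\partial_xp_\epsilon,\quad \epsilon^2(\partial_tu^r_\epsilon+u^x_\epsilon\partial_xu^r_\epsilon+u^r_\epsilon\partial_ru^r_\epsilon)=-\partial_rp_\epsilon,$$ $$\partial_xu^x_\epsilon+\tfrac1r\partial_r(ru^r_\epsilon)=0,\qquad u^r_\epsilon|_{r=1}=0,\qquad u^x_\epsilon|_{t=0}=u^x_{\epsilon0}.$$ (AHEE): for $(t,x,r)\in(0,T)\times\mathbb{T}\times(0,1)$, unknowns $u^x,u^r$ (functions of $t,x,r$) and $p=p(t,x)$ (independent of $r$), $$\partial_tu^x+u^x\partial_xu^x+u^r\partial_ru^x=-\partial_xp,\quad \partial_xu^x+\tfrac1r\partial_r(ru^r)=0,\quad u^r|_{r=1}=0,\quad u^x|_{t=0}=u^x_0.$$ Smooth solution on $[0,T]$: the axisymmetric vector field $u^xe_x+u^re_r$ (resp. $u^x_\epsilon e_x+u^r_\epsilon e_r$), viewed as a three-dimensional vector field on $\{(x,y,z):x\in\mathbb{T},\,y^2+z^2\le1\}$ with $r=\sqrt{y^2+z^2}$, and the pressure are smooth in $(t,x,y,z)$ on $[0,T]$, up to and including the boundary and the axis $r=0$;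 in particular $ru^r\to0$ and $ru^r_\epsilon\to 0$ as $r\to0^+$. *)

theory Defs
  imports "HOL-Analysis.Analysis"
begin

(* Intended for convex sets S with nonempty interior, where derivatives within S are unique.
   D [b1, ..., bk] is the iterated partial derivative of f in the directions b1, ..., bk, so f is
   C-infinity on S up to and including the boundary. *)
definition smooth_upto :: "'a::euclidean_space set \<Rightarrow> ('a \<Rightarrow> 'b::real_normed_vector) \<Rightarrow> bool" where
  "smooth_upto S f \<longleftrightarrow>
    (\<exists>D :: 'a list \<Rightarrow> 'a \<Rightarrow> 'b.
      (\<forall>X\<in>S. D [] X = f X) \<and>
      (\<forall>\<alpha>\<in>lists Basis. \<forall>X\<in>S.
        (D \<alpha> has_derivative (\<lambda>h. \<Sum>b\<in>Basis. (h \<bullet> b) *\<^sub>R D (b # \<alpha>) X)) (at X within S)))"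

(* Points are (t, x, y, z). Functions on the torus are functions on the line with period 1. *)
definition spacetime_cylinder :: "real \<Rightarrow> (real \<times> real \<times> real \<times> real) set" where
  "spacetime_cylinder T = {(t, x, y, z). 0 \<le> t \<and> t \<le> T \<and> y\<^sup>2 + z\<^sup>2 \<le> 1}"

definition x_periodic :: "real \<Rightarrow> (real \<Rightarrow> real \<Rightarrow> real \<Rightarrow> real) \<Rightarrow> bool" where
  "x_periodic T f \<longleftrightarrow> (\<forall>t\<in>{0..T}. \<forall>x. \<forall>r\<in>{0..1}. f t (x + 1) r = f t x r)"

(* A field f of (t, x, r) as a scalar on the cylinder, with r = sqrt (y^2 + z^2). *)
definition axi_scalar ::
  "(real \<Rightarrow> real \<Rightarrow> real \<Rightarrow> real) \<Rightarrow> real \<times> real \<times> real \<times> real \<Rightarrow> real" where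
  "axi_scalar f = (\<lambda>(t, x, y, z). f t x (sqrt (y\<^sup>2 + z\<^sup>2)))"

(* The field ux e_x + ur e_r with e_r = (0, y/r, z/r). On the axis division by zero makes the
   radial part 0, which is the value any continuous axisymmetric field has there. *)
definition axi_vector ::
  "(real \<Rightarrow> real \<Rightarrow> real \<Rightarrow> real) \<Rightarrow> (real \<Rightarrow> real \<Rightarrow> real \<Rightarrow> real) \<Rightarrow>
   real \<times> real \<times> real \<times> real \<Rightarrow> real \<times> real \<times> real" where
  "axi_vector ux ur = (\<lambda>(t, x, y, z). let r = sqrt (y\<^sup>2 + z\<^sup>2) in
      (ux t x r, ur t x r * (y / r), ur t x r * (z / r)))"

definition smooth_fields ::
  "real \<Rightarrow> (real \<Rightarrow> real \<Rightarrow> real \<Rightarrow> real) \<Rightarrow> (real \<Rightarrow> real \<Rightarrow> real \<Rightarrow> real) \<Rightarrow>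
   (real \<Rightarrow> real \<Rightarrow> real \<Rightarrow> real) \<Rightarrow> bool" where
  "smooth_fields T ux ur p \<longleftrightarrow>
     x_periodic T ux \<and> x_periodic T ur \<and> x_periodic T p \<and>
     smooth_upto (spacetime_cylinder T) (axi_vector ux ur) \<and>
     smooth_upto (spacetime_cylinder T) (axi_scalar p)"

abbreviation dt :: "(real \<Rightarrow> real \<Rightarrow> real \<Rightarrow> real) \<Rightarrow> real \<Rightarrow> real \<Rightarrow> real \<Rightarrow> real" where
  "dt f t x r \<equiv> deriv (\<lambda>s. f s x r) t"

abbreviation dx :: "(real \<Rightarrow> real \<Rightarrow> real \<Rightarrow> real) \<Rightarrow> real \<Rightarrow> real \<Rightarrow> real \<Rightarrow> real" where
  "dx f t x r \<equiv> deriv (\<lambda>s. f t s r) x"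

abbreviation dr :: "(real \<Rightarrow> real \<Rightarrow> real \<Rightarrow> real) \<Rightarrow> real \<Rightarrow> real \<Rightarrow> real \<Rightarrow> real" where
  "dr f t x r \<equiv> deriv (\<lambda>s. f t x s) r"

definition AREE_solution ::
  "real \<Rightarrow> real \<Rightarrow> (real \<Rightarrow> real \<Rightarrow> real) \<Rightarrow>
   (real \<Rightarrow> real \<Rightarrow> real \<Rightarrow> real) \<Rightarrow> (real \<Rightarrow> real \<Rightarrow> real \<Rightarrow> real) \<Rightarrow> (real \<Rightarrow> real \<Rightarrow> real \<Rightarrow> real) \<Rightarrow> bool" where
  "AREE_solution \<epsilon> T ux0 ux ur p \<longleftrightarrow>
     smooth_fields T ux ur p \<and>
     (\<forall>t\<in>{0<..<T}. \<forall>x. \<forall>r\<in>{0<..<1}.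
        dt ux t x r + ux t x r * dx ux t x r + ur t x r * dr ux t x r = - dx p t x r \<and>
        \<epsilon>\<^sup>2 * (dt ur t x r + ux t x r * dx ur t x r + ur t x r * dr ur t x r) = - dr p t x r \<and>
        dx ux t x r + (1 / r) * dr (\<lambda>t x r. r * ur t x r) t x r = 0) \<and>
     (\<forall>t\<in>{0..T}. \<forall>x. ur t x 1 = 0) \<and>
     (\<forall>x. \<forall>r\<in>{0..1}. ux 0 x r = ux0 x r)"

definition AHEE_solution ::
  "real \<Rightarrow> (real \<Rightarrow> real \<Rightarrow> real) \<Rightarrow>
   (real \<Rightarrow> real \<Rightarrow> real \<Rightarrow> real) \<Rightarrow> (real \<Rightarrow> real \<Rightarrow> real \<Rightarrow> real) \<Rightarrow> (real \<Rightarrow> real \<Rightarrow> real) \<Rightarrow> bool" where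
  "AHEE_solution T ux0 ux ur p \<longleftrightarrow>
     smooth_fields T ux ur (\<lambda>t x r. p t x) \<and>
     (\<forall>t\<in>{0<..<T}. \<forall>x. \<forall>r\<in>{0<..<1}.
        dt ux t x r + ux t x r * dx ux t x r + ur t x r * dr ux t x r = - deriv (\<lambda>s. p t s) x \<and>
        dx ux t x r + (1 / r) * dr (\<lambda>t x r. r * ur t x r) t x r = 0) \<and>
     (\<forall>t\<in>{0..T}. \<forall>x. ur t x 1 = 0) \<and>
     (\<forall>x. \<forall>r\<in>{0..1}. ux 0 x r = ux0 x r)"

definition w_hyd ::
  "(real \<Rightarrow> real \<Rightarrow> real \<Rightarrow> real) \<Rightarrow> real \<Rightarrow> real \<Rightarrow> real \<Rightarrow> real" where
  "w_hyd ux t x r = (1 / r) * dr ux t x r"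

definition w_resc ::
  "real \<Rightarrow> (real \<Rightarrow> real \<Rightarrow> real \<Rightarrow> real) \<Rightarrow> (real \<Rightarrow> real \<Rightarrow> real \<Rightarrow> real) \<Rightarrow>
   real \<Rightarrow> real \<Rightarrow> real \<Rightarrow> real" where
  "w_resc \<epsilon> uxe ure t x r = (1 / r) * dr uxe t x r - (\<epsilon>\<^sup>2 / r) * dx ure t x r"

(* The r-range is the open interval, on which every deriv is a genuine two-sided derivative. *)
definition error_energy ::
  "real \<Rightarrow> (real \<Rightarrow> real \<Rightarrow> real \<Rightarrow> real) \<Rightarrow> (real \<Rightarrow> real \<Rightarrow> real \<Rightarrow> real) \<Rightarrow>
   (real \<Rightarrow> real \<Rightarrow> real \<Rightarrow> real) \<Rightarrow> (real \<Rightarrow> real \<Rightarrow> real \<Rightarrow> real) \<Rightarrow> real \<Rightarrow> real" where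
  "error_energy \<epsilon> uxe ure ux ur t =
     integral {0..1} (\<lambda>x. integral {0<..<1} (\<lambda>r.
       (\<bar>uxe t x r - ux t x r\<bar>\<^sup>2 + \<epsilon>\<^sup>2 * \<bar>ure t x r - ur t x r\<bar>\<^sup>2
        + \<bar>w_resc \<epsilon> uxe ure t x r - w_hyd ux t x r\<bar>\<^sup>2) * r))"

end

theory Submission
  imports Defs
begin

text \<open>In the variable \<open>s = r\<^sup>2 / 2\<close>, with \<open>u\<^sup>r = r k\<close>, the measure \<open>r dr\<close> becomes \<open>ds\<close>, the hydrostatic potential
  vorticity is \<open>w = u\<^sub>s\<close>, and the sign condition says that \<open>u\<close> is uniformly convex in \<open>s\<close>. The vorticity
  \<open>W\<close> of the rescaled flow is transported, so the integral of \<open>F (t, x, W)\<close> changes only through the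
  explicit dependence of \<open>F\<close> on \<open>t\<close> and \<open>x\<close>. Taking for \<open>F (t, x, \<cdot>)\<close> the Legendre transform of
  \<open>u (t, x, \<cdot>)\<close>, extended quadratically beyond the range of \<open>w\<close>, makes \<open>F (t, x, W) + u - s W\<close> a Fenchel
  gap comparable to \<open>(W - w)\<^sup>2\<close>, and all terms of its evolution that are linear in the perturbation
  cancel up to a forcing of size \<open>\<epsilon>\<^sup>2\<close>. An elliptic estimate for the stream function controls the
  velocity error by \<open>W - w\<close>, the forcing and the conserved mean velocity. The forcing can be
  integrated by parts against the stream function and therefore enters only as \<open>\<epsilon>\<^sup>4\<close>, whence the
  restriction \<open>\<beta> \<le> 4\<close>; Gronwall's inequality concludes.\<close>

section \<open>Functions smooth up to the boundary\<close>

text \<open>A plain energy estimate for W - w fails: transport of w by the radial perturbation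
  leaves 2 s (K - k) w_s, while only \<epsilon> times the radial velocity error is controlled.
  Weighted by 1 / w_s, the same term becomes the integral of 2 s (K - k) (W - w), which vanishes up
  to the forcing; the Legendre transform is the nonlinear density having this weight as second
  derivative at w. The quadratic extension is forced by the lack of a pointwise bound on W, which
  may leave the range of w. The extended density is in general only C^1, so its derivatives come
  from an envelope theorem for a continuous maximizer. The forcing stems from \<epsilon>^2
  \<open>Dx k\<close>, which the hydrostatic vorticity lacks. One constant has to serve every
  \<epsilon> > 0, whereas \<epsilon>^4 \<le> \<epsilon>^\<beta> holds only for \<epsilon> \<le> 1.
  Large \<epsilon> is reached by comparison with a steady shear, which has no forcing, and by the
  observation that, if k does not vanish initially, an admissible initial error bounds \<epsilon>^2
  by a multiple of \<epsilon>^\<beta>.\<close>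

lemma smooth_upto_partials:
  assumes "smooth_upto S f"
  shows "\<exists>g. \<forall>b\<in>Basis. smooth_upto S (g b) \<and>
    (\<forall>X\<in>S. (f has_derivative (\<lambda>h. \<Sum>b\<in>Basis. (h \<bullet> b) *\<^sub>R g b X)) (at X within S))"
proof -
  obtain D where D0: "\<And>X. X \<in> S \<Longrightarrow> D [] X = f X"
    and D: "\<And>\<alpha> X. \<alpha> \<in> lists Basis \<Longrightarrow> X \<in> S \<Longrightarrow>
        (D \<alpha> has_derivative (\<lambda>h. \<Sum>b\<in>Basis. (h \<bullet> b) *\<^sub>R D (b # \<alpha>) X)) (at X within S)"
    using assms unfolding smooth_upto_def by blast
  have "smooth_upto S (D [b])" if b: "b \<in> Basis" for b
    unfolding smooth_upto_def
  proof (intro exI conjI ballI)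
    fix \<alpha> :: "'a list" and X assume "\<alpha> \<in> lists Basis" "X \<in> S"
    then show "(D (\<alpha> @ [b]) has_derivative (\<lambda>h. \<Sum>c\<in>Basis. (h \<bullet> c) *\<^sub>R D ((c # \<alpha>) @ [b]) X)) (at X within S)"
      using D[of "\<alpha> @ [b]" X] b by simp
  qed simp
  moreover have "(f has_derivative (\<lambda>h. \<Sum>b\<in>Basis. (h \<bullet> b) *\<^sub>R D [b] X)) (at X within S)"
    if "X \<in> S" for X
    using D[of "[]" X] that by (intro has_derivative_transform[OF that _ D]) (auto simp: D0)
  ultimately show ?thesis by (intro exI[of _ "\<lambda>b. D [b]"]) blast
qed

text \<open>Smoothness asks for a whole tree of iterated partials. A class of functions closed under
  one gradient step suffices: choice fixes a gradient for each member, and folding it along a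
  multi-index builds the tree.\<close>

lemma smooth_upto_coinduct:
  assumes f: "P f"
    and step: "\<And>f. P f \<Longrightarrow> \<exists>g. \<forall>b\<in>Basis. P (g b) \<and>
      (\<forall>X\<in>S. (f has_derivative (\<lambda>h. \<Sum>b\<in>Basis. (h \<bullet> b) *\<^sub>R g b X)) (at X within S))"
  shows "smooth_upto S f"
proof -
  obtain G where G: "\<And>f b. P f \<Longrightarrow> b \<in> Basis \<Longrightarrow> P (G f b)"
    and GD: "\<And>f X. P f \<Longrightarrow> X \<in> S \<Longrightarrow>
      (f has_derivative (\<lambda>h. \<Sum>b\<in>Basis. (h \<bullet> b) *\<^sub>R G f b X)) (at X within S)"
  proof -
    have "\<exists>G. \<forall>f. P f \<longrightarrow> (\<forall>b\<in>Basis. P (G f b) \<and>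
      (\<forall>X\<in>S. (f has_derivative (\<lambda>h. \<Sum>b\<in>Basis. (h \<bullet> b) *\<^sub>R G f b X)) (at X within S)))"
      by (rule choice) (use step in blast)
    then obtain G where "\<And>f b. P f \<Longrightarrow> b \<in> Basis \<Longrightarrow> P (G f b) \<and>
      (\<forall>X\<in>S. (f has_derivative (\<lambda>h. \<Sum>b\<in>Basis. (h \<bullet> b) *\<^sub>R G f b X)) (at X within S))"
      by blast
    note G = this
    show ?thesis
      \<comment> \<open>The derivative clause sits under the quantifier over \<open>Basis\<close>,
        so some basis vector is needed to reach it.\<close>
      by (rule that[of G]) (use G in blast, use G SOME_Basis in blast)
  qed
  define D where "D \<alpha> = foldr (\<lambda>b f. G f b) \<alpha> f" for \<alpha>
  have PD: "P (D \<alpha>)" if "\<alpha> \<in> lists Basis" for \<alpha>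
    using that by (induction \<alpha>) (auto simp: D_def f G)
  show ?thesis unfolding smooth_upto_def
  proof (intro exI conjI ballI)
    fix \<alpha> :: "'a list" and X assume "\<alpha> \<in> lists Basis" "X \<in> S"
    then show "(D \<alpha> has_derivative (\<lambda>h. \<Sum>b\<in>Basis. (h \<bullet> b) *\<^sub>R D (b # \<alpha>) X)) (at X within S)"
      using GD[OF PD] by (simp add: D_def)
  qed (simp add: D_def)
qed

text \<open>The gradient is chosen as a whole and then evaluated at \<open>b\<close>, so that all
  components belong to one derivative.\<close>

definition partial :: "'a::euclidean_space set \<Rightarrow> 'a \<Rightarrow> ('a \<Rightarrow> 'b::real_normed_vector) \<Rightarrow> 'a \<Rightarrow> 'b" where
  "partial S b f = (SOME g. \<forall>b\<in>Basis. smooth_upto S (g b) \<and>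
    (\<forall>X\<in>S. (f has_derivative (\<lambda>h. \<Sum>b\<in>Basis. (h \<bullet> b) *\<^sub>R g b X)) (at X within S))) b"

lemma
  assumes "smooth_upto S f"
  shows smooth_upto_partial: "b \<in> Basis \<Longrightarrow> smooth_upto S (partial S b f)"
    and has_derivative_partial: "X \<in> S \<Longrightarrow>
      (f has_derivative (\<lambda>h. \<Sum>b\<in>Basis. (h \<bullet> b) *\<^sub>R partial S b f X)) (at X within S)"
proof -
  define G where "G = (SOME g. \<forall>b\<in>Basis. smooth_upto S (g b) \<and>
    (\<forall>X\<in>S. (f has_derivative (\<lambda>h. \<Sum>b\<in>Basis. (h \<bullet> b) *\<^sub>R g b X)) (at X within S)))"
  have G: "\<forall>b\<in>Basis. smooth_upto S (G b) \<and>
    (\<forall>X\<in>S. (f has_derivative (\<lambda>h. \<Sum>b\<in>Basis. (h \<bullet> b) *\<^sub>R G b X)) (at X within S))"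
    unfolding G_def by (rule someI_ex[OF smooth_upto_partials[OF assms]])
  have p: "partial S b f = G b" for b
    by (simp add: partial_def G_def)
  show "b \<in> Basis \<Longrightarrow> smooth_upto S (partial S b f)"
    using G by (simp add: p)
  show "X \<in> S \<Longrightarrow> (f has_derivative (\<lambda>h. \<Sum>b\<in>Basis. (h \<bullet> b) *\<^sub>R partial S b f X)) (at X within S)"
    unfolding p using bspec[OF G SOME_Basis] by blast
qed

lemma smooth_upto_cong:
  assumes "smooth_upto S f" "\<And>X. X \<in> S \<Longrightarrow> g X = f X"
  shows "smooth_upto S g"
  using assms unfolding smooth_upto_def by simp

lemma smooth_upto_continuous_on: "smooth_upto S f \<Longrightarrow> continuous_on S f"
  by (meson has_derivative_partial has_derivative_continuous continuous_on_eq_continuous_within)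

lemma smooth_upto_const: "smooth_upto S (\<lambda>X. c)"
  by (rule smooth_upto_coinduct[where P = "\<lambda>f. \<exists>c. f = (\<lambda>X. c)"])
     (auto intro!: exI[of _ "\<lambda>b X. 0"])

lemma smooth_upto_add:
  assumes "smooth_upto S f" "smooth_upto S g"
  shows "smooth_upto S (\<lambda>X. f X + g X)"
proof (rule smooth_upto_coinduct[where P = "\<lambda>k. \<exists>f g. smooth_upto S f \<and> smooth_upto S g \<and> k = (\<lambda>X. f X + g X)"])
  fix k assume "\<exists>f g. smooth_upto S f \<and> smooth_upto S g \<and> k = (\<lambda>X. f X + g X)"
  then obtain f g where fg: "smooth_upto S f" "smooth_upto S g" "k = (\<lambda>X. f X + g X)" by blast
  show "\<exists>h. \<forall>b\<in>Basis. (\<exists>f g. smooth_upto S f \<and> smooth_upto S g \<and> h b = (\<lambda>X. f X + g X)) \<and>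
      (\<forall>X\<in>S. (k has_derivative (\<lambda>v. \<Sum>b\<in>Basis. (v \<bullet> b) *\<^sub>R h b X)) (at X within S))"
  proof (intro exI[of _ "\<lambda>b X. partial S b f X + partial S b g X"] ballI conjI)
    fix X assume X: "X \<in> S"
    show "(k has_derivative (\<lambda>v. \<Sum>b\<in>Basis. (v \<bullet> b) *\<^sub>R (partial S b f X + partial S b g X))) (at X within S)"
      using has_derivative_add[OF has_derivative_partial[OF fg(1) X] has_derivative_partial[OF fg(2) X]]
      by (simp add: fg(3) scaleR_add_right sum.distrib)
  qed (use fg smooth_upto_partial in blast)
qed (use assms in blast)

lemma smooth_upto_linear_comp:
  assumes "smooth_upto S f" and T: "bounded_linear T"
  shows "smooth_upto S (\<lambda>X. T (f X))"
proof (rule smooth_upto_coinduct[where P = "\<lambda>k. \<exists>f. smooth_upto S f \<and> k = (\<lambda>X. T (f X))"])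
  fix k assume "\<exists>f. smooth_upto S f \<and> k = (\<lambda>X. T (f X))"
  then obtain f where f: "smooth_upto S f" "k = (\<lambda>X. T (f X))" by blast
  interpret T: bounded_linear T by fact
  show "\<exists>g. \<forall>b\<in>Basis. (\<exists>f. smooth_upto S f \<and> g b = (\<lambda>X. T (f X))) \<and>
     (\<forall>X\<in>S. (k has_derivative (\<lambda>h. \<Sum>b\<in>Basis. (h \<bullet> b) *\<^sub>R g b X)) (at X within S))"
  proof (intro exI[of _ "\<lambda>b X. T (partial S b f X)"] ballI conjI)
    fix X assume X: "X \<in> S"
    show "(k has_derivative (\<lambda>h. \<Sum>b\<in>Basis. (h \<bullet> b) *\<^sub>R T (partial S b f X))) (at X within S)"
      using T.has_derivative[OF has_derivative_partial[OF f(1) X]]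
      by (simp add: f(2) T.sum T.scaleR)
  qed (use f smooth_upto_partial in blast)
qed (use assms in blast)

lemma smooth_upto_scaleR: "smooth_upto S f \<Longrightarrow> smooth_upto S (\<lambda>X. c *\<^sub>R f X)"
  using smooth_upto_linear_comp[OF _ bounded_linear_scaleR_right] by blast

lemma smooth_upto_sum:
  "finite I \<Longrightarrow> (\<And>i. i \<in> I \<Longrightarrow> smooth_upto S (f i)) \<Longrightarrow> smooth_upto S (\<lambda>X. \<Sum>i\<in>I. f i X)"
  by (induction I rule: finite_induct) (auto intro: smooth_upto_const smooth_upto_add)

text \<open>By the chain rule the partials of f o L are linear combinations of partials of f
  composed with L, so functions of this shape form a class closed under gradients. It yields the
  restriction to a meridian plane and to a fixed pair t, x.\<close>

lemma smooth_upto_comp_linear: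
  fixes L :: "'a::euclidean_space \<Rightarrow> 'b::euclidean_space" and f :: "'b \<Rightarrow> 'c::real_normed_vector"
  assumes "smooth_upto S f" and L: "bounded_linear L" and LS: "L ` R \<subseteq> S"
  shows "smooth_upto R (\<lambda>X. f (L X))"
proof (rule smooth_upto_coinduct[where P = "\<lambda>k. \<exists>f. smooth_upto S f \<and> k = (\<lambda>X. f (L X))"])
  fix k :: "'a \<Rightarrow> 'c" assume "\<exists>f. smooth_upto S f \<and> k = (\<lambda>X. f (L X))"
  then obtain f where f: "smooth_upto S f" "k = (\<lambda>X. f (L X))" by blast
  interpret L: bounded_linear L by fact
  define g where "g c Y = (\<Sum>b\<in>Basis. (L c \<bullet> b) *\<^sub>R partial S b f Y)" for c Y
  have "smooth_upto S (g c)" for c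
    unfolding g_def by (intro smooth_upto_sum smooth_upto_scaleR smooth_upto_partial f) auto
  moreover have "(k has_derivative (\<lambda>h. \<Sum>c\<in>Basis. (h \<bullet> c) *\<^sub>R g c (L X))) (at X within R)"
    if X: "X \<in> R" for X
  proof -
    have "(f has_derivative (\<lambda>h. \<Sum>b\<in>Basis. (h \<bullet> b) *\<^sub>R partial S b f (L X))) (at (L X) within L ` R)"
      using has_derivative_subset[OF has_derivative_partial[OF f(1)] LS] LS X by blast
    from has_derivative_in_compose[OF L.has_derivative[OF has_derivative_ident] this]
    have "(k has_derivative (\<lambda>h. \<Sum>b\<in>Basis. (L h \<bullet> b) *\<^sub>R partial S b f (L X))) (at X within R)"
      by (simp add: f(2))
    moreover have "(\<Sum>b\<in>Basis. (L h \<bullet> b) *\<^sub>R partial S b f (L X)) = (\<Sum>c\<in>Basis. (h \<bullet> c) *\<^sub>R g c (L X))" for h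
    proof -
      have "L h \<bullet> b = (\<Sum>c\<in>Basis. (h \<bullet> c) * (L c \<bullet> b))" for b
        by (subst euclidean_representation[of h, symmetric])
           (simp add: L.sum L.scaleR inner_sum_left del: euclidean_representation)
      then have "(\<Sum>b\<in>Basis. (L h \<bullet> b) *\<^sub>R partial S b f (L X)) =
        (\<Sum>b\<in>Basis. \<Sum>c\<in>Basis. ((h \<bullet> c) * (L c \<bullet> b)) *\<^sub>R partial S b f (L X))"
        by (simp add: scaleR_sum_left)
      also have "\<dots> = (\<Sum>c\<in>Basis. (h \<bullet> c) *\<^sub>R g c (L X))"
        by (subst sum.swap) (simp add: g_def scaleR_sum_right)
      finally show ?thesis .
    qed
    ultimately show ?thesis by simp
  qed
  ultimately show "\<exists>g. \<forall>b\<in>Basis. (\<exists>f. smooth_upto S f \<and> g b = (\<lambda>X. f (L X))) \<and>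
     (\<forall>X\<in>R. (k has_derivative (\<lambda>h. \<Sum>b\<in>Basis. (h \<bullet> b) *\<^sub>R g b X)) (at X within R))"
    by (intro exI[of _ "\<lambda>c X. g c (L X)"]) blast
qed (use assms in blast)

section \<open>Calculus on space-time slabs\<close>

type_synonym point = "real \<times> real \<times> real"
type_synonym field = "point \<Rightarrow> real"

abbreviation slab :: "real \<Rightarrow> real \<Rightarrow> real \<Rightarrow> (point) set" where
  "slab T c d \<equiv> {0..T} \<times> UNIV \<times> {c..d}"

lemma sum_Basis_triple:
  "(\<Sum>b\<in>(Basis :: (point) set). F b) = F (1, 0, 0) + F (0, 1, 0) + F (0, 0, 1)"
  by (simp add: Basis_prod_def sum.union_disjoint image_image add.assoc zero_prod_def add.commute add.left_commute)

lemma split_triple: "(\<lambda>(x, s). G (t, x, s)) = (\<lambda>y. G (t, y))"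
  by auto

lemma Basis_triple: "(Basis :: (point) set) = {(1, 0, 0), (0, 1, 0), (0, 0, 1)}"
  by (simp add: Basis_prod_def image_image zero_prod_def insert_commute)

text \<open>Partials, all but one of them continuous, give a total derivative. The two-variable
  criterion is used twice, on (x, s) and then on t against (x, s); on the faces of the slab the t
  and s derivatives are one-sided.\<close>

lemma has_derivative_slabI:
  fixes f ft fx fs :: "field"
  assumes ft: "\<And>t x s. (t, x, s) \<in> slab T c d \<Longrightarrow>
      ((\<lambda>t. f (t, x, s)) has_real_derivative ft (t, x, s)) (at t within {0..T})"
    and fx: "\<And>t x s. (t, x, s) \<in> slab T c d \<Longrightarrow>
      ((\<lambda>x. f (t, x, s)) has_real_derivative fx (t, x, s)) (at x)"
    and fs: "\<And>t x s. (t, x, s) \<in> slab T c d \<Longrightarrow>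
      ((\<lambda>s. f (t, x, s)) has_real_derivative fs (t, x, s)) (at s within {c..d})"
    and cx: "continuous_on (slab T c d) fx" and cs: "continuous_on (slab T c d) fs"
    and X: "(t, x, s) \<in> slab T c d"
  shows "(f has_derivative (\<lambda>(ht, hx, hs). ht * ft (t, x, s) + hx * fx (t, x, s) + hs * fs (t, x, s)))
    (at (t, x, s) within slab T c d)"
proof -
  define Dxs where "Dxs t y = fx (t, y) *\<^sub>R blinfun_inner_left (1, 0)
    + fs (t, y) *\<^sub>R (blinfun_inner_left (0, 1) :: (real \<times> real) \<Rightarrow>\<^sub>L real)" for t :: real and y :: "real \<times> real"
  have "((\<lambda>(x, s). f (t, x, s)) has_derivative blinfun_apply (Dxs t (x, s))) (at (x, s) within UNIV \<times> {c..d})"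
    if A: "(t, x, s) \<in> slab T c d" for t x s
  proof -
    have cts: "continuous_on (UNIV \<times> {c..d}) (\<lambda>(x, s). blinfun_scaleR_left (fs (t, x, s)))"
      using A by (auto simp: split_beta intro!: continuous_intros continuous_on_compose2[OF cs])
    have "((\<lambda>(x, s). f (t, x, s)) has_derivative
        (\<lambda>(hx, hs). (*) (fx (t, x, s)) hx + blinfun_apply (blinfun_scaleR_left (fs (t, x, s))) hs))
        (at (x, s) within UNIV \<times> {c..d})"
    proof (rule has_derivative_partialsI[where fy = "\<lambda>x s. blinfun_scaleR_left (fs (t, x, s))"])
      show "((\<lambda>x. f (t, x, s)) has_derivative (*) (fx (t, x, s))) (at x)"
        using fx[OF A] by (simp add: has_field_derivative_def)
      show "((\<lambda>s. f (t, x', s)) has_derivative blinfun_apply (blinfun_scaleR_left (fs (t, x', s'))))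
          (at s' within {c..d})" if "s' \<in> {c..d}" for x' s'
        by (rule has_derivative_eq_rhs[OF fs[of t x' s', unfolded has_field_derivative_def]])
           (use A that in \<open>auto simp: fun_eq_iff\<close>)
      show "continuous (at (x, s) within UNIV \<times> {c..d}) (\<lambda>(x, s). blinfun_scaleR_left (fs (t, x, s)))"
        using bspec[OF cts[unfolded continuous_on_eq_continuous_within], of "(x, s)"] A by (simp del: split_paired_All)
    qed (use A in auto)
    moreover have "(\<lambda>(hx, hs). (*) (fx (t, x, s)) hx + blinfun_apply (blinfun_scaleR_left (fs (t, x, s))) hs)
        = blinfun_apply (Dxs t (x, s))"
      by (auto simp: fun_eq_iff Dxs_def blinfun.add_left blinfun.scaleR_left)
    ultimately show ?thesis by simp
  qed
  note xs = this
  have cts: "continuous_on ({0..T} \<times> (UNIV \<times> {c..d})) (\<lambda>(t, y). Dxs t y)"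
    unfolding Dxs_def split_beta prod.collapse by (intro continuous_intros cx cs)
  have "((\<lambda>(t, y). f (t, y)) has_derivative
      (\<lambda>(ht, hy). (*) (ft (t, x, s)) ht + blinfun_apply (Dxs t (x, s)) hy))
      (at (t, x, s) within {0..T} \<times> (UNIV \<times> {c..d}))"
  proof (rule has_derivative_partialsI[where fy = Dxs])
    show "((\<lambda>t. f (t, x, s)) has_derivative (*) (ft (t, x, s))) (at t within {0..T})"
      using ft[OF X] by (simp add: has_field_derivative_def)
    show "((\<lambda>y. f (t', y)) has_derivative blinfun_apply (Dxs t' y')) (at y' within UNIV \<times> {c..d})"
      if "t' \<in> {0..T}" "y' \<in> UNIV \<times> {c..d}" for t' y'
      using xs[of t' "fst y'" "snd y'"] that by (auto simp: mem_Times_iff split_triple)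
    show "continuous (at (t, x, s) within {0..T} \<times> UNIV \<times> {c..d}) (\<lambda>(t, y). Dxs t y)"
      using cts X by (simp only: continuous_on_eq_continuous_within)
  qed (use X in \<open>auto intro: convex_Times\<close>)
  moreover have "(\<lambda>(ht, hy). (*) (ft (t, x, s)) ht + blinfun_apply (Dxs t (x, s)) hy)
      = (\<lambda>(ht, hx, hs). ht * ft (t, x, s) + hx * fx (t, x, s) + hs * fs (t, x, s))"
    by (auto simp: fun_eq_iff Dxs_def blinfun.add_left blinfun.scaleR_left)
  ultimately show ?thesis by (simp add: split_beta)
qed

text \<open>On a slab, coinduction only has to supply three one-variable derivatives; continuity of
  the members of the class upgrades them to a total derivative.\<close>

lemma smooth_slab_coinduct:
  fixes f :: "field"
  assumes f: "P f"
    and cont: "\<And>f. P f \<Longrightarrow> continuous_on (slab T c d) f"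
    and step: "\<And>f. P f \<Longrightarrow> \<exists>ft fx fs. P ft \<and> P fx \<and> P fs \<and> (\<forall>t x s. (t, x, s) \<in> slab T c d \<longrightarrow>
      ((\<lambda>t. f (t, x, s)) has_real_derivative ft (t, x, s)) (at t within {0..T}) \<and>
      ((\<lambda>x. f (t, x, s)) has_real_derivative fx (t, x, s)) (at x) \<and>
      ((\<lambda>s. f (t, x, s)) has_real_derivative fs (t, x, s)) (at s within {c..d}))"
  shows "smooth_upto (slab T c d) f"
proof (rule smooth_upto_coinduct[where P = P, OF f])
  fix f assume Pf: "P f"
  obtain ft fx fs where P: "P ft" "P fx" "P fs" and D: "\<And>t x s. (t, x, s) \<in> slab T c d \<Longrightarrow>
      ((\<lambda>t. f (t, x, s)) has_real_derivative ft (t, x, s)) (at t within {0..T})"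
     "\<And>t x s. (t, x, s) \<in> slab T c d \<Longrightarrow>
      ((\<lambda>x. f (t, x, s)) has_real_derivative fx (t, x, s)) (at x)"
     "\<And>t x s. (t, x, s) \<in> slab T c d \<Longrightarrow>
      ((\<lambda>s. f (t, x, s)) has_real_derivative fs (t, x, s)) (at s within {c..d})"
    using step[OF Pf] by blast
  define g where "g b = (if b = (1, 0, 0) then ft else if b = (0, 1, 0) then fx else fs)"
    for b :: "point"
  have "(f has_derivative (\<lambda>h. \<Sum>b\<in>Basis. (h \<bullet> b) *\<^sub>R g b X)) (at X within slab T c d)"
    if "X \<in> slab T c d" for X
  proof -
    obtain t x s where X: "X = (t, x, s)" by (cases X)
    have "(\<lambda>(ht, hx, hs). ht * ft (t, x, s) + hx * fx (t, x, s) + hs * fs (t, x, s))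
       = (\<lambda>h. \<Sum>b\<in>Basis. (h \<bullet> b) *\<^sub>R g b X)"
      by (auto simp: fun_eq_iff sum_Basis_triple g_def X)
    then show ?thesis
      using has_derivative_slabI[OF D cont[OF P(2)] cont[OF P(3)], of t x s] that by (simp add: X)
  qed
  moreover have "P (g b)" for b by (simp add: g_def P)
  ultimately show "\<exists>g. \<forall>b\<in>Basis. P (g b) \<and> (\<forall>X\<in>slab T c d.
      (f has_derivative (\<lambda>h. \<Sum>b\<in>Basis. (h \<bullet> b) *\<^sub>R g b X)) (at X within slab T c d))"
    by blast
qed

lemma
  fixes f :: "field"
  assumes f: "smooth_upto (slab T c d) f" and X: "(t, x, s) \<in> slab T c d"
  shows partial_t: "((\<lambda>t. f (t, x, s)) has_real_derivative partial (slab T c d) (1, 0, 0) f (t, x, s)) (at t within {0..T})"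
    and partial_x: "((\<lambda>x. f (t, x, s)) has_real_derivative partial (slab T c d) (0, 1, 0) f (t, x, s)) (at x)"
    and partial_s: "((\<lambda>s. f (t, x, s)) has_real_derivative partial (slab T c d) (0, 0, 1) f (t, x, s)) (at s within {c..d})"
proof -
  let ?D = "\<lambda>h. \<Sum>b\<in>Basis. (h \<bullet> b) *\<^sub>R partial (slab T c d) b f (t, x, s)"
  have D: "(f has_derivative ?D) (at (t, x, s) within slab T c d)"
    by (rule has_derivative_partial[OF f X])
  have D': "(f has_derivative ?D) (at (t, x, s) within R)" if "R \<subseteq> slab T c d" for R
    by (rule has_derivative_subset[OF D that])
  have D1: "((\<lambda>t. (t, x, s)) has_derivative (\<lambda>h. (h, 0, 0))) (at t within {0..T})"
    by (auto intro!: derivative_eq_intros simp: zero_prod_def)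
  have sub: "(\<lambda>t. (t, x, s)) ` {0..T} \<subseteq> slab T c d" using X by auto
  from has_derivative_in_compose[OF D1 D'[OF sub]]
  show "((\<lambda>t. f (t, x, s)) has_real_derivative partial (slab T c d) (1, 0, 0) f (t, x, s)) (at t within {0..T})"
    by (auto simp: has_field_derivative_def sum_Basis_triple mult.commute[of _ "partial _ _ _ _"])
  have D1: "((\<lambda>x. (t, x, s)) has_derivative (\<lambda>h. (0, h, 0))) (at x)"
    by (auto intro!: derivative_eq_intros)
  have sub: "range (\<lambda>x. (t, x, s)) \<subseteq> slab T c d" using X by auto
  from has_derivative_in_compose[OF D1 D'[OF sub]]
  show "((\<lambda>x. f (t, x, s)) has_real_derivative partial (slab T c d) (0, 1, 0) f (t, x, s)) (at x)"
    by (auto simp: has_field_derivative_def sum_Basis_triple mult.commute[of _ "partial _ _ _ _"])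
  have D1: "((\<lambda>s. (t, x, s)) has_derivative (\<lambda>h. (0, 0, h))) (at s within {c..d})"
    by (auto intro!: derivative_eq_intros)
  have sub: "(\<lambda>s. (t, x, s)) ` {c..d} \<subseteq> slab T c d" using X by auto
  from has_derivative_in_compose[OF D1 D'[OF sub]]
  show "((\<lambda>s. f (t, x, s)) has_real_derivative partial (slab T c d) (0, 0, 1) f (t, x, s)) (at s within {c..d})"
    by (auto simp: has_field_derivative_def sum_Basis_triple mult.commute[of _ "partial _ _ _ _"])
qed

lemma has_real_derivative_unique_Icc:
  fixes f :: "real \<Rightarrow> real"
  assumes "(f has_real_derivative D) (at x within {a..b})" "(f has_real_derivative E) (at x within {a..b})"
    and "a < b" "x \<in> {a..b}"
  shows "D = E"
proof -
  have "at x within {a..b} \<noteq> bot"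
    using assms(3,4) islimpt_Icc[of a b x] by (simp add: trivial_limit_within)
  then show ?thesis using assms(1,2) has_field_derivative_unique by blast
qed

lemma real_derivative_within_transform:
  fixes f g :: "real \<Rightarrow> real"
  assumes "(f has_real_derivative D) (at x within A)" "x \<in> A" "\<And>y. y \<in> A \<Longrightarrow> g y = f y"
  shows "(g has_real_derivative D) (at x within A)"
  using assms unfolding has_field_derivative_def by (metis has_derivative_transform)

text \<open>The weight makes the family closed under differentiation: a derivative in y brings out
  one factor \<theta> and so raises n by one.\<close>

definition radial_mean :: "nat \<Rightarrow> field \<Rightarrow> field" where
  "radial_mean n f = (\<lambda>(t, x, y). integral {0..1} (\<lambda>\<theta>. \<theta> ^ n * f (t, x, \<theta> * y)))"

lemma scale_mem_Icc:
  fixes \<theta> y :: real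
  assumes "0 \<le> \<theta>" "\<theta> \<le> 1" "-1 \<le> y" "y \<le> 1"
  shows "-1 \<le> \<theta> * y" "\<theta> * y \<le> 1"
proof -
  have "\<bar>\<theta> * y\<bar> \<le> 1" using assms by (simp add: abs_mult mult_le_one)
  then show "-1 \<le> \<theta> * y" "\<theta> * y \<le> 1" by auto
qed

lemma smooth_upto_radial_mean:
  assumes "smooth_upto (slab T (-1) 1) f"
  shows "smooth_upto (slab T (-1) 1) (radial_mean n f)"
proof (rule smooth_slab_coinduct[where P = "\<lambda>k. \<exists>n f. smooth_upto (slab T (-1) 1) f \<and> k = radial_mean n f"])
  have cont: "continuous_on (slab T (-1) 1 \<times> cbox 0 1) (\<lambda>(X, \<theta>). case X of (t, x, y) \<Rightarrow> \<theta> ^ n * f (t, x, \<theta> * y))"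
    if f: "smooth_upto (slab T (-1) 1) f" for n f
    using smooth_upto_continuous_on[OF f]
    by (auto simp: split_beta scale_mem_Icc intro!: continuous_intros continuous_on_compose2[OF smooth_upto_continuous_on[OF f]])
  show "continuous_on (slab T (-1) 1) k"
    if "\<exists>n f. smooth_upto (slab T (-1) 1) f \<and> k = radial_mean n f" for k
  proof -
    from that obtain n f where f: "smooth_upto (slab T (-1) 1) f" and k: "k = radial_mean n f" by blast
    have "k = (\<lambda>X. integral (cbox 0 1) (\<lambda>\<theta>. case X of (t, x, y) \<Rightarrow> \<theta> ^ n * f (t, x, \<theta> * y)))"
      by (auto simp: k radial_mean_def)
    then show ?thesis using integral_continuous_on_param[OF cont[OF f, of n]] by simp
  qed
  fix k assume "\<exists>n f. smooth_upto (slab T (-1) 1) f \<and> k = radial_mean n f"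
  then obtain n f where f: "smooth_upto (slab T (-1) 1) f" and k: "k = radial_mean n f" by blast
  let ?p = "\<lambda>b. partial (slab T (-1) 1) b f"
  have sp: "smooth_upto (slab T (-1) 1) (?p (1,0,0))" "smooth_upto (slab T (-1) 1) (?p (0,1,0))"
     "smooth_upto (slab T (-1) 1) (?p (0,0,1))"
    using smooth_upto_partial[OF f] by (auto simp: Basis_triple)
  have int: "(\<lambda>\<theta>. \<theta> ^ n * f (t, x, \<theta> * y)) integrable_on cbox 0 1" if "(t, x, y) \<in> slab T (-1) 1" for t x y
    by (intro integrable_continuous continuous_intros continuous_on_compose2[OF smooth_upto_continuous_on[OF f]])
       (use that scale_mem_Icc in auto)
  have c: "continuous_on (A \<times> cbox 0 1) (\<lambda>(z, \<theta>). \<theta> ^ m * h (t' z, x' z, \<theta> * y' z))"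
    if "smooth_upto (slab T (-1) 1) h" "\<And>z. z \<in> A \<Longrightarrow> (t' z, x' z, y' z) \<in> slab T (-1) 1"
      "continuous_on A t'" "continuous_on A x'" "continuous_on A y'" for h m A and t' x' y' :: "real \<Rightarrow> real"
    unfolding split_beta
    by (intro continuous_intros continuous_on_compose2[OF smooth_upto_continuous_on[OF that(1)]]
        continuous_on_compose2[OF that(3)] continuous_on_compose2[OF that(4)] continuous_on_compose2[OF that(5)])
       (use that(2) scale_mem_Icc in auto)
  show "\<exists>ft fx fs.
     (\<exists>n f. smooth_upto (slab T (-1) 1) f \<and> ft = radial_mean n f) \<and>
     (\<exists>n f. smooth_upto (slab T (-1) 1) f \<and> fx = radial_mean n f) \<and>
     (\<exists>n f. smooth_upto (slab T (-1) 1) f \<and> fs = radial_mean n f) \<and>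
     (\<forall>t x s. (t, x, s) \<in> slab T (-1) 1 \<longrightarrow>
       ((\<lambda>t. k (t, x, s)) has_real_derivative ft (t, x, s)) (at t within {0..T}) \<and>
       ((\<lambda>x. k (t, x, s)) has_real_derivative fx (t, x, s)) (at x) \<and>
       ((\<lambda>s. k (t, x, s)) has_real_derivative fs (t, x, s)) (at s within {-1..1}))"
  proof (rule exI[of _ "radial_mean n (?p (1,0,0))"], rule exI[of _ "radial_mean n (?p (0,1,0))"],
      rule exI[of _ "radial_mean (Suc n) (?p (0,0,1))"], intro conjI allI impI)
    fix t x y assume X: "(t, x, y) \<in> slab T (-1) 1"
    have L: "(t, x, \<theta> * y) \<in> slab T (-1) 1" if "(t, x, y) \<in> slab T (-1) 1" "\<theta> \<in> cbox 0 1" for t x y \<theta>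
      using that scale_mem_Icc by auto
    have "((\<lambda>t. integral (cbox 0 1) (\<lambda>\<theta>. \<theta> ^ n * f (t, x, \<theta> * y))) has_real_derivative
       integral (cbox 0 1) (\<lambda>\<theta>. \<theta> ^ n * ?p (1,0,0) (t, x, \<theta> * y))) (at t within {0..T})"
      by (rule leibniz_rule_field_derivative)
         (use X L int in \<open>auto intro!: DERIV_cmult partial_t[OF f] c[OF sp(1), where t'="\<lambda>t. t", simplified] continuous_intros\<close>)
    then show "((\<lambda>t. k (t, x, y)) has_real_derivative radial_mean n (?p (1,0,0)) (t, x, y)) (at t within {0..T})"
      by (simp add: k radial_mean_def)
    have "((\<lambda>x. integral (cbox 0 1) (\<lambda>\<theta>. \<theta> ^ n * f (t, x, \<theta> * y))) has_real_derivative
       integral (cbox 0 1) (\<lambda>\<theta>. \<theta> ^ n * ?p (0,1,0) (t, x, \<theta> * y))) (at x within UNIV)"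
      by (rule leibniz_rule_field_derivative)
         (use X L int in \<open>auto intro!: DERIV_cmult partial_x[OF f] c[OF sp(2), where x'="\<lambda>t. t", simplified] continuous_intros\<close>)
    then show "((\<lambda>x. k (t, x, y)) has_real_derivative radial_mean n (?p (0,1,0)) (t, x, y)) (at x)"
      by (simp add: k radial_mean_def)
    have d: "((\<lambda>y. \<theta> ^ n * f (t, x, \<theta> * y)) has_real_derivative \<theta> ^ Suc n * ?p (0,0,1) (t, x, \<theta> * y)) (at y within {-1..1})"
      if "y \<in> {-1..1}" "\<theta> \<in> cbox 0 1" for y \<theta>
    proof -
      have "((\<lambda>s. f (t, x, s)) has_real_derivative ?p (0,0,1) (t, x, \<theta> * y)) (at (\<theta> * y) within (*) \<theta> ` {-1..1})"
        by (rule has_field_derivative_subset[OF partial_s[OF f]]) (use X L that scale_mem_Icc in auto)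
      from DERIV_image_chain[OF this, of "\<theta>"]
      have "((\<lambda>y. f (t, x, \<theta> * y)) has_real_derivative ?p (0,0,1) (t, x, \<theta> * y) * \<theta>) (at y within {-1..1})"
        by (auto simp: o_def intro!: derivative_eq_intros)
      from DERIV_cmult[OF this, of "\<theta> ^ n"] show ?thesis by (simp add: mult_ac)
    qed
    have "((\<lambda>y. integral (cbox 0 1) (\<lambda>\<theta>. \<theta> ^ n * f (t, x, \<theta> * y))) has_real_derivative
       integral (cbox 0 1) (\<lambda>\<theta>. \<theta> ^ Suc n * ?p (0,0,1) (t, x, \<theta> * y))) (at y within {-1..1})"
      by (rule leibniz_rule_field_derivative[OF d])
         (use X L int c[OF sp(3), where y'="\<lambda>t. t" and t'="\<lambda>_. t" and x'="\<lambda>_. x" and A = "{-1..1}" and m = "Suc n", simplified] in \<open>auto simp: continuous_intros\<close>)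
    then show "((\<lambda>y. k (t, x, y)) has_real_derivative radial_mean (Suc n) (?p (0,0,1)) (t, x, y)) (at y within {-1..1})"
      by (simp add: k radial_mean_def)
  qed (use sp in blast)+
qed (use assms in blast)

section \<open>Even functions and the variable \<open>r\<^sup>2 / 2\<close>\<close>

text \<open>Integrating the derivative of g (t, x, \<theta> y) in \<theta> over [0, 1] exhibits the
  quotient g / y as a mean of the y-derivative, which is smooth across y = 0.\<close>

lemma hadamard:
  assumes g: "smooth_upto (slab T (-1) 1) g"
    and g0: "\<And>t x. t \<in> {0..T} \<Longrightarrow> g (t, x, 0) = 0"
  obtains k where "smooth_upto (slab T (-1) 1) k"
    and "\<And>t x y. (t, x, y) \<in> slab T (-1) 1 \<Longrightarrow> g (t, x, y) = y * k (t, x, y)"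
proof
  let ?gy = "partial (slab T (-1) 1) (0, 0, 1) g"
  show "smooth_upto (slab T (-1) 1) (radial_mean 0 ?gy)"
    by (intro smooth_upto_radial_mean smooth_upto_partial[OF g]) (simp add: Basis_triple)
  fix t x y assume X: "(t, x, y) \<in> slab T (-1) 1"
  have d: "((\<lambda>\<theta>. g (t, x, \<theta> * y)) has_vector_derivative ?gy (t, x, \<theta> * y) * y) (at \<theta> within {0..1})"
    if "\<theta> \<in> {0..1}" for \<theta>
  proof -
    have "((\<lambda>y. g (t, x, y)) has_real_derivative ?gy (t, x, \<theta> * y)) (at (\<theta> * y) within (\<lambda>\<theta>. \<theta> * y) ` {0..1})"
      by (rule has_field_derivative_subset[OF partial_s[OF g]]) (use X that scale_mem_Icc in auto)
    moreover have "((\<lambda>\<theta>. \<theta> * y) has_real_derivative y) (at \<theta> within {0..1})"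
      by (auto intro!: derivative_eq_intros)
    ultimately show ?thesis
      using DERIV_image_chain by (force simp: o_def simp flip: has_real_derivative_iff_has_vector_derivative)
  qed
  have "((\<lambda>\<theta>. ?gy (t, x, \<theta> * y) * y) has_integral g (t, x, 1 * y) - g (t, x, 0 * y)) {0..1}"
    by (rule fundamental_theorem_of_calculus[OF _ d]) auto
  from integral_unique[OF this] X g0 show "g (t, x, y) = y * radial_mean 0 ?gy (t, x, y)"
    by (simp add: radial_mean_def mult.commute)
qed

text \<open>Whitney's theorem on even functions; the parameter \<open>s = r\<^sup>2 / 2\<close> turns \<open>r dr\<close> into \<open>ds\<close>.\<close>
lemma smooth_upto_even:
  fixes f :: "field"
  assumes "T > 0" and f: "smooth_upto (slab T (-1) 1) f"
    and even: "\<And>t x y. (t, x, y) \<in> slab T (-1) 1 \<Longrightarrow> f (t, x, - y) = f (t, x, y)"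
  shows "smooth_upto (slab T 0 (1/2)) (\<lambda>(t, x, s). f (t, x, sqrt (2 * s)))"
proof -
  define even_smooth where "even_smooth f \<longleftrightarrow> smooth_upto (slab T (-1) 1) f \<and>
    (\<forall>t x y. (t, x, y) \<in> slab T (-1) 1 \<longrightarrow> f (t, x, - y) = f (t, x, y))"
    for f :: "field"
  have mem: "(t, x, sqrt (2 * s)) \<in> slab T (-1) 1" if "(t, x, s) \<in> slab T 0 (1/2)" for t x s :: real
  proof -
    have "0 \<le> sqrt (2 * s)" "sqrt (2 * s) \<le> 1" using that by auto
    then show ?thesis using that by (simp del: real_sqrt_le_1_iff real_sqrt_ge_0_iff)
  qed
  show ?thesis
  proof (rule smooth_slab_coinduct[where
        P = "\<lambda>k. \<exists>f. even_smooth f \<and> k = (\<lambda>(t, x, s). f (t, x, sqrt (2 * s)))"])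
    show "\<exists>g. even_smooth g \<and> (\<lambda>(t, x, s). f (t, x, sqrt (2 * s))) = (\<lambda>(t, x, s). g (t, x, sqrt (2 * s)))"
      using f even by (auto simp: even_smooth_def)
    show "continuous_on (slab T 0 (1/2)) k"
      if "\<exists>f. even_smooth f \<and> k = (\<lambda>(t, x, s). f (t, x, sqrt (2 * s)))" for k
    proof -
      from that obtain f where f: "smooth_upto (slab T (-1) 1) f" and k: "k = (\<lambda>(t, x, s). f (t, x, sqrt (2 * s)))"
        by (auto simp: even_smooth_def)
      show ?thesis
        unfolding k split_beta
        by (intro continuous_intros continuous_on_compose2[OF smooth_upto_continuous_on[OF f]]) (use mem in auto)
    qed
    fix k assume "\<exists>f. even_smooth f \<and> k = (\<lambda>(t, x, s). f (t, x, sqrt (2 * s)))"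
    then obtain f where f: "smooth_upto (slab T (-1) 1) f"
      and ev: "\<And>t x y. (t, x, y) \<in> slab T (-1) 1 \<Longrightarrow> f (t, x, - y) = f (t, x, y)"
      and k: "k = (\<lambda>(t, x, s). f (t, x, sqrt (2 * s)))"
      by (auto simp: even_smooth_def)
    let ?p = "\<lambda>b. partial (slab T (-1) 1) b f"
    have sp: "smooth_upto (slab T (-1) 1) (?p (1,0,0))" "smooth_upto (slab T (-1) 1) (?p (0,1,0))"
       "smooth_upto (slab T (-1) 1) (?p (0,0,1))"
      using smooth_upto_partial[OF f] by (auto simp: Basis_triple)
    have ev_t: "?p (1,0,0) (t, x, - y) = ?p (1,0,0) (t, x, y)" if "(t, x, y) \<in> slab T (-1) 1" for t x y
    proof (rule has_real_derivative_unique_Icc)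
      show "((\<lambda>t. f (t, x, y)) has_real_derivative ?p (1,0,0) (t, x, - y)) (at t within {0..T})"
        by (rule real_derivative_within_transform[OF partial_t[OF f]]) (use that in \<open>auto simp: ev\<close>)
      show "((\<lambda>t. f (t, x, y)) has_real_derivative ?p (1,0,0) (t, x, y)) (at t within {0..T})"
        by (rule partial_t[OF f that])
    qed (use that \<open>T > 0\<close> in auto)
    have ev_x: "?p (0,1,0) (t, x, - y) = ?p (0,1,0) (t, x, y)" if "(t, x, y) \<in> slab T (-1) 1" for t x y
    proof (rule DERIV_unique)
      show "((\<lambda>x. f (t, x, y)) has_real_derivative ?p (0,1,0) (t, x, - y)) (at x)"
        by (rule real_derivative_within_transform[OF partial_x[OF f]]) (use that in \<open>auto simp: ev\<close>)
      show "((\<lambda>x. f (t, x, y)) has_real_derivative ?p (0,1,0) (t, x, y)) (at x)"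
        by (rule partial_x[OF f that])
    qed
    have odd_y: "?p (0,0,1) (t, x, - y) = - ?p (0,0,1) (t, x, y)" if X: "(t, x, y) \<in> slab T (-1) 1" for t x y
    proof -
      have "((\<lambda>y. f (t, x, y)) has_real_derivative ?p (0,0,1) (t, x, - y)) (at (- y) within uminus ` {-1..1})"
        by (rule has_field_derivative_subset[OF partial_s[OF f]]) (use X in auto)
      moreover have "(uminus has_real_derivative - 1) (at y within {-1..1})"
        by (auto intro!: derivative_eq_intros)
      ultimately have "((\<lambda>y. f (t, x, - y)) has_real_derivative ?p (0,0,1) (t, x, - y) * - 1) (at y within {-1..1})"
        using DERIV_image_chain unfolding o_def by blast
      then have "((\<lambda>y. f (t, x, y)) has_real_derivative ?p (0,0,1) (t, x, - y) * - 1) (at y within {-1..1})"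
      proof (rule real_derivative_within_transform)
        show "f (t, x, z) = f (t, x, - z)" if "z \<in> {-1..1}" for z
          by (rule ev[symmetric]) (use X that in auto)
      qed (use X in auto)
      from has_real_derivative_unique_Icc[OF this partial_s[OF f X]] X show ?thesis by auto
    qed
    have p0: "?p (0,0,1) (t, x, 0) = 0" if "t \<in> {0..T}" for t x
      using odd_y[of t x 0] that by auto
    \<comment> \<open>The even functions are closed under d/ds: f_y is odd, hence f_y = y l with l
      smooth and even, and the s-derivative of f (sqrt (2 s)) is f_y / sqrt (2 s) = l.\<close>
    obtain l where l: "smooth_upto (slab T (-1) 1) l"
      and ly: "\<And>t x y. (t, x, y) \<in> slab T (-1) 1 \<Longrightarrow> ?p (0,0,1) (t, x, y) = y * l (t, x, y)"
      by (rule hadamard[OF sp(3) p0]) auto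
    have ev_l: "l (t, x, - y) = l (t, x, y)" if "(t, x, y) \<in> slab T (-1) 1" for t x y
      using ly[of t x y] ly[of t x "- y"] odd_y[OF that] that by (cases "y = 0") auto
    have L: "even_smooth (?p (1,0,0))" "even_smooth (?p (0,1,0))" "even_smooth l"
      using sp l ev_t ev_x ev_l by (auto simp: even_smooth_def)
    let ?h = "\<lambda>f (t, x, s). f (t, x, sqrt (2 * s)) :: real"
    have cts: "continuous_on {0..1/2} (\<lambda>s. ?h f (t, x, s))" if "t \<in> {0..T}" "smooth_upto (slab T (-1) 1) f" for t x f
      unfolding split_beta
      by (intro continuous_intros continuous_on_compose2[OF smooth_upto_continuous_on[OF that(2)]])
        (use mem that in auto)
    have ds: "((\<lambda>s. k (t, x, s)) has_real_derivative ?h l (t, x, s)) (at s within {0..1/2})"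
      if X: "(t, x, s) \<in> slab T 0 (1/2)" for t x s
    proof -
      have in_d: "((\<lambda>s. k (t, x, s)) has_real_derivative ?h l (t, x, \<sigma>)) (at \<sigma>)"
        if \<sigma>: "\<sigma> \<in> {0<..<1/2}" for \<sigma>
      proof -
        have r: "0 < sqrt (2 * \<sigma>)" "sqrt (2 * \<sigma>) < 1" using \<sigma> by auto
        then have "at (sqrt (2 * \<sigma>)) within {-1..1} = at (sqrt (2 * \<sigma>))"
          by (intro at_within_Icc_at) linarith+
        note r = r this
        have "((\<lambda>y. f (t, x, y)) has_real_derivative ?p (0,0,1) (t, x, sqrt (2 * \<sigma>))) (at (sqrt (2 * \<sigma>)))"
          using partial_s[OF f, of t x "sqrt (2 * \<sigma>)"] X r by auto
        moreover have "((\<lambda>\<sigma>. sqrt (2 * \<sigma>)) has_real_derivative 1 / sqrt (2 * \<sigma>)) (at \<sigma>)"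
        proof -
          have "((*) 2 has_real_derivative 2) (at \<sigma>)"
            by (auto intro!: derivative_eq_intros)
          from DERIV_chain2[OF DERIV_real_sqrt[of "2 * \<sigma>"] this] \<sigma> show ?thesis
            by (simp add: inverse_eq_divide)
        qed
        ultimately have "((\<lambda>\<sigma>. f (t, x, sqrt (2 * \<sigma>))) has_real_derivative
            ?p (0,0,1) (t, x, sqrt (2 * \<sigma>)) * (1 / sqrt (2 * \<sigma>))) (at \<sigma>)"
          by (rule DERIV_chain2)
        then show ?thesis using ly[of t x "sqrt (2 * \<sigma>)"] X r by (simp add: k)
      qed
      \<comment> \<open>The square root is not differentiable at s = 0. The interior derivative is
        integrated from 0, and this integral of a continuous function is then differentiated up to
        the end point.\<close>
      have ftc: "((\<lambda>\<sigma>. ?h l (t, x, \<sigma>)) has_integral (k (t, x, s) - k (t, x, 0))) {0..s}"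
        if "s \<in> {0..1/2}" for s
      proof (rule fundamental_theorem_of_calculus_interior)
        show "continuous_on {0..s} (\<lambda>s. k (t, x, s))"
          using continuous_on_subset[OF cts[OF _ f, of t x]] X that by (auto simp: k)
        show "((\<lambda>s. k (t, x, s)) has_vector_derivative ?h l (t, x, \<sigma>)) (at \<sigma>)" if "\<sigma> \<in> {0<..<s}" for \<sigma>
          using in_d[of \<sigma>] that \<open>s \<in> _\<close> by (auto simp: has_real_derivative_iff_has_vector_derivative)
      qed (use that in auto)
      have "((\<lambda>s. integral {0..s} (\<lambda>\<sigma>. ?h l (t, x, \<sigma>))) has_real_derivative ?h l (t, x, s)) (at s within {0..1/2})"
        using integral_has_real_derivative[OF cts[OF _ l, of t x]] X by auto
      from DERIV_add[OF this DERIV_const[of "k (t, x, 0)"]]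
      have "((\<lambda>s. integral {0..s} (\<lambda>\<sigma>. ?h l (t, x, \<sigma>)) + k (t, x, 0)) has_real_derivative ?h l (t, x, s)) (at s within {0..1/2})"
        by simp
      then show ?thesis
        by (rule real_derivative_within_transform) (use X integral_unique[OF ftc] in auto)
    qed
    show "\<exists>ft fx fs.
     (\<exists>f. even_smooth f \<and> ft = (\<lambda>(t, x, s). f (t, x, sqrt (2 * s)))) \<and>
     (\<exists>f. even_smooth f \<and> fx = (\<lambda>(t, x, s). f (t, x, sqrt (2 * s)))) \<and>
     (\<exists>f. even_smooth f \<and> fs = (\<lambda>(t, x, s). f (t, x, sqrt (2 * s)))) \<and>
     (\<forall>t x s. (t, x, s) \<in> slab T 0 (1/2) \<longrightarrow>
       ((\<lambda>t. k (t, x, s)) has_real_derivative ft (t, x, s)) (at t within {0..T}) \<and>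
       ((\<lambda>x. k (t, x, s)) has_real_derivative fx (t, x, s)) (at x) \<and>
       ((\<lambda>s. k (t, x, s)) has_real_derivative fs (t, x, s)) (at s within {0..1/2}))"
    proof (rule exI[of _ "?h (?p (1,0,0))"], rule exI[of _ "?h (?p (0,1,0))"], rule exI[of _ "?h l"],
        intro conjI allI impI)
      fix t x s assume X: "(t, x, s) \<in> slab T 0 (1/2)"
      show "((\<lambda>s. k (t, x, s)) has_real_derivative ?h l (t, x, s)) (at s within {0..1/2})"
        by (rule ds[OF X])
      show "((\<lambda>t. k (t, x, s)) has_real_derivative ?h (?p (1,0,0)) (t, x, s)) (at t within {0..T})"
        using partial_t[OF f mem[OF X]] by (simp add: k)
      show "((\<lambda>x. k (t, x, s)) has_real_derivative ?h (?p (0,1,0)) (t, x, s)) (at x)"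
        using partial_x[OF f mem[OF X]] by (simp add: k)
    qed ((rule exI, rule conjI, rule L, rule refl)+)
  qed
qed

text \<open>Symmetry of second derivatives that is valid up to the boundary: differentiate
  \<open>f \<tau> \<sigma> = f \<tau> c + (integral of f2 over {c..\<sigma>})\<close> in \<open>\<tau>\<close>.\<close>
lemma mixed_partials:
  fixes f f1 f2 f12 f21 :: "real \<Rightarrow> real \<Rightarrow> real"
  assumes "a < b" "c < d" and \<tau>: "\<tau> \<in> {a..b}" and \<sigma>: "\<sigma> \<in> {c..d}"
    and d1: "\<And>\<tau> \<sigma>. \<tau> \<in> {a..b} \<Longrightarrow> \<sigma> \<in> {c..d} \<Longrightarrow> ((\<lambda>\<tau>. f \<tau> \<sigma>) has_real_derivative f1 \<tau> \<sigma>) (at \<tau> within {a..b})"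
    and d2: "\<And>\<tau> \<sigma>. \<tau> \<in> {a..b} \<Longrightarrow> \<sigma> \<in> {c..d} \<Longrightarrow> ((\<lambda>\<sigma>. f \<tau> \<sigma>) has_real_derivative f2 \<tau> \<sigma>) (at \<sigma> within {c..d})"
    and d12: "\<And>\<tau> \<sigma>. \<tau> \<in> {a..b} \<Longrightarrow> \<sigma> \<in> {c..d} \<Longrightarrow> ((\<lambda>\<sigma>. f1 \<tau> \<sigma>) has_real_derivative f12 \<tau> \<sigma>) (at \<sigma> within {c..d})"
    and d21: "\<And>\<tau> \<sigma>. \<tau> \<in> {a..b} \<Longrightarrow> \<sigma> \<in> {c..d} \<Longrightarrow> ((\<lambda>\<tau>. f2 \<tau> \<sigma>) has_real_derivative f21 \<tau> \<sigma>) (at \<tau> within {a..b})"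
    and c2: "\<And>\<tau>. \<tau> \<in> {a..b} \<Longrightarrow> continuous_on {c..d} (f2 \<tau>)"
    and cont: "continuous_on ({a..b} \<times> {c..d}) (\<lambda>(\<tau>, \<sigma>). f21 \<tau> \<sigma>)"
  shows "f12 \<tau> \<sigma> = f21 \<tau> \<sigma>"
proof -
  have int: "f \<tau> \<sigma> = f \<tau> c + integral {c..\<sigma>} (f2 \<tau>)" if "\<tau> \<in> {a..b}" "\<sigma> \<in> {c..d}" for \<tau> \<sigma>
  proof -
    have "(f2 \<tau> has_integral f \<tau> \<sigma> - f \<tau> c) {c..\<sigma>}"
    proof (rule fundamental_theorem_of_calculus)
      show "(f \<tau> has_vector_derivative f2 \<tau> z) (at z within {c..\<sigma>})" if "z \<in> {c..\<sigma>}" for z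
        using has_field_derivative_subset[OF d2[of \<tau> z], of "{c..\<sigma>}"] that \<open>\<tau> \<in> _\<close> \<open>\<sigma> \<in> _\<close>
        by (auto simp: has_real_derivative_iff_has_vector_derivative)
    qed (use that in auto)
    then show ?thesis by (simp add: integral_unique)
  qed
  have int1: "f1 \<tau> \<sigma>' = f1 \<tau> c + integral {c..\<sigma>'} (f21 \<tau>)" if \<sigma>': "\<sigma>' \<in> {c..d}" for \<sigma>'
  proof (rule has_real_derivative_unique_Icc[OF _ _ \<open>a < b\<close> \<tau>])
    show "((\<lambda>\<tau>. f \<tau> \<sigma>') has_real_derivative f1 \<tau> \<sigma>') (at \<tau> within {a..b})"
      by (rule d1[OF \<tau> \<sigma>'])
    have "((\<lambda>\<tau>. integral (cbox c \<sigma>') (f2 \<tau>)) has_real_derivative integral (cbox c \<sigma>') (f21 \<tau>)) (at \<tau> within {a..b})"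
    proof (rule leibniz_rule_field_derivative)
      show "f2 \<tau> integrable_on cbox c \<sigma>'" if "\<tau> \<in> {a..b}" for \<tau>
        by (rule integrable_continuous, rule continuous_on_subset[OF c2[OF that]]) (use \<sigma>' in auto)
      show "continuous_on ({a..b} \<times> cbox c \<sigma>') (\<lambda>(\<tau>, \<sigma>). f21 \<tau> \<sigma>)"
        by (rule continuous_on_subset[OF cont]) (use \<sigma>' in auto)
    qed (use \<tau> \<sigma>' d21 in auto)
    from DERIV_add[OF d1[OF \<tau>, of c] this] \<open>c < d\<close>
    have "((\<lambda>\<tau>. f \<tau> c + integral {c..\<sigma>'} (f2 \<tau>)) has_real_derivative f1 \<tau> c + integral {c..\<sigma>'} (f21 \<tau>)) (at \<tau> within {a..b})"
      by simp
    then show "((\<lambda>\<tau>. f \<tau> \<sigma>') has_real_derivative f1 \<tau> c + integral {c..\<sigma>'} (f21 \<tau>)) (at \<tau> within {a..b})"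
      by (rule real_derivative_within_transform[OF _ \<tau> int[OF _ \<sigma>']])
  qed
  show ?thesis
  proof (rule has_real_derivative_unique_Icc[OF d12[OF \<tau> \<sigma>] _ \<open>c < d\<close> \<sigma>])
    have "continuous_on {c..d} (f21 \<tau>)"
    proof -
      have "continuous_on {c..d} (\<lambda>\<sigma>. case (\<tau>, \<sigma>) of (\<tau>, \<sigma>) \<Rightarrow> f21 \<tau> \<sigma>)"
        by (rule continuous_on_compose2[OF cont]) (use \<tau> in \<open>auto intro!: continuous_intros\<close>)
      then show ?thesis by simp
    qed
    from DERIV_add[OF DERIV_const[of "f1 \<tau> c"] integral_has_real_derivative[OF this \<sigma>]]
    have "((\<lambda>\<sigma>. f1 \<tau> c + integral {c..\<sigma>} (f21 \<tau>)) has_real_derivative f21 \<tau> \<sigma>) (at \<sigma> within {c..d})"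
      by simp
    then show "((\<lambda>\<sigma>. f1 \<tau> \<sigma>) has_real_derivative f21 \<tau> \<sigma>) (at \<sigma> within {c..d})"
      by (rule real_derivative_within_transform[OF _ \<sigma> int1])
  qed
qed

section \<open>The equations in the variable \<open>s = r\<^sup>2 / 2\<close>\<close>

abbreviation Q :: "(real \<times> real) set" where "Q \<equiv> cbox (0, 0) (1, 1/2)"

locale cylinder =
  fixes T :: real
  assumes T: "T > 0"
begin

abbreviation \<Omega> :: "(point) set" where
  "\<Omega> \<equiv> slab T 0 (1/2)"

abbreviation cell :: "point set" where
  "cell \<equiv> {0..T} \<times> {0..1} \<times> {0..1/2}"

abbreviation Dt :: "field \<Rightarrow> field" where
  "Dt \<equiv> partial \<Omega> (1, 0, 0)"

abbreviation Dx :: "field \<Rightarrow> field" where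
  "Dx \<equiv> partial \<Omega> (0, 1, 0)"

abbreviation Ds :: "field \<Rightarrow> field" where
  "Ds \<equiv> partial \<Omega> (0, 0, 1)"

definition smooth :: "field \<Rightarrow> bool" where
  "smooth f \<longleftrightarrow> smooth_upto \<Omega> f \<and> (\<forall>t x s. (t, x, s) \<in> \<Omega> \<longrightarrow> f (t, x + 1, s) = f (t, x, s))"

lemma smooth_D: "smooth f \<Longrightarrow> smooth_upto \<Omega> f"
  by (simp add: smooth_def)

lemma smooth_periodic: "smooth f \<Longrightarrow> (t, x, s) \<in> \<Omega> \<Longrightarrow> f (t, x + 1, s) = f (t, x, s)"
  by (simp add: smooth_def)

lemmas has_Dt = partial_t[OF smooth_D]
  and has_Dx = partial_x[OF smooth_D]
  and has_Ds = partial_s[OF smooth_D]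
  and smooth_continuous_on = smooth_upto_continuous_on[OF smooth_D]

text \<open>Periodicity passes to the partials because derivatives in one variable, one-sided at end
  points, are unique.\<close>

lemma smooth_partials:
  assumes f: "smooth f"
  shows "smooth (Dt f)" "smooth (Dx f)" "smooth (Ds f)"
proof -
  have sp: "smooth_upto \<Omega> (Dt f)" "smooth_upto \<Omega> (Dx f)" "smooth_upto \<Omega> (Ds f)"
    using smooth_upto_partial[OF smooth_D[OF f]] by (auto simp: Basis_triple)
  have "Dt f (t, x + 1, s) = Dt f (t, x, s)" if X: "(t, x, s) \<in> \<Omega>" for t x s
  proof (rule has_real_derivative_unique_Icc[OF _ has_Dt[OF f X] T])
    show "((\<lambda>t. f (t, x, s)) has_real_derivative Dt f (t, x + 1, s)) (at t within {0..T})"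
    proof (rule real_derivative_within_transform[OF has_Dt[OF f]])
      show "f (t, x, s) = f (t, x + 1, s)" if "t \<in> {0..T}" for t
        using smooth_periodic[OF f, of t x s] X that by simp
    qed (use X in auto)
  qed (use X in auto)
  moreover have "Dx f (t, x + 1, s) = Dx f (t, x, s)" if X: "(t, x, s) \<in> \<Omega>" for t x s
  proof (rule DERIV_unique[OF _ has_Dx[OF f X]])
    have "((\<lambda>x. f (t, x + 1, s)) has_real_derivative Dx f (t, x + 1, s)) (at x)"
      using has_Dx[OF f, of t "x + 1" s] X DERIV_shift[of "\<lambda>x. f (t, x, s)" _ x 1] by auto
    then show "((\<lambda>x. f (t, x, s)) has_real_derivative Dx f (t, x + 1, s)) (at x)"
    proof (rule real_derivative_within_transform)
      show "f (t, x, s) = f (t, x + 1, s)" for x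
        using smooth_periodic[OF f, of t x s] X by simp
    qed auto
  qed
  moreover have "Ds f (t, x + 1, s) = Ds f (t, x, s)" if X: "(t, x, s) \<in> \<Omega>" for t x s
  proof (rule has_real_derivative_unique_Icc[OF _ has_Ds[OF f X]])
    show "((\<lambda>s. f (t, x, s)) has_real_derivative Ds f (t, x + 1, s)) (at s within {0..1/2})"
    proof (rule real_derivative_within_transform[OF has_Ds[OF f]])
      show "f (t, x, s) = f (t, x + 1, s)" if "s \<in> {0..1/2}" for s
        using smooth_periodic[OF f, of t x s] X that by simp
    qed (use X in auto)
  qed (use X in auto)
  ultimately show "smooth (Dt f)" "smooth (Dx f)" "smooth (Ds f)"
    using sp by (auto simp: smooth_def)
qed

lemma
  assumes f: "smooth f"
  shows continuous_slice_s: "t \<in> {0..T} \<Longrightarrow> continuous_on {0..1/2} (\<lambda>s. f (t, x, s))"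
    and continuous_slice_x: "t \<in> {0..T} \<Longrightarrow> s \<in> {0..1/2} \<Longrightarrow> continuous_on A (\<lambda>x. f (t, x, s))"
    and continuous_slice_ts: "continuous_on ({0..T} \<times> {0..1/2}) (\<lambda>(t, s). f (t, x, s))"
    and continuous_slice_xs: "t \<in> {0..T} \<Longrightarrow> continuous_on (A \<times> {0..1/2}) (\<lambda>(x, s). f (t, x, s))"
    and continuous_slice_tx: "s \<in> {0..1/2} \<Longrightarrow> continuous_on ({0..T} \<times> A) (\<lambda>(t, x). f (t, x, s))"
  unfolding split_beta
  by (rule continuous_on_compose2[OF smooth_continuous_on[OF f]], (intro continuous_intros; fail), auto)+

lemma mixed_ts:
  assumes f: "smooth f" and X: "(t, x, s) \<in> \<Omega>"
  shows "Ds (Dt f) (t, x, s) = Dt (Ds f) (t, x, s)"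
proof (rule mixed_partials[where f = "\<lambda>t s. f (t, x, s)" and a = "0" and b = "T" and c = "0" and d = "1/2" and
      ?f1.0 = "\<lambda>t s. Dt f (t, x, s)" and ?f2.0 = "\<lambda>t s. Ds f (t, x, s)" and
      ?f12.0 = "\<lambda>t s. Ds (Dt f) (t, x, s)" and ?f21.0 = "\<lambda>t s. Dt (Ds f) (t, x, s)"], goal_cases)
  case 5 then show ?case using X by (intro has_Dt[OF f]; auto)
next
  case 6 then show ?case using X by (intro has_Ds[OF f]; auto)
next
  case 7 then show ?case using X by (intro has_Ds[OF smooth_partials(1)[OF f]]; auto)
next
  case 8 then show ?case using X by (intro has_Dt[OF smooth_partials(3)[OF f]]; auto)
next
  case 9 then show ?case using X by (intro continuous_slice_s[OF smooth_partials(3)[OF f]]; auto)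
next
  case 10 then show ?case using X by (intro continuous_slice_ts[OF smooth_partials(1)[OF smooth_partials(3)[OF f]]]; auto)
qed (use X T in auto)

lemma mixed_xs:
  assumes f: "smooth f" and X: "(t, x, s) \<in> \<Omega>"
  shows "Ds (Dx f) (t, x, s) = Dx (Ds f) (t, x, s)"
proof (rule mixed_partials[where f = "\<lambda>x s. f (t, x, s)" and a = "x - 1" and b = "x + 1" and c = "0" and d = "1/2" and
      ?f1.0 = "\<lambda>x s. Dx f (t, x, s)" and ?f2.0 = "\<lambda>x s. Ds f (t, x, s)" and
      ?f12.0 = "\<lambda>x s. Ds (Dx f) (t, x, s)" and ?f21.0 = "\<lambda>x s. Dx (Ds f) (t, x, s)"], goal_cases)
  case 5 then show ?case using X by (intro has_field_derivative_at_within[OF has_Dx[OF f]]; auto)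
next
  case 6 then show ?case using X by (intro has_Ds[OF f]; auto)
next
  case 7 then show ?case using X by (intro has_Ds[OF smooth_partials(2)[OF f]]; auto)
next
  case 8 then show ?case using X by (intro has_field_derivative_at_within[OF has_Dx[OF smooth_partials(3)[OF f]]]; auto)
next
  case 9 then show ?case using X by (intro continuous_slice_s[OF smooth_partials(3)[OF f]]; auto)
next
  case 10 then show ?case using X by (intro continuous_slice_xs[OF smooth_partials(2)[OF smooth_partials(3)[OF f]]]; auto)
qed (use X T in auto)

lemma mixed_tx:
  assumes f: "smooth f" and X: "(t, x, s) \<in> \<Omega>"
  shows "Dx (Dt f) (t, x, s) = Dt (Dx f) (t, x, s)"
proof (rule mixed_partials[where f = "\<lambda>t x. f (t, x, s)" and a = "0" and b = "T" and c = "x - 1" and d = "x + 1" and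
      ?f1.0 = "\<lambda>t x. Dt f (t, x, s)" and ?f2.0 = "\<lambda>t x. Dx f (t, x, s)" and
      ?f12.0 = "\<lambda>t x. Dx (Dt f) (t, x, s)" and ?f21.0 = "\<lambda>t x. Dt (Dx f) (t, x, s)"], goal_cases)
  case 5 then show ?case using X by (intro has_Dt[OF f]; auto)
next
  case 6 then show ?case using X by (intro has_field_derivative_at_within[OF has_Dx[OF f]]; auto)
next
  case 7 then show ?case using X by (intro has_field_derivative_at_within[OF has_Dx[OF smooth_partials(1)[OF f]]]; auto)
next
  case 8 then show ?case using X by (intro has_Dt[OF smooth_partials(2)[OF f]]; auto)
next
  case 9 then show ?case using X by (intro continuous_slice_x[OF smooth_partials(2)[OF f]]; auto)
next
  case 10 then show ?case using X by (intro continuous_slice_tx[OF smooth_partials(1)[OF smooth_partials(2)[OF f]]]; auto)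
qed (use X T in auto)

text \<open>The equations are imposed on the open domain only; continuity carries identities to the
  wall, the axis and the end times.\<close>

lemma eq_on_slab:
  fixes f g :: "field"
  assumes "continuous_on \<Omega> f" "continuous_on \<Omega> g"
    and eq: "\<And>t x s. t \<in> {0<..<T} \<Longrightarrow> s \<in> {0<..<1/2} \<Longrightarrow> f (t, x, s) = g (t, x, s)"
    and X: "X \<in> \<Omega>"
  shows "f X = g X"
proof -
  have cl: "closure ({0<..<T} \<times> (UNIV :: real set) \<times> {0<..<1/2 :: real}) = \<Omega>"
    using T by (simp add: closure_Times)
  have "f X - g X = 0"
    by (rule continuous_constant_on_closure[where S = "{0<..<T} \<times> (UNIV :: real set) \<times> {0<..<1/2 :: real}" and f = "\<lambda>X. f X - g X"])
       (use assms in \<open>auto simp: cl intro!: continuous_intros\<close>)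
  then show ?thesis by simp
qed

text \<open>The equations in the variable \<open>s = r\<^sup>2 / 2\<close> with \<open>u\<^sup>r = r k\<close>, so that \<open>r u\<^sup>r = 2 s k\<close>
  and no coefficient is singular on the axis. For \<open>\<epsilon> = 0\<close> this is the hydrostatic system.\<close>
definition euler ::
  "real \<Rightarrow> field \<Rightarrow> field \<Rightarrow> field \<Rightarrow> bool" where
  "euler \<epsilon> U k P \<longleftrightarrow> smooth U \<and> smooth k \<and> smooth P \<and> (\<forall>t x s. (t, x, s) \<in> \<Omega> \<longrightarrow>
     Dt U (t, x, s) + U (t, x, s) * Dx U (t, x, s) + 2 * s * k (t, x, s) * Ds U (t, x, s) = - Dx P (t, x, s) \<and>
     \<epsilon>\<^sup>2 * (Dt k (t, x, s) + U (t, x, s) * Dx k (t, x, s) + 2 * s * k (t, x, s) * Ds k (t, x, s) + (k (t, x, s))\<^sup>2)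
       = - Ds P (t, x, s) \<and>
     Dx U (t, x, s) + 2 * k (t, x, s) + 2 * s * Ds k (t, x, s) = 0)"

text \<open>With \<open>u\<^sup>r = r k\<close> and d/ds = (1/r) d/dr this is \<open>w_resc\<close>;
  for \<epsilon> = 0 it reduces to \<open>w_hyd\<close>.\<close>

definition vort :: "real \<Rightarrow> field \<Rightarrow> field \<Rightarrow> field" where
  "vort \<epsilon> U k X = Ds U X - \<epsilon>\<^sup>2 * Dx k X"

text \<open>Cross-differentiation removes the pressure. Apart from transport there remain
  \<open>Ds U\<close> times the divergence from the first equation and
  \<open>\<epsilon>\<^sup>2 * Dx k\<close> times the divergence from the second, where the
  derivative of k^2 supplies the missing part of the divergence. The case \<epsilon> = 0 gives the
  transport of w.\<close>

lemma vorticity_transport: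
  assumes E: "euler \<epsilon> U k P" and X: "(t, x, s) \<in> \<Omega>"
  shows "(Dt (Ds U) (t, x, s) - \<epsilon>\<^sup>2 * Dt (Dx k) (t, x, s))
    + U (t, x, s) * (Dx (Ds U) (t, x, s) - \<epsilon>\<^sup>2 * Dx (Dx k) (t, x, s))
    + 2 * s * k (t, x, s) * (Ds (Ds U) (t, x, s) - \<epsilon>\<^sup>2 * Ds (Dx k) (t, x, s)) = 0"
proof -
  have sm: "smooth U" "smooth k" "smooth P" and
    m1: "\<And>t x s. (t, x, s) \<in> \<Omega> \<Longrightarrow> Dt U (t, x, s) + U (t, x, s) * Dx U (t, x, s) + 2 * s * k (t, x, s) * Ds U (t, x, s) = - Dx P (t, x, s)"
    and m2: "\<And>t x s. (t, x, s) \<in> \<Omega> \<Longrightarrow> \<epsilon>\<^sup>2 * (Dt k (t, x, s) + U (t, x, s) * Dx k (t, x, s) + 2 * s * k (t, x, s) * Ds k (t, x, s) + (k (t, x, s))\<^sup>2)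
       = - Ds P (t, x, s)"
    and dv: "\<And>t x s. (t, x, s) \<in> \<Omega> \<Longrightarrow> Dx U (t, x, s) + 2 * k (t, x, s) + 2 * s * Ds k (t, x, s) = 0"
    using E by (auto simp: euler_def)
  note sp = smooth_partials[OF sm(1)] smooth_partials[OF sm(2)] smooth_partials[OF sm(3)]
  let ?X = "(t, x, s)"
  have "((\<lambda>s. Dt U (t, x, s) + U (t, x, s) * Dx U (t, x, s) + 2 * s * k (t, x, s) * Ds U (t, x, s)) has_real_derivative
      Ds (Dt U) ?X + (Ds U ?X * Dx U ?X + Ds (Dx U) ?X * U ?X)
      + ((2 * k ?X + Ds k ?X * (2 * s)) * Ds U ?X + Ds (Ds U) ?X * (2 * s * k ?X))) (at s within {0..1/2})"
    by (rule derivative_eq_intros has_Ds[OF sm(1) X] has_Ds[OF sm(2) X] has_Ds[OF sp(1) X] has_Ds[OF sp(2) X] has_Ds[OF sp(3) X] refl | simp)+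
  moreover have "((\<lambda>s. Dt U (t, x, s) + U (t, x, s) * Dx U (t, x, s) + 2 * s * k (t, x, s) * Ds U (t, x, s)) has_real_derivative
      - Ds (Dx P) ?X) (at s within {0..1/2})"
    by (rule real_derivative_within_transform[OF DERIV_minus[OF has_Ds[OF sp(8) X]]]) (use X m1 in auto)
  ultimately have e1: "Ds (Dt U) ?X + (Ds U ?X * Dx U ?X + Ds (Dx U) ?X * U ?X)
      + ((2 * k ?X + Ds k ?X * (2 * s)) * Ds U ?X + Ds (Ds U) ?X * (2 * s * k ?X)) = - Ds (Dx P) ?X"
    by (rule has_real_derivative_unique_Icc) (use X in auto)
  have "((\<lambda>x. \<epsilon>\<^sup>2 * (Dt k (t, x, s) + U (t, x, s) * Dx k (t, x, s) + 2 * s * k (t, x, s) * Ds k (t, x, s) + (k (t, x, s))\<^sup>2)) has_real_derivative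
      \<epsilon>\<^sup>2 * (Dx (Dt k) ?X + (Dx U ?X * Dx k ?X + Dx (Dx k) ?X * U ?X)
      + (2 * s * Dx k ?X * Ds k ?X + Dx (Ds k) ?X * (2 * s * k ?X)) + 2 * k ?X * Dx k ?X)) (at x)"
    by (rule derivative_eq_intros has_Dx[OF sm(1) X] has_Dx[OF sm(2) X] has_Dx[OF sp(4) X] has_Dx[OF sp(5) X] has_Dx[OF sp(6) X] refl | simp)+
  moreover have "((\<lambda>x. \<epsilon>\<^sup>2 * (Dt k (t, x, s) + U (t, x, s) * Dx k (t, x, s) + 2 * s * k (t, x, s) * Ds k (t, x, s) + (k (t, x, s))\<^sup>2)) has_real_derivative
      - Dx (Ds P) ?X) (at x)"
    by (rule real_derivative_within_transform[OF DERIV_minus[OF has_Dx[OF sp(9) X]]]) (use X m2 in auto)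
  ultimately have e2: "\<epsilon>\<^sup>2 * (Dx (Dt k) ?X + (Dx U ?X * Dx k ?X + Dx (Dx k) ?X * U ?X)
      + (2 * s * Dx k ?X * Ds k ?X + Dx (Ds k) ?X * (2 * s * k ?X)) + 2 * k ?X * Dx k ?X) = - Dx (Ds P) ?X"
    by (rule DERIV_unique)
  have "Dt (Ds U) ?X + U ?X * Dx (Ds U) ?X + 2 * s * k ?X * Ds (Ds U) ?X
     + Ds U ?X * (Dx U ?X + 2 * k ?X + 2 * s * Ds k ?X) = - Ds (Dx P) ?X"
    using e1 mixed_ts[OF sm(1) X] mixed_xs[OF sm(1) X] by (simp add: algebra_simps)
  moreover have "\<epsilon>\<^sup>2 * (Dt (Dx k) ?X + U ?X * Dx (Dx k) ?X + 2 * s * k ?X * Ds (Dx k) ?X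
     + Dx k ?X * (Dx U ?X + 2 * k ?X + 2 * s * Ds k ?X)) = - Ds (Dx P) ?X"
    using e2 mixed_tx[OF sm(2) X] mixed_xs[OF sm(2) X] mixed_xs[OF sm(3) X] by (simp add: algebra_simps)
  ultimately show ?thesis
    unfolding dv[OF X] mult_zero_right add_0_right by (simp add: algebra_simps)
qed

section \<open>From the given fields to smooth functions of s\<close>

definition represents ::
  "field \<Rightarrow> field \<Rightarrow>
   (real \<Rightarrow> real \<Rightarrow> real \<Rightarrow> real) \<Rightarrow> (real \<Rightarrow> real \<Rightarrow> real \<Rightarrow> real) \<Rightarrow> bool" where
  "represents U k ux ur \<longleftrightarrow> (\<forall>t\<in>{0..T}. \<forall>x. \<forall>r\<in>{0<..<1}.
     ux t x r = U (t, x, r\<^sup>2 / 2) \<and> ur t x r = r * k (t, x, r\<^sup>2 / 2))"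

text \<open>The plane z = 0, with y as a signed radius, carries all information on an axisymmetric
  field; smoothness across the axis turns into smoothness in y together with parity.\<close>

lemma smooth_upto_meridian:
  assumes "smooth_upto (spacetime_cylinder T) F"
  shows "smooth_upto (slab T (-1) 1) (\<lambda>(t, x, y). F (t, x, y, 0))"
proof -
  let ?L = "\<lambda>X :: point. (fst X, fst (snd X), snd (snd X), 0 :: real)"
  have "bounded_linear ?L"
    by (intro bounded_linear_intros bounded_linear_compose[OF bounded_linear_fst bounded_linear_snd]
        bounded_linear_compose[OF bounded_linear_snd bounded_linear_snd])
  moreover have "?L ` slab T (-1) 1 \<subseteq> spacetime_cylinder T"
    by (auto simp: spacetime_cylinder_def abs_square_le_1)
  ultimately have "smooth_upto (slab T (-1) 1) (\<lambda>X. F (?L X))"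
    by (rule smooth_upto_comp_linear[OF assms])
  then show ?thesis
    by (rule smooth_upto_cong) (auto simp: split_beta)
qed

text \<open>Periodicity is assumed off the axis only, because the quotient of the radial velocity by
  r is read off from the field only there; density of s > 0 supplies it at s = 0.\<close>

lemma smooth_of_even:
  assumes f: "smooth_upto (slab T (-1) 1) f"
    and even: "\<And>t x y. (t, x, y) \<in> slab T (-1) 1 \<Longrightarrow> f (t, x, - y) = f (t, x, y)"
    and per: "\<And>t x y. t \<in> {0..T} \<Longrightarrow> y \<in> {0<..1} \<Longrightarrow> f (t, x + 1, y) = f (t, x, y)"
  shows "smooth (\<lambda>(t, x, s). f (t, x, sqrt (2 * s)))" (is "smooth ?g")
proof -
  have g: "smooth_upto \<Omega> ?g" by (rule smooth_upto_even[OF T f even])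
  have shift: "continuous_on \<Omega> (\<lambda>(t, x, s). ?g (t, x + 1, s))"
  proof -
    have "continuous_on \<Omega> (\<lambda>X. ?g (fst X, fst (snd X) + 1, snd (snd X)))"
      by (rule continuous_on_compose2[OF smooth_upto_continuous_on[OF g]]) (auto intro!: continuous_intros)
    then show ?thesis by (simp add: split_beta)
  qed
  have "(\<lambda>(t, x, s). ?g (t, x + 1, s)) X = ?g X" if "X \<in> \<Omega>" for X
    by (rule eq_on_slab[OF shift smooth_upto_continuous_on[OF g] _ that]) (auto intro: per)
  then show ?thesis using g unfolding smooth_def by force
qed

lemma smooth_fields_represented:
  assumes "smooth_fields T ux ur p"
  obtains U k P where "smooth U" "smooth k" "smooth P" "represents U k ux ur"
    "\<And>t x r. t \<in> {0..T} \<Longrightarrow> r \<in> {0..1} \<Longrightarrow> p t x r = P (t, x, r\<^sup>2 / 2)"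
    "\<And>t x. t \<in> {0..T} \<Longrightarrow> ur t x 1 = k (t, x, 1/2)"
proof -
  have per: "x_periodic T ux" "x_periodic T ur" "x_periodic T p"
    and sv: "smooth_upto (spacetime_cylinder T) (axi_vector ux ur)"
    and sp: "smooth_upto (spacetime_cylinder T) (axi_scalar p)"
    using assms by (auto simp: smooth_fields_def)
  let ?V = "\<lambda>(t, x, y). axi_vector ux ur (t, x, y, 0)"
  let ?u = "\<lambda>(t, x, y). ux t x \<bar>y\<bar>" and ?g = "\<lambda>(t, x, y). ur t x \<bar>y\<bar> * (y / \<bar>y\<bar>)"
    and ?p = "\<lambda>(t, x, y). p t x \<bar>y\<bar>"
  have V: "smooth_upto (slab T (-1) 1) ?V" by (rule smooth_upto_meridian[OF sv])
  have u: "smooth_upto (slab T (-1) 1) ?u"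
    by (rule smooth_upto_cong[OF smooth_upto_linear_comp[OF V bounded_linear_fst]])
       (auto simp: axi_vector_def Let_def)
  have g: "smooth_upto (slab T (-1) 1) ?g"
    by (rule smooth_upto_cong[OF smooth_upto_linear_comp[OF V
          bounded_linear_compose[OF bounded_linear_fst bounded_linear_snd]]])
       (auto simp: axi_vector_def Let_def)
  have p: "smooth_upto (slab T (-1) 1) ?p"
    by (rule smooth_upto_cong[OF smooth_upto_meridian[OF sp]]) (auto simp: axi_scalar_def)
  have g0: "?g (t, x, 0) = 0" for t x by simp
  \<comment> \<open>The radial component is odd in the signed radius and vanishes at y = 0. Dividing
    it by y leaves an even function, which becomes k.\<close>
  obtain l where l: "smooth_upto (slab T (-1) 1) l"
    and gl: "\<And>t x y. (t, x, y) \<in> slab T (-1) 1 \<Longrightarrow> ?g (t, x, y) = y * l (t, x, y)"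
    by (rule hadamard[OF g g0], rule that)
  have ul: "ur t x y = y * l (t, x, y)" if "t \<in> {0..T}" "y \<in> {0<..1}" for t x y
    using gl[of t x y] that by simp
  have even_l: "l (t, x, - y) = l (t, x, y)" if "(t, x, y) \<in> slab T (-1) 1" for t x y
    using gl[of t x y] gl[of t x "- y"] that by (cases "y = 0") (auto simp: field_simps)
  have per_l: "l (t, x + 1, y) = l (t, x, y)" if "t \<in> {0..T}" "y \<in> {0<..1}" for t x y
    using ul[OF that, of x] ul[OF that, of "x + 1"] per(2) that by (auto simp: x_periodic_def)
  show ?thesis
  proof (rule that)
    show "smooth (\<lambda>(t, x, s). ?u (t, x, sqrt (2 * s)))"
      by (rule smooth_of_even[OF u]) (use per in \<open>auto simp: x_periodic_def\<close>)
    show "smooth (\<lambda>(t, x, s). l (t, x, sqrt (2 * s)))"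
      by (rule smooth_of_even[OF l]; rule even_l per_l; assumption)
    show "smooth (\<lambda>(t, x, s). ?p (t, x, sqrt (2 * s)))"
      by (rule smooth_of_even[OF p]) (use per in \<open>auto simp: x_periodic_def\<close>)
    \<comment> \<open>On the axis \<open>axi_vector\<close> discards the value of \<open>ur\<close>,
      so the representation is claimed for r > 0.\<close>
    show "represents (\<lambda>(t, x, s). ?u (t, x, sqrt (2 * s))) (\<lambda>(t, x, s). l (t, x, sqrt (2 * s))) ux ur"
      by (auto simp: represents_def ul)
  qed (auto simp: ul)
qed

lemma interior_square:
  assumes s: "0 < s" "s < 1/2"
  obtains r :: real where "r \<in> {0<..<1}" "r\<^sup>2 / 2 = s"
proof
  have "0 < sqrt (2 * s)" by (rule real_sqrt_gt_zero) (use s in linarith)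
  moreover have "sqrt (2 * s) < sqrt 1" by (rule real_sqrt_less_mono) (use s in linarith)
  ultimately show "sqrt (2 * s) \<in> {0<..<1}" by simp
  show "(sqrt (2 * s))\<^sup>2 / 2 = s" by (subst real_sqrt_pow2) (use s in linarith)+
qed

lemma represented_derivs:
  assumes sm: "smooth U" "smooth k" and rep: "represents U k ux ur"
    and t: "t \<in> {0..T}" and r: "r \<in> {0<..<1}"
  shows "deriv (\<lambda>r. ux t x r) r = r * Ds U (t, x, r\<^sup>2 / 2)"
    and "deriv (\<lambda>r. ur t x r) r = k (t, x, r\<^sup>2 / 2) + r\<^sup>2 * Ds k (t, x, r\<^sup>2 / 2)"
    and "deriv (\<lambda>r. r * ur t x r) r = 2 * r * k (t, x, r\<^sup>2 / 2) + r ^ 3 * Ds k (t, x, r\<^sup>2 / 2)"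
    and "deriv (\<lambda>x. ux t x r) x = Dx U (t, x, r\<^sup>2 / 2)"
    and "deriv (\<lambda>x. ur t x r) x = r * Dx k (t, x, r\<^sup>2 / 2)"
    and "t \<in> {0<..<T} \<Longrightarrow> deriv (\<lambda>t. ux t x r) t = Dt U (t, x, r\<^sup>2 / 2)"
    and "t \<in> {0<..<T} \<Longrightarrow> deriv (\<lambda>t. ur t x r) t = r * Dt k (t, x, r\<^sup>2 / 2)"
    and "deriv (\<lambda>r. (1 / r) * deriv (\<lambda>r. ux t x r) r) r = r * Ds (Ds U) (t, x, r\<^sup>2 / 2)"
proof -
  have ds: "((\<lambda>r. f (t, x, r\<^sup>2 / 2)) has_real_derivative r * Ds f (t, x, r\<^sup>2 / 2)) (at r)"
    if f: "smooth f" and r: "r \<in> {0<..<1}" for f r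
  proof -
    have "0 < r\<^sup>2 / 2" "r\<^sup>2 / 2 < 1 / 2"
      using r by (auto simp: abs_square_less_1)
    then have "((\<lambda>s. f (t, x, s)) has_real_derivative Ds f (t, x, r\<^sup>2 / 2)) (at (r\<^sup>2 / 2))"
      using has_Ds[OF f, of t x "r\<^sup>2 / 2"] t at_within_Icc_at[of 0 "r\<^sup>2 / 2" "1 / 2"] by auto
    moreover have "((\<lambda>r. r\<^sup>2 / 2) has_real_derivative r) (at r)"
      by (auto intro!: derivative_eq_intros)
    ultimately have "((\<lambda>r. f (t, x, r\<^sup>2 / 2)) has_real_derivative Ds f (t, x, r\<^sup>2 / 2) * r) (at r)"
      by (rule DERIV_chain2)
    then show ?thesis by (simp add: mult.commute)
  qed
  have r2: "r\<^sup>2 / 2 \<in> {0..1/2}" using r by (auto simp: power_le_one)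
  have loc: "deriv g r = D"
    if "(f has_real_derivative D) (at r)" "\<And>r. r \<in> {0<..<1} \<Longrightarrow> g r = f r" "r \<in> {0<..<1}" for f g D and r :: real
    by (rule DERIV_imp_deriv, rule has_field_derivative_transform_within_open[OF that(1), of "{0<..<1}"])
       (use that in auto)
  have ux: "ux t x r = U (t, x, r\<^sup>2 / 2)" and ur: "ur t x r = r * k (t, x, r\<^sup>2 / 2)"
    if "t \<in> {0..T}" "r \<in> {0<..<1}" for t x r
    using rep that by (auto simp: represents_def)
  have 1: "deriv (\<lambda>r. ux t x r) r = r * Ds U (t, x, r\<^sup>2 / 2)" if "r \<in> {0<..<1}" for r
    by (rule loc[OF ds[OF sm(1) that]]) (use ux t that in auto)
  show "deriv (\<lambda>r. ux t x r) r = r * Ds U (t, x, r\<^sup>2 / 2)"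
    by (rule 1[OF r])
  show "deriv (\<lambda>r. ur t x r) r = k (t, x, r\<^sup>2 / 2) + r\<^sup>2 * Ds k (t, x, r\<^sup>2 / 2)"
    using DERIV_mult[OF DERIV_ident ds[OF sm(2) r]]
    by (intro loc) (use ur t r in \<open>auto simp: power2_eq_square algebra_simps\<close>)
  show "deriv (\<lambda>r. r * ur t x r) r = 2 * r * k (t, x, r\<^sup>2 / 2) + r ^ 3 * Ds k (t, x, r\<^sup>2 / 2)"
    using DERIV_mult[OF DERIV_ident DERIV_mult[OF DERIV_ident ds[OF sm(2) r]]]
    by (intro loc) (use ur t r in \<open>auto simp: power3_eq_cube power2_eq_square algebra_simps\<close>)
  have "(\<lambda>x. ux t x r) = (\<lambda>x. U (t, x, r\<^sup>2 / 2))" "(\<lambda>x. ur t x r) = (\<lambda>x. r * k (t, x, r\<^sup>2 / 2))"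
    using ux ur t r by auto
  then show "deriv (\<lambda>x. ux t x r) x = Dx U (t, x, r\<^sup>2 / 2)" "deriv (\<lambda>x. ur t x r) x = r * Dx k (t, x, r\<^sup>2 / 2)"
    using has_Dx[OF sm(1), of t x "r\<^sup>2 / 2"] has_Dx[OF sm(2), of t x "r\<^sup>2 / 2"] t r2
    by (auto intro!: DERIV_imp_deriv DERIV_cmult)
  {
    assume t': "t \<in> {0<..<T}"
    have loct: "deriv g t = D"
      if "(f has_real_derivative D) (at t within {0..T})" "\<And>t. t \<in> {0..T} \<Longrightarrow> g t = f t" for f g D
      by (rule DERIV_imp_deriv, rule has_field_derivative_transform_within_open[of f _ _ "{0<..<T}"])
         (use that t' at_within_Icc_at[of 0 t T] in auto)
    show "deriv (\<lambda>t. ux t x r) t = Dt U (t, x, r\<^sup>2 / 2)"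
      by (rule loct[OF has_Dt[OF sm(1)]]) (use t r2 ux r in auto)
    show "deriv (\<lambda>t. ur t x r) t = r * Dt k (t, x, r\<^sup>2 / 2)"
      by (rule loct[OF DERIV_cmult[OF has_Dt[OF sm(2)]]]) (use t r2 ur r in auto)
  }
  show "deriv (\<lambda>r. (1 / r) * deriv (\<lambda>r. ux t x r) r) r = r * Ds (Ds U) (t, x, r\<^sup>2 / 2)"
    by (rule loc[OF ds[OF smooth_partials(3)[OF sm(1)] r]]) (use 1 r in auto)
qed

lemma smooth_eq_on_slab:
  assumes "continuous_on \<Omega> f" "continuous_on \<Omega> g"
    and eq: "\<And>t x r. t \<in> {0<..<T} \<Longrightarrow> r \<in> {0<..<1} \<Longrightarrow> f (t, x, r\<^sup>2 / 2) = (g (t, x, r\<^sup>2 / 2) :: real)"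
    and X: "X \<in> \<Omega>"
  shows "f X = g X"
proof (rule eq_on_slab[OF assms(1,2) _ X])
  fix t x s :: real assume t: "t \<in> {0<..<T}" and "s \<in> {0<..<1/2}"
  then obtain r where "r \<in> {0<..<1}" "r\<^sup>2 / 2 = s" using interior_square[of s] by auto
  then show "f (t, x, s) = g (t, x, s)" using eq[OF t, of r x] by simp
qed

lemma eulerI:
  assumes sm: "smooth U" "smooth k" "smooth P" and rep: "represents U k ux ur"
    and p: "\<And>t x r. t \<in> {0..T} \<Longrightarrow> r \<in> {0..1} \<Longrightarrow> p t x r = P (t, x, r\<^sup>2 / 2)"
    and pde: "\<And>t x r. t \<in> {0<..<T} \<Longrightarrow> r \<in> {0<..<1} \<Longrightarrow>
        dt ux t x r + ux t x r * dx ux t x r + ur t x r * dr ux t x r = - dx p t x r \<and>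
        \<epsilon>\<^sup>2 * (dt ur t x r + ux t x r * dx ur t x r + ur t x r * dr ur t x r) = - dr p t x r \<and>
        dx ux t x r + (1 / r) * dr (\<lambda>t x r. r * ur t x r) t x r = 0"
  shows "euler \<epsilon> U k P"
proof -
  note sp = smooth_partials[OF sm(1)] smooth_partials[OF sm(2)] smooth_partials[OF sm(3)]
  note cont = smooth_continuous_on[OF sm(1)] smooth_continuous_on[OF sm(2)] sp[THEN smooth_continuous_on]
  have repP: "represents P (\<lambda>X. 0) p (\<lambda>t x r. 0)"
    using p by (auto simp: represents_def)
  have sm0: "smooth (\<lambda>X. 0)" by (simp add: smooth_def smooth_upto_const)
  have eq: "Dt U (t, x, r\<^sup>2 / 2) + U (t, x, r\<^sup>2 / 2) * Dx U (t, x, r\<^sup>2 / 2) + 2 * (r\<^sup>2 / 2) * k (t, x, r\<^sup>2 / 2) * Ds U (t, x, r\<^sup>2 / 2)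
        = - Dx P (t, x, r\<^sup>2 / 2)" (is ?e1)
     "\<epsilon>\<^sup>2 * (Dt k (t, x, r\<^sup>2 / 2) + U (t, x, r\<^sup>2 / 2) * Dx k (t, x, r\<^sup>2 / 2)
        + 2 * (r\<^sup>2 / 2) * k (t, x, r\<^sup>2 / 2) * Ds k (t, x, r\<^sup>2 / 2) + (k (t, x, r\<^sup>2 / 2))\<^sup>2) = - Ds P (t, x, r\<^sup>2 / 2)" (is ?e2)
     "Dx U (t, x, r\<^sup>2 / 2) + 2 * k (t, x, r\<^sup>2 / 2) + 2 * (r\<^sup>2 / 2) * Ds k (t, x, r\<^sup>2 / 2) = 0" (is ?e3)
    if tr: "t \<in> {0<..<T}" "r \<in> {0<..<1}" for t x r
  proof -
    have t: "t \<in> {0..T}" and r0: "r \<noteq> 0" using tr by auto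
    have v: "ux t x r = U (t, x, r\<^sup>2 / 2)" "ur t x r = r * k (t, x, r\<^sup>2 / 2)"
      using rep t tr by (auto simp: represents_def)
    note d = represented_derivs[OF sm(1,2) rep t tr(2)]
    note dp = represented_derivs(1,4)[OF sm(3) sm0 repP t tr(2)]
    note e = pde[OF tr, of x, unfolded d(1-5) d(6,7)[OF tr(1)] v dp]
    show ?e1 using e by (simp add: power2_eq_square algebra_simps)
    \<comment> \<open>Since \<open>u\<^sup>r = r k\<close>, the radial momentum equation carries a
      factor r. The term k^2 arises from the radial derivative of r k.\<close>
    have "r * (\<epsilon>\<^sup>2 * (Dt k (t, x, r\<^sup>2 / 2) + U (t, x, r\<^sup>2 / 2) * Dx k (t, x, r\<^sup>2 / 2)
        + 2 * (r\<^sup>2 / 2) * k (t, x, r\<^sup>2 / 2) * Ds k (t, x, r\<^sup>2 / 2) + (k (t, x, r\<^sup>2 / 2))\<^sup>2)) = r * (- Ds P (t, x, r\<^sup>2 / 2))"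
      using e by (simp add: power2_eq_square algebra_simps)
    then show ?e2 by (simp only: mult_left_cancel[OF r0])
    have "(1 / r) * (2 * r * a + r ^ 3 * b) = 2 * a + 2 * (r\<^sup>2 / 2) * b" for a b
      using r0 by (simp add: distrib_left power3_eq_cube power2_eq_square)
    then show ?e3 using e by (simp add: add.assoc)
  qed
  have c1: "continuous_on \<Omega> (\<lambda>X. Dt U X + U X * Dx U X + 2 * snd (snd X) * k X * Ds U X)" and c1': "continuous_on \<Omega> (\<lambda>X. - Dx P X)"
    by (intro continuous_intros cont)+
  have c2: "continuous_on \<Omega> (\<lambda>X. \<epsilon>\<^sup>2 * (Dt k X + U X * Dx k X + 2 * snd (snd X) * k X * Ds k X + (k X)\<^sup>2))" and c2': "continuous_on \<Omega> (\<lambda>X. - Ds P X)"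
    by (intro continuous_intros cont)+
  have c3: "continuous_on \<Omega> (\<lambda>X. Dx U X + 2 * k X + 2 * snd (snd X) * Ds k X)" and c3': "continuous_on \<Omega> (\<lambda>X. 0)"
    by (intro continuous_intros cont)+
  show ?thesis
    unfolding euler_def
  proof (intro conjI allI impI sm)
    fix t x s assume X: "(t, x, s) \<in> \<Omega>"
    show "Dt U (t, x, s) + U (t, x, s) * Dx U (t, x, s) + 2 * s * k (t, x, s) * Ds U (t, x, s) = - Dx P (t, x, s)"
      using smooth_eq_on_slab[where f = "\<lambda>X. Dt U X + U X * Dx U X + 2 * snd (snd X) * k X * Ds U X" and
          g = "\<lambda>X. - Dx P X", OF c1 c1' _ X] eq(1) by simp
    show "\<epsilon>\<^sup>2 * (Dt k (t, x, s) + U (t, x, s) * Dx k (t, x, s) + 2 * s * k (t, x, s) * Ds k (t, x, s) + (k (t, x, s))\<^sup>2)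
       = - Ds P (t, x, s)"
      using smooth_eq_on_slab[where f = "\<lambda>X. \<epsilon>\<^sup>2 * (Dt k X + U X * Dx k X + 2 * snd (snd X) * k X * Ds k X + (k X)\<^sup>2)" and
          g = "\<lambda>X. - Ds P X", OF c2 c2' _ X] eq(2) by simp
    show "Dx U (t, x, s) + 2 * k (t, x, s) + 2 * s * Ds k (t, x, s) = 0"
      using smooth_eq_on_slab[where f = "\<lambda>X. Dx U X + 2 * k X + 2 * snd (snd X) * Ds k X" and
          g = "\<lambda>X. 0", OF c3 c3' _ X] eq(3) by simp
  qed
qed

lemma AREE_euler:
  assumes "AREE_solution \<epsilon> T ux0 ux ur p"
  obtains U k P where "euler \<epsilon> U k P" "represents U k ux ur" "\<And>t x. t \<in> {0..T} \<Longrightarrow> k (t, x, 1/2) = 0"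
proof -
  obtain U k P where *: "smooth U" "smooth k" "smooth P" "represents U k ux ur"
    "\<And>t x r. t \<in> {0..T} \<Longrightarrow> r \<in> {0..1} \<Longrightarrow> p t x r = P (t, x, r\<^sup>2 / 2)"
    "\<And>t x. t \<in> {0..T} \<Longrightarrow> ur t x 1 = k (t, x, 1/2)"
    by (rule smooth_fields_represented[of ux ur p], use assms in \<open>simp add: AREE_solution_def\<close>, rule that)
  show ?thesis
    by (rule that[OF eulerI[OF *(1-5)] *(4)])
       (use assms *(6) in \<open>auto simp: AREE_solution_def\<close>)
qed

text \<open>The hydrostatic system is the case \<epsilon> = 0 of \<open>eulerI\<close>: its second
  equation then says that the pressure does not depend on r.\<close>

lemma AHEE_euler:
  assumes sol: "AHEE_solution T ux0 ux ur p"
  obtains U k P where "euler 0 U k P" "represents U k ux ur" "\<And>t x. t \<in> {0..T} \<Longrightarrow> k (t, x, 1/2) = 0"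
proof -
  obtain U k P where *: "smooth U" "smooth k" "smooth P" "represents U k ux ur"
    "\<And>t x r. t \<in> {0..T} \<Longrightarrow> r \<in> {0..1} \<Longrightarrow> p t x = P (t, x, r\<^sup>2 / 2)"
    "\<And>t x. t \<in> {0..T} \<Longrightarrow> ur t x 1 = k (t, x, 1/2)"
    by (rule smooth_fields_represented[of ux ur "\<lambda>t x r. p t x"], use sol in \<open>simp add: AHEE_solution_def\<close>, rule that)
  have "dr (\<lambda>t x r. p t x) t x r = 0" for t x r by simp
  then show ?thesis
    using sol *(6)
    by (intro that[OF eulerI[OF *(1-4), of "\<lambda>t x r. p t x"] *(4)] *(5))
       (auto simp: AHEE_solution_def)
qed

text \<open>The weight 2 s is r^2, from \<open>u\<^sup>r = r k\<close>, and r dr has become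
  ds.\<close>

definition energy :: "real \<Rightarrow> field \<Rightarrow> field \<Rightarrow>
    field \<Rightarrow> field \<Rightarrow> real \<Rightarrow> real" where
  "energy \<epsilon> U k u l t = integral Q (\<lambda>(x, s). (U (t, x, s) - u (t, x, s))\<^sup>2
     + 2 * s * \<epsilon>\<^sup>2 * (k (t, x, s) - l (t, x, s))\<^sup>2 + (vort \<epsilon> U k (t, x, s) - Ds u (t, x, s))\<^sup>2)"

lemma integral_half_square:
  assumes "continuous_on {0..1/2} (g :: real \<Rightarrow> real)"
  shows "integral {0<..<1} (\<lambda>r. r * g (r\<^sup>2 / 2)) = integral {0..1/2} g"
proof -
  have "((\<lambda>r. r *\<^sub>R g (r\<^sup>2 / 2)) has_integral integral {0\<^sup>2 / 2..1\<^sup>2 / 2} g) {0..1}"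
    by (rule has_integral_substitution[OF _ _ _ assms])
       (auto intro!: derivative_eq_intros simp: power_le_one)
  then show ?thesis by (simp add: integral_unique flip: integral_open_interval_real)
qed

lemma error_energy_eq:
  assumes sm: "smooth U" "smooth k" "smooth u" "smooth l"
    and rep: "represents U k uxe ure" "represents u l ux ur" and t: "t \<in> {0..T}"
  shows "error_energy \<epsilon> uxe ure ux ur t = energy \<epsilon> U k u l t"
proof -
  let ?G = "\<lambda>x s. (U (t, x, s) - u (t, x, s))\<^sup>2
     + 2 * s * \<epsilon>\<^sup>2 * (k (t, x, s) - l (t, x, s))\<^sup>2 + (vort \<epsilon> U k (t, x, s) - Ds u (t, x, s))\<^sup>2"
  note sp = smooth_partials[OF sm(1)] smooth_partials[OF sm(2)] smooth_partials[OF sm(3)]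
  have cont: "continuous_on (cbox (0, 0) (1, 1/2)) (\<lambda>(x, s). ?G x s)"
    unfolding split_beta vort_def cbox_Pair_eq
    using t by (intro continuous_intros continuous_on_compose2[OF smooth_continuous_on] sm sp) auto
  have c: "continuous_on {0..1/2} (?G x)" for x
    unfolding vort_def
    using t by (intro continuous_intros continuous_on_compose2[OF smooth_continuous_on] sm sp) auto
  have "integral {0<..<1} (\<lambda>r. (\<bar>uxe t x r - ux t x r\<bar>\<^sup>2 + \<epsilon>\<^sup>2 * \<bar>ure t x r - ur t x r\<bar>\<^sup>2
        + \<bar>w_resc \<epsilon> uxe ure t x r - w_hyd ux t x r\<bar>\<^sup>2) * r) = integral {0<..<1} (\<lambda>r. r * ?G x (r\<^sup>2 / 2))" for x
  proof (rule integral_cong)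
    fix r :: real assume r: "r \<in> {0<..<1}"
    then have r0: "r \<noteq> 0" by auto
    have v: "uxe t x r = U (t, x, r\<^sup>2 / 2)" "ure t x r = r * k (t, x, r\<^sup>2 / 2)"
       "ux t x r = u (t, x, r\<^sup>2 / 2)" "ur t x r = r * l (t, x, r\<^sup>2 / 2)"
      using rep t r by (auto simp: represents_def)
    have w: "w_resc \<epsilon> uxe ure t x r = vort \<epsilon> U k (t, x, r\<^sup>2 / 2)" "w_hyd ux t x r = Ds u (t, x, r\<^sup>2 / 2)"
      unfolding w_resc_def w_hyd_def vort_def
        represented_derivs(1,5)[OF sm(1,2) rep(1) t r] represented_derivs(1)[OF sm(3,4) rep(2) t r]
      using r0 by simp_all
    show "(\<bar>uxe t x r - ux t x r\<bar>\<^sup>2 + \<epsilon>\<^sup>2 * \<bar>ure t x r - ur t x r\<bar>\<^sup>2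
        + \<bar>w_resc \<epsilon> uxe ure t x r - w_hyd ux t x r\<bar>\<^sup>2) * r = r * ?G x (r\<^sup>2 / 2)"
      unfolding v w power2_abs by (simp add: power2_eq_square algebra_simps)
  qed
  then have "error_energy \<epsilon> uxe ure ux ur t = integral {0..1} (\<lambda>x. integral {0..1/2} (?G x))"
    unfolding error_energy_def by (simp only: integral_half_square[OF c])
  then show ?thesis
    using integral_prod_continuous[OF cont] by (simp add: energy_def)
qed

text \<open>In the variable s the condition bounds the second derivative of U from below. Taking the
  minimum with \<sigma> turns the inequality into an equation, to which the density argument
  applies.\<close>

lemma sign_condition:
  assumes sm: "smooth U" "smooth k" "represents U k ux ur"
    and sign: "\<And>t x r. t \<in> {0..T} \<Longrightarrow> r \<in> {0<..<1} \<Longrightarrow> (1 / r) * dr (\<lambda>t x r. (1 / r) * dr ux t x r) t x r \<ge> \<sigma>"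
    and X: "X \<in> \<Omega>"
  shows "Ds (Ds U) X \<ge> \<sigma>"
proof -
  let ?f = "\<lambda>X. min (Ds (Ds U) X) \<sigma>"
  have "?f X = \<sigma>"
  proof (rule smooth_eq_on_slab[OF _ _ _ X])
    show "continuous_on \<Omega> ?f"
      by (intro continuous_intros smooth_continuous_on smooth_partials sm)
    fix t x r :: real assume t: "t \<in> {0<..<T}" and r: "r \<in> {0<..<1}"
    then show "min (Ds (Ds U) (t, x, r\<^sup>2 / 2)) \<sigma> = \<sigma>"
      using sign[of t r x] represented_derivs(8)[OF sm, of t r x] by auto
  qed auto
  then show ?thesis by linarith
qed

end

section \<open>Elliptic estimates on the periodic cell\<close>

abbreviation strip :: "(real \<times> real) set" where "strip \<equiv> UNIV \<times> {0..1/2}"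

lemma Q_subset_strip: "Q \<subseteq> strip" by (auto simp: cbox_Pair_eq)

lemma strip_continuous_Q: "continuous_on strip f \<Longrightarrow> continuous_on Q f"
  using Q_subset_strip by (rule continuous_on_subset[rotated])

lemma strip_integrable:
  fixes f :: "real \<times> real \<Rightarrow> real"
  shows "continuous_on strip f \<Longrightarrow> f integrable_on Q"
  by (intro integrable_continuous strip_continuous_Q)

lemma integral_Q_le:
  fixes f g :: "real \<times> real \<Rightarrow> real"
  assumes "continuous_on strip f" "continuous_on strip g"
    and "\<And>x s. x \<in> {0..1} \<Longrightarrow> s \<in> {0..1/2} \<Longrightarrow> f (x, s) \<le> g (x, s)"
  shows "integral Q f \<le> integral Q g"
  by (rule integral_le[OF strip_integrable strip_integrable]) (use assms in \<open>auto simp: cbox_Pair_eq\<close>)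

lemma integral_Q_nonneg:
  fixes f :: "real \<times> real \<Rightarrow> real"
  assumes "continuous_on strip f" "\<And>x s. x \<in> {0..1} \<Longrightarrow> s \<in> {0..1/2} \<Longrightarrow> 0 \<le> f (x, s)"
  shows "0 \<le> integral Q f"
  using integral_Q_le[of "\<lambda>_. 0" f] assms by auto

lemma integral_Q_const: "integral Q (\<lambda>X. c) = c / 2" for c :: real
  by (simp add: content_Pair)

lemma integral_Q_combine:
  fixes f g h :: "real \<times> real \<Rightarrow> real"
  assumes "continuous_on strip f" "continuous_on strip g" "continuous_on strip h"
  shows "integral Q f - integral Q g + r * integral Q h = integral Q (\<lambda>X. f X - g X + r * h X)"
proof -
  have "integral Q (\<lambda>X. f X - g X + r * h X) = integral Q (\<lambda>X. f X - g X) + integral Q (\<lambda>X. r * h X)"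
    by (intro integral_add strip_integrable continuous_intros assms)
  also have "integral Q (\<lambda>X. f X - g X) = integral Q f - integral Q g"
    by (intro integral_diff strip_integrable assms)
  finally show ?thesis by simp
qed

text \<open>Integration by parts takes this form throughout, together with
  \<open>integral_ds_eq_0\<close>: a product is differentiated, and its boundary terms cancel by
  periodicity in x or by equal values at s = 0 and s = 1/2.\<close>

lemma integral_dx_eq_0:
  fixes f f' :: "real \<Rightarrow> real \<Rightarrow> real"
  assumes d: "\<And>x s. s \<in> {0..1/2} \<Longrightarrow> ((\<lambda>x. f x s) has_real_derivative f' x s) (at x)"
    and c: "continuous_on strip (\<lambda>(x, s). f' x s)"
    and per: "\<And>s. s \<in> {0..1/2} \<Longrightarrow> f 1 s = f 0 s"
  shows "integral Q (\<lambda>(x, s). f' x s) = 0"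
proof -
  have "integral Q (\<lambda>(x, s). f' x s) = integral (cbox 0 1) (\<lambda>x. integral (cbox 0 (1/2)) (f' x))"
    using integral_prod_continuous[OF strip_continuous_Q[OF c]] by simp
  also have "\<dots> = integral (cbox 0 (1/2)) (\<lambda>s. integral (cbox 0 1) (\<lambda>x. f' x s))"
    by (rule integral_swap_continuous[OF strip_continuous_Q[OF c]])
  also have "\<dots> = integral (cbox 0 (1/2)) (\<lambda>s::real. 0)"
  proof (rule integral_cong)
    fix s :: real assume s: "s \<in> cbox 0 (1/2)"
    have "((\<lambda>x. f' x s) has_integral f 1 s - f 0 s) {0..1}"
      by (rule fundamental_theorem_of_calculus)
         (use d s in \<open>auto simp flip: has_real_derivative_iff_has_vector_derivative intro: has_field_derivative_at_within\<close>)
    then show "integral (cbox 0 1) (\<lambda>x. f' x s) = 0"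
      using per s by (simp add: integral_unique)
  qed
  finally show ?thesis by simp
qed

lemma integral_ds_eq_0:
  fixes f f' :: "real \<Rightarrow> real \<Rightarrow> real"
  assumes d: "\<And>x s. s \<in> {0..1/2} \<Longrightarrow> ((\<lambda>s. f x s) has_real_derivative f' x s) (at s within {0..1/2})"
    and c: "continuous_on strip (\<lambda>(x, s). f' x s)"
    and bc: "\<And>x. f x (1/2) = f x 0"
  shows "integral Q (\<lambda>(x, s). f' x s) = 0"
proof -
  have "integral Q (\<lambda>(x, s). f' x s) = integral (cbox 0 1) (\<lambda>x. integral (cbox 0 (1/2)) (f' x))"
    using integral_prod_continuous[OF strip_continuous_Q[OF c]] by simp
  also have "\<dots> = integral (cbox 0 1) (\<lambda>x::real. 0)"
  proof (rule integral_cong)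
    fix x :: real
    have "(f' x has_integral f x (1/2) - f x 0) {0..1/2}"
      by (rule fundamental_theorem_of_calculus)
         (use d in \<open>auto simp flip: has_real_derivative_iff_has_vector_derivative\<close>)
    then show "integral (cbox 0 (1/2)) (f' x) = 0"
      using bc by (simp add: integral_unique)
  qed
  finally show ?thesis by simp
qed

text \<open>The stream function \<open>B\<close> vanishes on both boundary components because the mean \<open>2 c\<close> of \<open>a\<close> is
  removed; testing the vorticity against \<open>B\<close> recovers the velocity.\<close>
locale perturbation =
  fixes a a_x a_s \<kappa> \<kappa>_x \<kappa>_s h h_x :: "real \<Rightarrow> real \<Rightarrow> real" and e m :: real
  assumes a_x: "\<And>x s. s \<in> {0..1/2} \<Longrightarrow> ((\<lambda>x. a x s) has_real_derivative a_x x s) (at x)"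
    and a_s: "\<And>x s. s \<in> {0..1/2} \<Longrightarrow> ((\<lambda>s. a x s) has_real_derivative a_s x s) (at s within {0..1/2})"
    and \<kappa>_x: "\<And>x s. s \<in> {0..1/2} \<Longrightarrow> ((\<lambda>x. \<kappa> x s) has_real_derivative \<kappa>_x x s) (at x)"
    and \<kappa>_s: "\<And>x s. s \<in> {0..1/2} \<Longrightarrow> ((\<lambda>s. \<kappa> x s) has_real_derivative \<kappa>_s x s) (at s within {0..1/2})"
    and h_x: "\<And>x s. s \<in> {0..1/2} \<Longrightarrow> ((\<lambda>x. h x s) has_real_derivative h_x x s) (at x)"
    and per: "\<And>x s. s \<in> {0..1/2} \<Longrightarrow> a (x + 1) s = a x s \<and> \<kappa> (x + 1) s = \<kappa> x s \<and> h (x + 1) s = h x s"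
    and cont: "continuous_on strip (\<lambda>(x, s). a x s)" "continuous_on strip (\<lambda>(x, s). a_x x s)"
      "continuous_on strip (\<lambda>(x, s). a_s x s)" "continuous_on strip (\<lambda>(x, s). \<kappa> x s)"
      "continuous_on strip (\<lambda>(x, s). \<kappa>_x x s)" "continuous_on strip (\<lambda>(x, s). \<kappa>_s x s)"
      "continuous_on strip (\<lambda>(x, s). h x s)" "continuous_on strip (\<lambda>(x, s). h_x x s)"
    and div: "\<And>x s. s \<in> {0..1/2} \<Longrightarrow> a_x x s + 2 * \<kappa> x s + 2 * s * \<kappa>_s x s = 0"
    and bc: "\<And>x. \<kappa> x (1/2) = 0"
    and e: "e \<ge> 0"
    and m: "\<And>x s. x \<in> {0..1} \<Longrightarrow> s \<in> {0..1/2} \<Longrightarrow> \<bar>h x s\<bar> \<le> m \<and> \<bar>h_x x s\<bar> \<le> m"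
begin

definition c :: real where "c = integral Q (\<lambda>(x, s). a x s)"

definition B :: "real \<Rightarrow> real \<Rightarrow> real" where "B x s = integral {0..s} (a x) - 2 * c * s"

lemma slice: "continuous_on strip (\<lambda>(x, s). f x s) \<Longrightarrow> continuous_on {0..1/2} (f x)"
  for f :: "real \<Rightarrow> real \<Rightarrow> real" and x
proof -
  assume f: "continuous_on strip (\<lambda>(x, s). f x s)"
  have "continuous_on {0..1/2} (\<lambda>s. case (x, s) of (x, s) \<Rightarrow> f x s)"
    by (rule continuous_on_compose2[OF f]) (auto intro!: continuous_intros)
  then show ?thesis by simp
qed

lemma B_s: "s \<in> {0..1/2} \<Longrightarrow> (B x has_real_derivative a x s - 2 * c) (at s within {0..1/2})"
  unfolding B_def by (auto intro!: derivative_eq_intros integral_has_real_derivative slice cont)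

text \<open>Incompressibility says that a_x is the s-derivative of -2 s \<kappa>, and that function
  vanishes at s = 0.\<close>

lemma B_x:
  assumes s: "s \<in> {0..1/2}"
  shows "((\<lambda>x. B x s) has_real_derivative - 2 * s * \<kappa> x s) (at x)"
proof -
  have "((\<lambda>x. integral (cbox 0 s) (a x)) has_real_derivative integral (cbox 0 s) (a_x x)) (at x within UNIV)"
  proof (rule leibniz_rule_field_derivative)
    show "a x integrable_on cbox 0 s" for x
      by (rule integrable_continuous, rule continuous_on_subset[OF slice[OF cont(1)]]) (use s in auto)
    show "continuous_on (UNIV \<times> cbox 0 s) (\<lambda>(x, t). a_x x t)"
      by (rule continuous_on_subset[OF cont(2)]) (use s in auto)
  qed (use s a_x in auto)
  moreover have "(a_x x has_integral - 2 * s * \<kappa> x s - (- 2 * 0 * \<kappa> x 0)) {0..s}"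
  proof (rule fundamental_theorem_of_calculus)
    fix z assume z: "z \<in> {0..s}"
    have "((\<lambda>s. - 2 * s * \<kappa> x s) has_real_derivative a_x x z) (at z within {0..1/2})"
      by (rule derivative_eq_intros \<kappa>_s refl)+ (use z s div[of z x] in \<open>auto simp: algebra_simps\<close>)
    then have "((\<lambda>s. - 2 * s * \<kappa> x s) has_real_derivative a_x x z) (at z within {0..s})"
      by (rule has_field_derivative_subset) (use s in auto)
    then show "((\<lambda>s. - 2 * s * \<kappa> x s) has_vector_derivative a_x x z) (at z within {0..s})"
      by (simp add: has_real_derivative_iff_has_vector_derivative)
  qed (use s in auto)
  ultimately have "((\<lambda>x. integral {0..s} (a x)) has_real_derivative - 2 * s * \<kappa> x s) (at x)"
    by (simp add: integral_unique)
  from DERIV_diff[OF this DERIV_const[of "2 * c * s"]] show ?thesis by (simp add: B_def)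
qed

lemma B_0: "B x 0 = 0" by (simp add: B_def)

text \<open>Since \<kappa> vanishes at s = 1/2, \<open>B_x\<close> makes B constant in x there. Its
  average over x is the integral of a over the cell minus c, which is 0.\<close>

lemma B_half: "B x (1/2) = 0"
proof -
  have const: "B y (1/2) = B 0 (1/2)" for y
    using DERIV_isconst_all[of "\<lambda>x. B x (1/2)" y 0] B_x[of "1/2"] bc by auto
  have "c = integral (cbox 0 1) (\<lambda>x. integral (cbox 0 (1/2)) (a x))"
    unfolding c_def using integral_prod_continuous[OF strip_continuous_Q[OF cont(1)]] by simp
  also have "\<dots> = integral (cbox 0 1) (\<lambda>x::real. B 0 (1/2) + c)"
    using const by (intro integral_cong) (simp add: B_def algebra_simps)
  also have "\<dots> = B 0 (1/2) + c" by simp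
  finally show ?thesis using const by simp
qed

lemma B_per: "s \<in> {0..1/2} \<Longrightarrow> B 1 s = B 0 s"
  unfolding B_def using per[of _ 0] by (auto intro!: integral_cong)

text \<open>Rescaling the variable upper limit to [0, 1] makes B, up to the factor s, a parameter
  integral over a fixed interval, which is jointly continuous.\<close>

lemma B_continuous: "continuous_on strip (\<lambda>(x, s). B x s)"
proof -
  have "B x s = s * integral (cbox 0 1) (\<lambda>\<theta>. a x (\<theta> * s) - 2 * c)" if s: "s \<in> {0..1/2}" for x s
  proof -
    have \<theta>: "\<theta> * s \<in> {0..1/2}" if "\<theta> \<in> {0..1}" for \<theta>
      using that s mult_mono[of \<theta> 1 s "1/2"] by auto
    have "((\<lambda>\<theta>. (a x (\<theta> * s) - 2 * c) * s) has_integral B x (1 * s) - B x (0 * s)) {0..1}"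
    proof (rule fundamental_theorem_of_calculus)
      fix \<theta> :: real assume th: "\<theta> \<in> {0..1}"
      have "(B x has_real_derivative a x (\<theta> * s) - 2 * c) (at (\<theta> * s) within (\<lambda>\<theta>. \<theta> * s) ` {0..1})"
        by (rule has_field_derivative_subset[OF B_s[OF \<theta>[OF th]]]) (use \<theta> in auto)
      moreover have "((\<lambda>\<theta>. \<theta> * s) has_real_derivative s) (at \<theta> within {0..1})"
        by (auto intro!: derivative_eq_intros)
      ultimately have "((\<lambda>\<theta>. B x (\<theta> * s)) has_real_derivative (a x (\<theta> * s) - 2 * c) * s) (at \<theta> within {0..1})"
        by (rule DERIV_image_chain[unfolded o_def, where g = "\<lambda>\<theta>. \<theta> * s" and f = "B x"])
      then show "((\<lambda>\<theta>. B x (\<theta> * s)) has_vector_derivative (a x (\<theta> * s) - 2 * c) * s) (at \<theta> within {0..1})"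
        by (simp add: has_real_derivative_iff_has_vector_derivative)
    qed auto
    from integral_unique[OF this] show ?thesis by (simp add: B_0 mult.commute)
  qed
  moreover have "continuous_on strip (\<lambda>(x, s). s * integral (cbox 0 1) (\<lambda>\<theta>. a x (\<theta> * s) - 2 * c))"
  proof -
    have "continuous_on (strip \<times> cbox 0 1) (\<lambda>X. case (fst (fst X), snd X * snd (fst X)) of (x, s) \<Rightarrow> a x s)"
    proof (rule continuous_on_compose2[OF cont(1)])
      show "(\<lambda>X. (fst (fst X), snd X * snd (fst X))) ` (strip \<times> cbox 0 1) \<subseteq> strip"
        using mult_mono[of _ 1 _ "1/2 :: real"] by force
    qed (intro continuous_intros)
    then have "continuous_on (strip \<times> cbox 0 1) (\<lambda>(X, \<theta>). a (fst X) (\<theta> * snd X) - 2 * c)"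
      by (auto simp: split_beta intro!: continuous_intros)
    from integral_continuous_on_param[OF this] show ?thesis
      by (auto simp: split_beta intro!: continuous_intros)
  qed
  ultimately show ?thesis
    by (subst continuous_on_cong[OF refl]) auto
qed

text \<open>The s-derivative of s B^2 integrates to zero, so the integral of B^2 equals that of -2 s
  B (a - 2 c). As 2 s \<le> 1, this is at most half of each side of the claim, and the B^2 part is
  absorbed.\<close>

lemma poincare: "integral Q (\<lambda>(x, s). (B x s)\<^sup>2) \<le> integral Q (\<lambda>(x, s). (a x s - 2 * c)\<^sup>2)"
proof -
  note ct = cont(1)[unfolded split_beta] B_continuous[unfolded split_beta]
  have 0: "integral Q (\<lambda>(x, s). (B x s)\<^sup>2 + 2 * s * B x s * (a x s - 2 * c)) = 0"
  proof (rule integral_ds_eq_0)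
    show "((\<lambda>s. s * (B x s)\<^sup>2) has_real_derivative (B x s)\<^sup>2 + 2 * s * B x s * (a x s - 2 * c)) (at s within {0..1/2})"
      if "s \<in> {0..1/2}" for x s
      by (rule derivative_eq_intros B_s that refl)+ (simp add: algebra_simps)
  qed (auto simp: B_half split_beta intro!: continuous_intros ct)
  have "integral Q (\<lambda>(x, s). (B x s)\<^sup>2) =
     integral Q (\<lambda>(x, s). (B x s)\<^sup>2 + 2 * s * B x s * (a x s - 2 * c)) + integral Q (\<lambda>(x, s). - (2 * s * B x s * (a x s - 2 * c)))"
    unfolding split_beta
    by (subst integral_add[symmetric]) (auto intro!: strip_integrable continuous_intros ct)
  also have "\<dots> \<le> integral Q (\<lambda>(x, s). (1/2) * (B x s)\<^sup>2 + (1/2) * (a x s - 2 * c)\<^sup>2)"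
    unfolding 0 add_0
  proof (rule integral_Q_le)
    fix x s :: real assume "s \<in> {0..1/2}"
    then have "2 * s * \<bar>B x s * (a x s - 2 * c)\<bar> \<le> 1 * \<bar>B x s * (a x s - 2 * c)\<bar>"
      by (intro mult_right_mono) auto
    then have "- (2 * s * B x s * (a x s - 2 * c)) \<le> \<bar>B x s * (a x s - 2 * c)\<bar>"
      using abs_ge_minus_self[of "2 * s * B x s * (a x s - 2 * c)"] \<open>s \<in> _\<close> by (simp add: abs_mult mult.assoc)
    also have "\<dots> \<le> (1/2) * (B x s)\<^sup>2 + (1/2) * (a x s - 2 * c)\<^sup>2"
      using sum_squares_bound[of "\<bar>B x s\<bar>" "\<bar>a x s - 2 * c\<bar>"] by (simp add: abs_mult)
    finally show "(case (x, s) of (x, s) \<Rightarrow> - (2 * s * B x s * (a x s - 2 * c)))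
      \<le> (case (x, s) of (x, s) \<Rightarrow> (1/2) * (B x s)\<^sup>2 + (1/2) * (a x s - 2 * c)\<^sup>2)" by simp
  qed (auto simp: split_beta intro!: continuous_intros ct)
  also have "\<dots> = (1/2) * integral Q (\<lambda>(x, s). (B x s)\<^sup>2) + (1/2) * integral Q (\<lambda>(x, s). (a x s - 2 * c)\<^sup>2)"
    unfolding split_beta
    by (subst integral_add) (auto intro!: strip_integrable continuous_intros ct)
  finally show ?thesis by simp
qed

text \<open>In the application a and \<kappa> are velocity errors, e = \<epsilon>^2 and h is
  \<open>Dx k\<close> of the reference, so that \<omega> is W - w. Integration by parts against B
  turns a_s B into -(a - 2 c)^2 and \<kappa>_x B into 2 s \<kappa>^2. For the second claim, B_x = -2
  s \<kappa> moves the x-derivative onto h; the integrand e h_x B then yields e^2 by Young's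
  inequality.\<close>

lemma
  defines "\<omega> \<equiv> \<lambda>x s. a_s x s - e * \<kappa>_x x s - e * h x s"
  shows velocity_estimate: "integral Q (\<lambda>(x, s). (a x s - 2 * c)\<^sup>2) + integral Q (\<lambda>(x, s). 2 * s * e * (\<kappa> x s)\<^sup>2)
      \<le> 2 * integral Q (\<lambda>(x, s). (\<omega> x s)\<^sup>2) + e\<^sup>2 * m\<^sup>2" (is "?a + ?k \<le> 2 * ?w + _")
    and forcing_estimate: "\<bar>e * integral Q (\<lambda>(x, s). 2 * s * h x s * \<kappa> x s)\<bar>
      \<le> e\<^sup>2 * m\<^sup>2 + integral Q (\<lambda>(x, s). (a x s - 2 * c)\<^sup>2)"
proof -
  note ct = cont[unfolded split_beta] B_continuous[unfolded split_beta]
  have 1: "integral Q (\<lambda>(x, s). a_s x s * B x s + (a x s - 2 * c)\<^sup>2) = 0"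
  proof (rule integral_ds_eq_0)
    show "((\<lambda>s. (a x s - 2 * c) * B x s) has_real_derivative a_s x s * B x s + (a x s - 2 * c)\<^sup>2) (at s within {0..1/2})"
      if "s \<in> {0..1/2}" for x s
      by (rule derivative_eq_intros B_s a_s that refl)+ (simp add: algebra_simps power2_eq_square)
  qed (auto simp: B_half B_0 split_beta intro!: continuous_intros ct)
  have 2: "integral Q (\<lambda>(x, s). \<kappa>_x x s * B x s - 2 * s * (\<kappa> x s)\<^sup>2) = 0"
  proof (rule integral_dx_eq_0)
    show "((\<lambda>x. \<kappa> x s * B x s) has_real_derivative \<kappa>_x x s * B x s - 2 * s * (\<kappa> x s)\<^sup>2) (at x)"
      if "s \<in> {0..1/2}" for x s
      by (rule derivative_eq_intros B_x \<kappa>_x that refl)+ (simp add: algebra_simps power2_eq_square)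
    show "\<kappa> 1 s * B 1 s = \<kappa> 0 s * B 0 s" if "s \<in> {0..1/2}" for s
      using that B_per[OF that] per[OF that, of 0] by simp
  qed (auto simp: split_beta intro!: continuous_intros ct)
  have 3: "integral Q (\<lambda>(x, s). h_x x s * B x s - 2 * s * h x s * \<kappa> x s) = 0"
  proof (rule integral_dx_eq_0)
    show "((\<lambda>x. h x s * B x s) has_real_derivative h_x x s * B x s - 2 * s * h x s * \<kappa> x s) (at x)"
      if "s \<in> {0..1/2}" for x s
      by (rule derivative_eq_intros B_x h_x that refl)+ (simp add: algebra_simps power2_eq_square)
    show "h 1 s * B 1 s = h 0 s * B 0 s" if "s \<in> {0..1/2}" for s
      using that B_per[OF that] per[OF that, of 0] by simp
  qed (auto simp: split_beta intro!: continuous_intros ct)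
  have int: "f integrable_on Q" if "continuous_on strip f" for f :: "real \<times> real \<Rightarrow> real"
    by (rule strip_integrable[OF that])
  have mult: "x * y \<le> u * x\<^sup>2 + y\<^sup>2 / (4 * u)" if "u > 0" for x y u :: real
  proof -
    have "0 \<le> (2 * u * x - y)\<^sup>2 / (4 * u)" using that by simp
    also have "\<dots> = u * x\<^sup>2 + y\<^sup>2 / (4 * u) - x * y"
      using that by (simp add: power2_eq_square field_simps)
    finally show ?thesis by simp
  qed
  have "?a + ?k = integral Q (\<lambda>(x, s). (a x s - 2 * c)\<^sup>2 + 2 * s * e * (\<kappa> x s)\<^sup>2)"
    unfolding split_beta by (subst integral_add) (auto intro!: int continuous_intros ct)
  also have "\<dots> = integral Q (\<lambda>(x, s). (a x s - 2 * c)\<^sup>2 + 2 * s * e * (\<kappa> x s)\<^sup>2)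
     - integral Q (\<lambda>(x, s). a_s x s * B x s + (a x s - 2 * c)\<^sup>2)
     + e * integral Q (\<lambda>(x, s). \<kappa>_x x s * B x s - 2 * s * (\<kappa> x s)\<^sup>2)"
    by (simp add: 1 2)
  also have "\<dots> = integral Q (\<lambda>(x, s). - (\<omega> x s) * B x s - e * h x s * B x s)"
    by (subst integral_Q_combine, (auto simp: split_beta intro!: continuous_intros ct)[3])
       (auto intro!: integral_cong simp: \<omega>_def algebra_simps)
  \<comment> \<open>Young's inequality is applied twice, each time with B^2 / 4. The resulting B^2 /
    2 becomes half of \<open>?a\<close> through \<open>poincare\<close> and is absorbed on the
    left.\<close>
  also have "\<dots> \<le> integral Q (\<lambda>(x, s). (\<omega> x s)\<^sup>2 + e\<^sup>2 * m\<^sup>2 + (1/2) * (B x s)\<^sup>2)"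
  proof (rule integral_Q_le)
    fix x s :: real assume xs: "x \<in> {0..1}" "s \<in> {0..1/2}"
    have "- (\<omega> x s) * B x s \<le> 1 * (- \<omega> x s)\<^sup>2 + (B x s)\<^sup>2 / (4 * 1)"
      by (rule mult) simp
    moreover have "(- e * h x s) * B x s \<le> 1 * (- e * h x s)\<^sup>2 + (B x s)\<^sup>2 / (4 * 1)"
      by (rule mult) simp
    moreover have "(- e * h x s)\<^sup>2 \<le> e\<^sup>2 * m\<^sup>2"
    proof -
      have "(h x s)\<^sup>2 \<le> m\<^sup>2" using m[OF xs] by (intro abs_le_square_iff[THEN iffD1]) auto
      then show ?thesis by (simp add: power_mult_distrib mult_left_mono)
    qed
    ultimately show "(case (x, s) of (x, s) \<Rightarrow> - (\<omega> x s) * B x s - e * h x s * B x s)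
      \<le> (case (x, s) of (x, s) \<Rightarrow> (\<omega> x s)\<^sup>2 + e\<^sup>2 * m\<^sup>2 + (1/2) * (B x s)\<^sup>2)" by simp
  qed (auto simp: split_beta \<omega>_def intro!: continuous_intros ct)
  also have "\<dots> = ?w - integral Q (\<lambda>X. - (e\<^sup>2 * m\<^sup>2)) + (1/2) * integral Q (\<lambda>(x, s). (B x s)\<^sup>2)"
    by (subst integral_Q_combine, (auto simp: split_beta \<omega>_def intro!: continuous_intros ct)[3])
       (auto intro!: integral_cong)
  also have "\<dots> = ?w + e\<^sup>2 * m\<^sup>2 / 2 + (1/2) * integral Q (\<lambda>(x, s). (B x s)\<^sup>2)"
    unfolding integral_Q_const by simp
  also have "\<dots> \<le> ?w + e\<^sup>2 * m\<^sup>2 / 2 + (1/2) * ?a"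
    using poincare by simp
  finally have *: "?a + ?k \<le> ?w + e\<^sup>2 * m\<^sup>2 / 2 + (1/2) * ?a" .
  have "0 \<le> ?k"
    using e by (intro integral_Q_nonneg) (auto simp: split_beta intro!: continuous_intros ct)
  with * show "?a + ?k \<le> 2 * ?w + e\<^sup>2 * m\<^sup>2" by linarith
  have "integral Q (\<lambda>(x, s). h_x x s * B x s - 2 * s * h x s * \<kappa> x s)
    = integral Q (\<lambda>(x, s). h_x x s * B x s) - integral Q (\<lambda>(x, s). 2 * s * h x s * \<kappa> x s)"
    unfolding split_beta by (intro integral_diff int continuous_intros ct)
  with 3 have "integral Q (\<lambda>(x, s). 2 * s * h x s * \<kappa> x s) = integral Q (\<lambda>(x, s). h_x x s * B x s)"
    by simp
  moreover have "(\<lambda>(x, s). e * h_x x s * B x s) = (\<lambda>X. e * (case X of (x, s) \<Rightarrow> h_x x s * B x s))"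
    by auto
  ultimately have eq: "e * integral Q (\<lambda>(x, s). 2 * s * h x s * \<kappa> x s) = integral Q (\<lambda>(x, s). e * h_x x s * B x s)"
    by (simp only: integral_mult_right)
  have "\<bar>integral Q (\<lambda>(x, s). e * h_x x s * B x s)\<bar> \<le> integral Q (\<lambda>(x, s). e\<^sup>2 * m\<^sup>2 + (B x s)\<^sup>2)"
    unfolding real_norm_def[symmetric]
  proof (rule integral_norm_bound_integral)
    fix X :: "real \<times> real" assume X: "X \<in> Q"
    obtain x s where xs: "X = (x, s)" "x \<in> {0..1}" "s \<in> {0..1/2}" using X by (cases X) (auto simp: cbox_Pair_eq)
    have "\<bar>e * h_x x s\<bar> * \<bar>B x s\<bar> \<le> 1 * \<bar>e * h_x x s\<bar>\<^sup>2 + \<bar>B x s\<bar>\<^sup>2 / (4 * 1)"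
      by (rule mult) simp
    moreover have "\<bar>e * h_x x s\<bar>\<^sup>2 \<le> e\<^sup>2 * m\<^sup>2"
    proof -
      have "(h_x x s)\<^sup>2 \<le> m\<^sup>2" using m[OF xs(2,3)] by (intro abs_le_square_iff[THEN iffD1]) auto
      then show ?thesis by (simp add: power_mult_distrib mult_left_mono)
    qed
    moreover have "\<bar>B x s\<bar>\<^sup>2 / (4 * 1) \<le> (B x s)\<^sup>2" by simp
    ultimately have "\<bar>e * h_x x s\<bar> * \<bar>B x s\<bar> \<le> e\<^sup>2 * m\<^sup>2 + (B x s)\<^sup>2" by linarith
    then show "norm (case X of (x, s) \<Rightarrow> e * h_x x s * B x s) \<le> (case X of (x, s) \<Rightarrow> e\<^sup>2 * m\<^sup>2 + (B x s)\<^sup>2)"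
      unfolding xs by (simp add: abs_mult)
  qed (auto simp: split_beta intro!: int continuous_intros ct)
  also have "\<dots> = e\<^sup>2 * m\<^sup>2 / 2 + integral Q (\<lambda>(x, s). (B x s)\<^sup>2)"
    unfolding split_beta
    by (subst integral_add) (auto intro!: int continuous_intros ct simp: content_Pair)
  also have "\<dots> \<le> e\<^sup>2 * m\<^sup>2 + ?a"
    using poincare mult_nonneg_nonneg[OF zero_le_power2[of e] zero_le_power2[of m]] by linarith
  finally show "\<bar>e * integral Q (\<lambda>(x, s). 2 * s * h x s * \<kappa> x s)\<bar> \<le> e\<^sup>2 * m\<^sup>2 + ?a" unfolding eq .
qed

text \<open>The variance identity. The cell has measure 1/2, so 2 c is the mean and its square
  integrates to 2 c^2.\<close>

lemma mean_estimate: "2 * c\<^sup>2 \<le> integral Q (\<lambda>(x, s). (a x s)\<^sup>2)"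
  and centre_estimate: "integral Q (\<lambda>(x, s). (a x s)\<^sup>2) \<le> integral Q (\<lambda>(x, s). (a x s - 2 * c)\<^sup>2) + 2 * c\<^sup>2"
proof -
  note ct = cont[unfolded split_beta]
  have "integral Q (\<lambda>(x, s). (a x s - 2 * c)\<^sup>2)
     = integral Q (\<lambda>(x, s). (a x s)\<^sup>2) - 4 * c * integral Q (\<lambda>(x, s). a x s) + integral Q (\<lambda>X. 4 * c\<^sup>2)"
    unfolding split_beta integral_mult_right[symmetric]
    by (subst integral_diff[symmetric], (auto intro!: strip_integrable continuous_intros ct)[2],
        subst integral_add[symmetric])
       (auto intro!: strip_integrable continuous_intros ct integral_cong simp: power2_eq_square algebra_simps)
  then have eq: "integral Q (\<lambda>(x, s). (a x s - 2 * c)\<^sup>2) = integral Q (\<lambda>(x, s). (a x s)\<^sup>2) - 2 * c\<^sup>2"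
    unfolding integral_Q_const c_def[symmetric] by (simp add: power2_eq_square)
  then show "integral Q (\<lambda>(x, s). (a x s)\<^sup>2) \<le> integral Q (\<lambda>(x, s). (a x s - 2 * c)\<^sup>2) + 2 * c\<^sup>2" by simp
  have "0 \<le> integral Q (\<lambda>(x, s). (a x s - 2 * c)\<^sup>2)"
    by (intro integral_Q_nonneg) (auto simp: split_beta intro!: continuous_intros ct)
  then show "2 * c\<^sup>2 \<le> integral Q (\<lambda>(x, s). (a x s)\<^sup>2)" using eq by simp
qed

end

section \<open>Calculus for the envelope argument\<close>

lemma increment_lower:
  fixes f f' :: "real \<Rightarrow> real"
  assumes d: "\<And>z. z \<in> {c..d} \<Longrightarrow> (f has_real_derivative f' z) (at z within {c..d})"
    and ab: "a \<in> {c..d}" "b \<in> {c..d}" "a \<le> b"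
    and bd: "\<And>z. z \<in> {c..d} \<Longrightarrow> l \<le> f' z"
  shows "l * (b - a) \<le> f b - f a"
proof (cases "a = b")
  case False
  then have "a < b" using ab by simp
  have "(f has_derivative (*) (f' z)) (at z within {a..b})" if "a \<le> z" "z \<le> b" for z
    using has_field_derivative_subset[OF d[of z], of "{a..b}"] that ab by (auto simp: has_field_derivative_def)
  from mvt_simple[OF \<open>a < b\<close> this] obtain z where z: "z \<in> {a<..<b}" "f b - f a = f' z * (b - a)" by blast
  then show ?thesis using bd[of z] ab by (auto intro: mult_right_mono)
qed simp

lemma increment_abs:
  fixes f f' :: "real \<Rightarrow> real"
  assumes d: "\<And>z. z \<in> {c..d} \<Longrightarrow> (f has_real_derivative f' z) (at z within {c..d})"
    and ab: "a \<in> {c..d}" "b \<in> {c..d}" and bd: "\<And>z. z \<in> {c..d} \<Longrightarrow> \<bar>f' z\<bar> \<le> L"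
  shows "\<bar>f b - f a\<bar> \<le> L * \<bar>b - a\<bar>"
proof -
  have *: "\<bar>f b - f a\<bar> \<le> L * \<bar>b - a\<bar>" if "a \<in> {c..d}" "b \<in> {c..d}" "a \<le> b" for a b
  proof -
    have "-L * (b - a) \<le> f b - f a"
      by (rule increment_lower[OF d that]) (use bd in \<open>auto simp: abs_le_iff minus_le_iff\<close>)
    moreover have "-L * (b - a) \<le> - f b - - f a"
      by (rule increment_lower[OF DERIV_minus[OF d] that]) (use bd in \<open>auto simp: abs_le_iff\<close>)
    ultimately show ?thesis using \<open>a \<le> b\<close> by (simp add: abs_le_iff)
  qed
  show ?thesis using *[of a b] *[of b a] ab by (cases "a \<le> b") (auto simp: abs_minus_commute)
qed

text \<open>After subtraction of the tangent and the parabola the derivative has the sign of z - a,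
  by the monotonicity that the bound on f'' gives; hence a is a minimizer, also when it is an end
  point.\<close>

lemma taylor2_lower:
  fixes f f' f'' :: "real \<Rightarrow> real"
  assumes d: "\<And>z. z \<in> {c..d} \<Longrightarrow> (f has_real_derivative f' z) (at z within {c..d})"
    and d2: "\<And>z. z \<in> {c..d} \<Longrightarrow> (f' has_real_derivative f'' z) (at z within {c..d})"
    and ab: "a \<in> {c..d}" "b \<in> {c..d}"
    and bd: "\<And>z. z \<in> {c..d} \<Longrightarrow> l \<le> f'' z"
  shows "l / 2 * (b - a)\<^sup>2 \<le> f b - f a - f' a * (b - a)"
proof -
  define g where "g z = f z - f' a * z - l / 2 * (z - a)\<^sup>2" for z
  have g: "(g has_real_derivative f' z - f' a - l * (z - a)) (at z within {c..d})" if "z \<in> {c..d}" for z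
    unfolding g_def by (rule derivative_eq_intros d that refl)+ (simp add: algebra_simps)
  have f': "l * (y - x) \<le> f' y - f' x" if "x \<in> {c..d}" "y \<in> {c..d}" "x \<le> y" for x y
    by (rule increment_lower[OF d2 that bd])
  have "g a \<le> g b"
  proof (cases "a = b")
    case False
    let ?x = "min a b" and ?y = "max a b"
    have xy: "?x < ?y" using False by simp
    have "(g has_derivative (*) (f' z - f' a - l * (z - a))) (at z within {?x..?y})" if "?x \<le> z" "z \<le> ?y" for z
      using has_field_derivative_subset[OF g[of z], of "{?x..?y}"] that ab
      by (auto simp: has_field_derivative_def min_def max_def split: if_splits)
    from mvt_simple[OF xy this] obtain z where z: "z \<in> {?x<..<?y}"
      and eq: "g ?y - g ?x = (f' z - f' a - l * (z - a)) * (?y - ?x)" by blast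
    have zc: "z \<in> {c..d}" using z ab by auto
    show ?thesis
    proof (cases "a < b")
      case True
      then have "0 \<le> f' z - f' a - l * (z - a)" using f'[OF ab(1) zc] z by auto
      then have "0 \<le> g ?y - g ?x" unfolding eq using xy by (intro mult_nonneg_nonneg) auto
      then show ?thesis using True by auto
    next
      case b: False
      then have "f' z - f' a - l * (z - a) \<le> 0" using f'[OF zc ab(1)] z by (auto simp: algebra_simps)
      then have "g ?y - g ?x \<le> 0" unfolding eq using xy by (intro mult_nonpos_nonneg) auto
      then show ?thesis using b by auto
    qed
  qed simp
  then show ?thesis by (simp add: g_def algebra_simps)
qed

lemma taylor2_upper:
  fixes f f' f'' :: "real \<Rightarrow> real"
  assumes d: "\<And>z. z \<in> {c..d} \<Longrightarrow> (f has_real_derivative f' z) (at z within {c..d})"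
    and d2: "\<And>z. z \<in> {c..d} \<Longrightarrow> (f' has_real_derivative f'' z) (at z within {c..d})"
    and ab: "a \<in> {c..d}" "b \<in> {c..d}"
    and bd: "\<And>z. z \<in> {c..d} \<Longrightarrow> f'' z \<le> L"
  shows "f b - f a - f' a * (b - a) \<le> L / 2 * (b - a)\<^sup>2"
  using taylor2_lower[OF DERIV_minus[OF d] DERIV_minus[OF d2] ab, of "-L"] bd by simp

text \<open>Maximality at y and at z sandwiches the increment of the maximum between the increments
  of \<psi> with \<sigma> frozen at S z and at S y. By the mean value theorem both are (y - z) times
  a value of \<psi>' near \<open>\<psi>' z (S z)\<close>. Only continuity of the maximizer
  enters.\<close>

lemma danskin:
  fixes \<psi> \<psi>' :: "real \<Rightarrow> real \<Rightarrow> real" and S :: "real \<Rightarrow> real"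
  assumes z: "z \<in> A" and A: "convex A"
    and d: "\<And>\<tau> \<sigma>. \<tau> \<in> A \<Longrightarrow> \<sigma> \<in> K \<Longrightarrow> ((\<lambda>\<tau>. \<psi> \<tau> \<sigma>) has_real_derivative \<psi>' \<tau> \<sigma>) (at \<tau> within A)"
    and S: "\<And>\<tau>. \<tau> \<in> A \<Longrightarrow> S \<tau> \<in> K"
    and max: "\<And>\<tau> \<sigma>. \<tau> \<in> A \<Longrightarrow> \<sigma> \<in> K \<Longrightarrow> \<psi> \<tau> \<sigma> \<le> \<psi> \<tau> (S \<tau>)"
    and contS: "continuous_on A S"
    and cont: "continuous_on (A \<times> K) (\<lambda>(\<tau>, \<sigma>). \<psi>' \<tau> \<sigma>)"
  shows "((\<lambda>\<tau>. \<psi> \<tau> (S \<tau>)) has_real_derivative \<psi>' z (S z)) (at z within A)"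
  unfolding has_field_derivative_def has_derivative_within_alt
proof (intro conjI allI impI)
  show "bounded_linear ((*) (\<psi>' z (S z)))" by (rule bounded_linear_mult_right)
  fix e :: real assume e: "e > 0"
  let ?L = "\<psi>' z (S z)"
  have mvt: "\<exists>\<xi>\<in>A. \<bar>\<xi> - z\<bar> \<le> \<bar>\<tau> - z\<bar> \<and> \<psi> \<tau> \<sigma> - \<psi> z \<sigma> = \<psi>' \<xi> \<sigma> * (\<tau> - z)"
    if \<tau>: "\<tau> \<in> A" and \<sigma>: "\<sigma> \<in> K" for \<tau> \<sigma>
  proof (cases "\<tau> = z")
    case True
    then show ?thesis using z by (intro bexI[of _ z]) auto
  next
    case False
    let ?x = "min \<tau> z" and ?y = "max \<tau> z"
    have sub: "{?x..?y} \<subseteq> A"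
      using A z \<tau> by (metis closed_segment_eq_real_ivl closed_segment_subset min_def max_def linorder_linear)
    have xy: "?x < ?y" using False by simp
    have "((\<lambda>\<tau>. \<psi> \<tau> \<sigma>) has_derivative (*) (\<psi>' w \<sigma>)) (at w within {?x..?y})" if "?x \<le> w" "w \<le> ?y" for w
      using has_field_derivative_subset[OF d[OF _ \<sigma>] sub, of w] that sub by (auto simp: has_field_derivative_def)
    from mvt_simple[OF xy this] obtain w where w: "w \<in> {?x<..<?y}"
      and eq: "\<psi> ?y \<sigma> - \<psi> ?x \<sigma> = \<psi>' w \<sigma> * (?y - ?x)" by blast
    have "\<psi> \<tau> \<sigma> - \<psi> z \<sigma> = \<psi>' w \<sigma> * (\<tau> - z)"
      using eq by (cases "\<tau> \<le> z") (auto simp: algebra_simps max_def min_def)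
    moreover have "w \<in> A" "\<bar>w - z\<bar> \<le> \<bar>\<tau> - z\<bar>" using w sub by (auto simp: max_def min_def split: if_splits)
    ultimately show ?thesis by blast
  qed
  obtain \<delta> where \<delta>: "\<delta> > 0" "\<And>\<xi> \<sigma>. \<xi> \<in> A \<Longrightarrow> \<sigma> \<in> K \<Longrightarrow> dist (\<xi>, \<sigma>) (z, S z) < \<delta> \<Longrightarrow> dist (\<psi>' \<xi> \<sigma>) ?L < e"
    using cont[unfolded continuous_on_iff, rule_format, of "(z, S z)" e] z S[OF z] e by force
  obtain \<delta>' where \<delta>': "\<delta>' > 0" "\<And>\<tau>. \<tau> \<in> A \<Longrightarrow> dist \<tau> z < \<delta>' \<Longrightarrow> dist (S \<tau>) (S z) < \<delta> / 2"
    using contS[unfolded continuous_on_iff, rule_format, OF z, of "\<delta> / 2"] \<delta>(1) by auto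
  have close: "\<bar>\<psi>' \<xi> \<sigma> - ?L\<bar> \<le> e"
    if "\<xi> \<in> A" "\<sigma> \<in> K" "\<bar>\<xi> - z\<bar> < \<delta> / 2" "dist \<sigma> (S z) < \<delta> / 2" for \<xi> \<sigma>
  proof -
    have "dist (\<xi>, \<sigma>) (z, S z) \<le> \<bar>\<xi> - z\<bar> + dist \<sigma> (S z)"
      unfolding dist_Pair_Pair using sqrt_sum_squares_le_sum[of "dist \<xi> z" "dist \<sigma> (S z)"] by (simp add: dist_real_def)
    then show ?thesis using \<delta>(2)[OF that(1,2)] that(3,4) by (simp add: dist_real_def)
  qed
  show "\<exists>d>0. \<forall>y\<in>A. norm (y - z) < d \<longrightarrow> norm (\<psi> y (S y) - \<psi> z (S z) - ?L * (y - z)) \<le> e * norm (y - z)"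
  proof (intro exI[of _ "min (\<delta> / 2) \<delta>'"] conjI ballI impI)
    fix y assume y: "y \<in> A" "norm (y - z) < min (\<delta> / 2) \<delta>'"
    have Sy: "dist (S y) (S z) < \<delta> / 2" using \<delta>'(2)[OF y(1)] y(2) by (simp add: dist_real_def)
    have bound: "\<bar>q * (y - z) - ?L * (y - z)\<bar> \<le> e * \<bar>y - z\<bar>" if "\<bar>q - ?L\<bar> \<le> e" for q
      using mult_right_mono[OF that, of "\<bar>y - z\<bar>"] by (simp add: abs_mult[symmetric] algebra_simps)
    obtain \<xi> where \<xi>: "\<xi> \<in> A" "\<bar>\<xi> - z\<bar> \<le> \<bar>y - z\<bar>" "\<psi> y (S z) - \<psi> z (S z) = \<psi>' \<xi> (S z) * (y - z)"
      using mvt[OF y(1) S[OF z]] by blast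
    obtain \<xi>' where \<xi>': "\<xi>' \<in> A" "\<bar>\<xi>' - z\<bar> \<le> \<bar>y - z\<bar>" "\<psi> y (S y) - \<psi> z (S y) = \<psi>' \<xi>' (S y) * (y - z)"
      using mvt[OF y(1) S[OF y(1)]] by blast
    have b1: "\<bar>\<psi>' \<xi> (S z) * (y - z) - ?L * (y - z)\<bar> \<le> e * \<bar>y - z\<bar>"
      by (rule bound, rule close) (use \<xi> y S[OF z] \<delta>(1) in auto)
    have b2: "\<bar>\<psi>' \<xi>' (S y) * (y - z) - ?L * (y - z)\<bar> \<le> e * \<bar>y - z\<bar>"
      by (rule bound, rule close) (use \<xi>' y S[OF y(1)] Sy in auto)
    show "norm (\<psi> y (S y) - \<psi> z (S z) - ?L * (y - z)) \<le> e * norm (y - z)"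
      using b1 b2 \<xi>(3) \<xi>'(3) max[OF y(1) S[OF z]] max[OF z S[OF y(1)]]
      unfolding real_norm_def abs_le_iff by linarith
  qed (use \<delta> \<delta>' in auto)
qed

text \<open>Squaring removes the kink of the positive part; this is what glues the quadratic
  extension to the Legendre transform in a C^1 way.\<close>

lemma half_square_pos_part:
  fixes f :: "real \<Rightarrow> real"
  assumes f: "(f has_real_derivative D) (at z within A)"
  shows "((\<lambda>z. (max 0 (f z))\<^sup>2 / 2) has_real_derivative max 0 (f z) * D) (at z within A)"
proof -
  have "((\<lambda>y. (max 0 y)\<^sup>2 / 2) has_real_derivative max 0 y) (at y)" for y :: real
  proof (cases "y = 0")
    case True
    have "\<exists>d>0. \<forall>y. \<bar>y\<bar> < d \<longrightarrow> \<bar>(max 0 y)\<^sup>2 / 2\<bar> \<le> e * \<bar>y\<bar>" if "e > 0" for e :: real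
    proof (intro exI[of _ e] conjI allI impI)
      fix y :: real assume "\<bar>y\<bar> < e"
      then have "\<bar>y\<bar> * \<bar>y\<bar> \<le> e * \<bar>y\<bar>" by (intro mult_right_mono) auto
      moreover have "(max 0 y)\<^sup>2 \<le> \<bar>y\<bar> * \<bar>y\<bar>" by (auto simp: max_def power2_eq_square)
      ultimately have "(max 0 y)\<^sup>2 / 2 \<le> e * \<bar>y\<bar>"
        using mult_nonneg_nonneg[of e "\<bar>y\<bar>"] \<open>e > 0\<close> by linarith
      then show "\<bar>(max 0 y)\<^sup>2 / 2\<bar> \<le> e * \<bar>y\<bar>" by simp
    qed (rule that)
    then show ?thesis
      unfolding True has_field_derivative_def has_derivative_within_alt by (auto intro: bounded_linear_mult_right)
  next
    case False
    show ?thesis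
    proof (cases "y > 0")
      case True
      have "((\<lambda>y. y\<^sup>2 / 2) has_real_derivative max 0 y) (at y)"
        using True by (auto intro!: derivative_eq_intros)
      then show ?thesis
        by (rule has_field_derivative_transform_within_open[of _ _ _ "{0<..}"]) (use True in auto)
    next
      case y: False
      have "((\<lambda>y. 0) has_real_derivative max 0 y) (at y)"
        using y False by (auto intro!: derivative_eq_intros)
      then show ?thesis
        by (rule has_field_derivative_transform_within_open[of _ _ _ "{..<0}"]) (use y False in auto)
    qed
  qed
  from DERIV_chain2[OF this f] show ?thesis .
qed

section \<open>The Fenchel gap of a convex profile\<close>

text \<open>The two bounds are kept apart: M enters the rates and comparison constants, while m
  measures the forcing alone and can be taken to be 0 for a steady shear.\<close>

locale reference = cylinder +
  fixes u k p :: "field" and \<sigma> M m :: real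
  assumes reference: "euler 0 u k p"
    and k_half: "\<And>t x. t \<in> {0..T} \<Longrightarrow> k (t, x, 1/2) = 0"
    and \<sigma>: "\<sigma> > 0"
    and convex: "\<And>X. X \<in> \<Omega> \<Longrightarrow> Ds (Ds u) X \<ge> \<sigma>"
    and M: "\<And>X. X \<in> cell \<Longrightarrow> \<bar>Ds u X\<bar> \<le> M \<and> \<bar>Ds (Ds u) X\<bar> \<le> M \<and>
        \<bar>Dx u X\<bar> \<le> M \<and> \<bar>Ds (Dx u) X\<bar> \<le> M \<and> \<bar>Dx (Ds u) X\<bar> \<le> M"
    and m: "\<And>X. X \<in> cell \<Longrightarrow> \<bar>Dx k X\<bar> \<le> m \<and> \<bar>Dx (Dx k) X\<bar> \<le> m"
begin

lemma smooth_u: "smooth u" and smooth_k: "smooth k"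
  using reference by (auto simp: euler_def)

lemma M_nonneg: "M \<ge> 0"
  using M[of "(0, 0, 0)"] T by auto

text \<open>This is r times the radial velocity. It vanishes at both ends of the slice and its
  s-derivative is -\<open>Dx u\<close>, so that bounds on derivatives of u also control its
  increments.\<close>

definition \<rho> :: "field" where "\<rho> X = 2 * snd (snd X) * k X"

lemma \<rho>_s:
  assumes "(t, x, s) \<in> \<Omega>"
  shows "((\<lambda>s. \<rho> (t, x, s)) has_real_derivative - Dx u (t, x, s)) (at s within {0..1/2})"
proof -
  have "((\<lambda>s. \<rho> (t, x, s)) has_real_derivative 2 * k (t, x, s) + Ds k (t, x, s) * (2 * s)) (at s within {0..1/2})"
    unfolding \<rho>_def snd_conv by (rule derivative_eq_intros has_Ds[OF smooth_k assms] refl)+ simp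
  moreover have "Dx u (t, x, s) + 2 * k (t, x, s) + 2 * s * Ds k (t, x, s) = 0"
    using reference assms by (auto simp: euler_def)
  then have "2 * k (t, x, s) + Ds k (t, x, s) * (2 * s) = - Dx u (t, x, s)" by (simp add: algebra_simps)
  ultimately show ?thesis by simp
qed

lemma \<rho>_boundary: "t \<in> {0..T} \<Longrightarrow> \<rho> (t, x, 0) = 0" "t \<in> {0..T} \<Longrightarrow> \<rho> (t, x, 1/2) = 0"
  by (simp_all add: \<rho>_def k_half)

lemma w_increasing:
  assumes t: "t \<in> {0..T}" and ab: "a \<in> {0..1/2}" "b \<in> {0..1/2}" "a \<le> b"
  shows "\<sigma> * (b - a) \<le> Ds u (t, x, b) - Ds u (t, x, a)"
  by (rule increment_lower[OF has_Ds[OF smooth_partials(3)[OF smooth_u]] ab]) (use t convex in auto)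

lemma w_monotone:
  assumes t: "t \<in> {0..T}" and ab: "a \<in> {0..1/2}" "b \<in> {0..1/2}"
  shows "\<sigma> * (b - a)\<^sup>2 \<le> (Ds u (t, x, b) - Ds u (t, x, a)) * (b - a)"
proof (cases "a \<le> b")
  case True
  then show ?thesis
    using mult_right_mono[OF w_increasing[OF t ab, of x], of "b - a"] by (simp add: power2_eq_square mult.assoc)
next
  case False
  then show ?thesis
    using mult_right_mono[OF w_increasing[OF t ab(2,1), of x], of "a - b"] by (simp add: power2_eq_square algebra_simps)
qed

text \<open>The first-order condition for maximizing s \<omega> - u (t, x, s) over [0, 1/2]. A
  single family of closed inequalities covers interior and clipped maximizers, which makes the graph
  of the maximizer closed.\<close>

definition variational :: "real \<Rightarrow> real \<Rightarrow> real \<Rightarrow> real \<Rightarrow> bool" where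
  "variational t x \<omega> s \<longleftrightarrow> s \<in> {0..1/2} \<and> (\<forall>\<tau>\<in>{0..1/2}. (\<omega> - Ds u (t, x, s)) * (\<tau> - s) \<le> 0)"

lemma variational_exists:
  assumes t: "t \<in> {0..T}"
  shows "\<exists>s. variational t x \<omega> s"
proof -
  consider "\<omega> \<le> Ds u (t, x, 0)" | "\<omega> \<ge> Ds u (t, x, 1/2)" | "Ds u (t, x, 0) \<le> \<omega>" "\<omega> \<le> Ds u (t, x, 1/2)"
    by linarith
  then show ?thesis
  proof cases
    case 1
    then have "variational t x \<omega> 0" unfolding variational_def by (auto intro: mult_nonpos_nonneg)
    then show ?thesis ..
  next
    case 2
    then have "variational t x \<omega> (1/2)" unfolding variational_def by (auto intro: mult_nonneg_nonpos)
    then show ?thesis ..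
  next
    case 3
    obtain s where "0 \<le> s" "s \<le> 1/2" "Ds u (t, x, s) = \<omega>"
      using IVT'[of "\<lambda>s. Ds u (t, x, s)" 0 \<omega> "1/2"] 3 continuous_slice_s[OF smooth_partials(3)[OF smooth_u] t]
      by auto
    then have "variational t x \<omega> s" unfolding variational_def by auto
    then show ?thesis ..
  qed
qed

lemma variational_unique:
  assumes t: "t \<in> {0..T}" and s: "variational t x \<omega> s" "variational t x \<omega> s'"
  shows "s = s'"
proof -
  have mem: "s \<in> {0..1/2}" "s' \<in> {0..1/2}" using s by (auto simp: variational_def)
  have "(\<omega> - Ds u (t, x, s)) * (s' - s) \<le> 0" "(\<omega> - Ds u (t, x, s')) * (s - s') \<le> 0"
    using s mem by (auto simp: variational_def)
  then have "(Ds u (t, x, s') - Ds u (t, x, s)) * (s' - s) \<le> 0" by (simp add: algebra_simps)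
  with w_monotone[OF t mem, of x] have "\<sigma> * (s' - s)\<^sup>2 \<le> 0" by linarith
  then show ?thesis using \<sigma> by (simp add: mult_le_0_iff)
qed

text \<open>The slice \<open>s \<mapsto> u (t, x, s)\<close> is convex with derivative \<open>w\<close>; \<open>sel t x \<omega>\<close> is the point where \<open>w\<close> takes
  the value \<open>\<omega>\<close>, clipped to \<open>[0, 1/2]\<close>, i.e. the maximizer in the Legendre transform of this slice.\<close>
definition sel :: "real \<Rightarrow> real \<Rightarrow> real \<Rightarrow> real" where
  "sel t x \<omega> = (SOME s. variational t x \<omega> s)"

lemma
  assumes t: "t \<in> {0..T}"
  shows sel_mem: "sel t x \<omega> \<in> {0..1/2}"
    and sel_variational: "\<tau> \<in> {0..1/2} \<Longrightarrow> (\<omega> - Ds u (t, x, sel t x \<omega>)) * (\<tau> - sel t x \<omega>) \<le> 0"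
    and variational_sel: "variational t x \<omega> (sel t x \<omega>)"
proof -
  show *: "variational t x \<omega> (sel t x \<omega>)"
    unfolding sel_def by (rule someI_ex[OF variational_exists[OF t]])
  then show "sel t x \<omega> \<in> {0..1/2}"
    and "\<tau> \<in> {0..1/2} \<Longrightarrow> (\<omega> - Ds u (t, x, sel t x \<omega>)) * (\<tau> - sel t x \<omega>) \<le> 0"
    by (simp_all add: variational_def)
qed

lemma sel_max:
  assumes t: "t \<in> {0..T}" and \<tau>: "\<tau> \<in> {0..1/2}"
  shows "\<tau> * \<omega> - u (t, x, \<tau>) \<le> sel t x \<omega> * \<omega> - u (t, x, sel t x \<omega>)"
proof -
  let ?S = "sel t x \<omega>"
  have "\<sigma> / 2 * (\<tau> - ?S)\<^sup>2 \<le> u (t, x, \<tau>) - u (t, x, ?S) - Ds u (t, x, ?S) * (\<tau> - ?S)"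
    by (rule taylor2_lower[OF has_Ds[OF smooth_u] has_Ds[OF smooth_partials(3)[OF smooth_u]] sel_mem[OF t] \<tau> convex])
       (use t in auto)
  moreover have "0 \<le> \<sigma> / 2 * (\<tau> - ?S)\<^sup>2" using \<sigma> by simp
  ultimately show ?thesis using sel_variational[OF t \<tau>, of \<omega> x] by (simp add: algebra_simps)
qed

text \<open>A map into a compact set with closed graph is continuous, and here the graph is an
  intersection of closed sets, one for each \<tau> in the variational inequality.\<close>

lemma sel_continuous:
  assumes W: "continuous_on \<Omega> W"
  shows "continuous_on \<Omega> (\<lambda>(t, x, s). sel t x (W (t, x, s)))"
proof (rule continuous_from_closed_graph[of "{0..1/2}"])
  let ?G = "(\<lambda>X. (X, case X of (t, x, s) \<Rightarrow> sel t x (W (t, x, s)))) ` \<Omega>"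
  let ?g = "\<lambda>\<tau> (X, \<sigma>). (W X - Ds u (fst X, fst (snd X), \<sigma>)) * (\<tau> - \<sigma>) :: real"
  have "?G = (\<Inter>\<tau>\<in>{0..1/2}. {Y \<in> \<Omega> \<times> {0..1/2}. ?g \<tau> Y \<le> 0})" (is "_ = ?R")
  proof (rule set_eqI)
    fix Y :: "(point) \<times> real"
    obtain t x s \<sigma>' where Y: "Y = ((t, x, s), \<sigma>')" by (metis surj_pair)
    have "Y \<in> ?G \<longleftrightarrow> (t, x, s) \<in> \<Omega> \<and> \<sigma>' = sel t x (W (t, x, s))" unfolding Y by force
    also have "\<dots> \<longleftrightarrow> (t, x, s) \<in> \<Omega> \<and> variational t x (W (t, x, s)) \<sigma>'"
      using variational_unique[of t x _ \<sigma>'] variational_sel[of t] by auto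
    also have "\<dots> \<longleftrightarrow> (\<forall>\<tau>\<in>{0..1/2}. (t, x, s) \<in> \<Omega> \<and> \<sigma>' \<in> {0..1/2} \<and> (W (t, x, s) - Ds u (t, x, \<sigma>')) * (\<tau> - \<sigma>') \<le> 0)"
    proof -
      \<comment> \<open>The side conditions move under the quantifier over \<tau> only because its
        range is nonempty.\<close>
      have "(0 :: real) \<in> {0..1/2}" by simp
      then show ?thesis unfolding variational_def by blast
    qed
    also have "\<dots> \<longleftrightarrow> Y \<in> ?R" unfolding Y by simp
    finally show "Y \<in> ?G \<longleftrightarrow> Y \<in> ?R" .
  qed
  moreover have "closed {Y \<in> \<Omega> \<times> {0..1/2}. ?g \<tau> Y \<le> 0}" for \<tau>
  proof (rule continuous_on_closed_Collect_le)
    show "continuous_on (\<Omega> \<times> {0..1/2}) (?g \<tau>)"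
      unfolding split_beta
      by (intro continuous_intros continuous_on_compose2[OF W]
          continuous_on_compose2[OF smooth_continuous_on[OF smooth_partials(3)[OF smooth_u]]]) auto
    show "closed (\<Omega> \<times> {0..1/2 :: real})" by (intro closed_Times closed_UNIV closed_atLeastAtMost)
  qed (rule continuous_on_const)
  ultimately show "closed ?G" by (auto intro: closed_INT)
qed (use sel_mem in auto)

lemma
  assumes t: "t \<in> {0..T}"
  shows sel_above: "\<omega> > Ds u (t, x, sel t x \<omega>) \<Longrightarrow> sel t x \<omega> = 1/2"
    and sel_below: "\<omega> < Ds u (t, x, sel t x \<omega>) \<Longrightarrow> sel t x \<omega> = 0"
  using sel_variational[OF t, of "1/2" \<omega> x] sel_variational[OF t, of 0 \<omega> x] sel_mem[OF t, of x \<omega>]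
  by (auto simp: mult_le_0_iff zero_le_mult_iff)

text \<open>The right-hand side is the signed distance from \<omega> to the range of w. At most one
  positive part is nonzero, so the squares add. This form depends on the two end values of w only
  and can be differentiated without touching \<open>sel\<close>.\<close>

lemma sel_gap:
  assumes t: "t \<in> {0..T}"
  shows "\<omega> - Ds u (t, x, sel t x \<omega>) = max 0 (\<omega> - Ds u (t, x, 1/2)) - max 0 (Ds u (t, x, 0) - \<omega>)"
    and "(\<omega> - Ds u (t, x, sel t x \<omega>))\<^sup>2 = (max 0 (\<omega> - Ds u (t, x, 1/2)))\<^sup>2 + (max 0 (Ds u (t, x, 0) - \<omega>))\<^sup>2"
proof -
  let ?S = "sel t x \<omega>"
  have S: "?S \<in> {0..1/2}" by (rule sel_mem[OF t])
  have "0 \<le> \<sigma> * (?S - 0)" "0 \<le> \<sigma> * (1/2 - ?S)" using S \<sigma> by auto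
  then have inc: "Ds u (t, x, 0) \<le> Ds u (t, x, ?S)" "Ds u (t, x, ?S) \<le> Ds u (t, x, 1/2)"
    using w_increasing[OF t _ S, of 0 x] w_increasing[OF t S, of "1/2" x] S by auto
  consider "\<omega> > Ds u (t, x, ?S)" "?S = 1/2" | "\<omega> < Ds u (t, x, ?S)" "?S = 0" | "\<omega> = Ds u (t, x, ?S)"
    using sel_above[OF t, of x \<omega>] sel_below[OF t, of \<omega> x] by linarith
  then have "\<omega> - Ds u (t, x, ?S) = max 0 (\<omega> - Ds u (t, x, 1/2)) - max 0 (Ds u (t, x, 0) - \<omega>) \<and>
    (\<omega> - Ds u (t, x, ?S))\<^sup>2 = (max 0 (\<omega> - Ds u (t, x, 1/2)))\<^sup>2 + (max 0 (Ds u (t, x, 0) - \<omega>))\<^sup>2"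
  proof cases
    case 1
    have e: "Ds u (t, x, ?S) = Ds u (t, x, 1/2)" by (simp only: 1(2))
    have "max 0 (\<omega> - Ds u (t, x, 1/2)) = \<omega> - Ds u (t, x, ?S)" "max 0 (Ds u (t, x, 0) - \<omega>) = 0"
      using inc 1(1) unfolding e by (simp_all add: max_def)
    then show ?thesis by simp
  next
    case 2
    have e: "Ds u (t, x, ?S) = Ds u (t, x, 0)" by (simp only: 2(2))
    have "max 0 (\<omega> - Ds u (t, x, 1/2)) = 0" "max 0 (Ds u (t, x, 0) - \<omega>) = - (\<omega> - Ds u (t, x, ?S))"
      using inc 2(1) unfolding e by (simp_all add: max_def)
    then show ?thesis by (simp only: power2_minus) simp
  next
    case 3
    then have "max 0 (\<omega> - Ds u (t, x, 1/2)) = 0" "max 0 (Ds u (t, x, 0) - \<omega>) = 0"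
      using inc by (simp_all only: max_def) auto
    then show ?thesis using 3 by simp
  qed
  then show "\<omega> - Ds u (t, x, ?S) = max 0 (\<omega> - Ds u (t, x, 1/2)) - max 0 (Ds u (t, x, 0) - \<omega>)"
    "(\<omega> - Ds u (t, x, ?S))\<^sup>2 = (max 0 (\<omega> - Ds u (t, x, 1/2)))\<^sup>2 + (max 0 (Ds u (t, x, 0) - \<omega>))\<^sup>2"
    by (rule conjunct1, rule conjunct2)
qed

text \<open>By the variational inequality and the monotonicity of w, the excess \<omega> - w(S) and
  the increment w(S) - w(s) both have the sign of S - s, so each is bounded by their sum; the
  increment moreover is at least \<sigma> |S - s| in size.\<close>

lemma sel_close:
  assumes t: "t \<in> {0..T}" and s: "s \<in> {0..1/2}"
  shows "\<sigma> * \<bar>sel t x \<omega> - s\<bar> \<le> \<bar>\<omega> - Ds u (t, x, s)\<bar>"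
    and "\<bar>\<omega> - Ds u (t, x, sel t x \<omega>)\<bar> \<le> \<bar>\<omega> - Ds u (t, x, s)\<bar>"
proof -
  let ?S = "sel t x \<omega>"
  define Z where "Z = \<omega> - Ds u (t, x, ?S)"
  define d where "d = Ds u (t, x, ?S) - Ds u (t, x, s)"
  have S: "?S \<in> {0..1/2}" by (rule sel_mem[OF t])
  have 1: "\<sigma> * (?S - s)\<^sup>2 \<le> d * (?S - s)" unfolding d_def by (rule w_monotone[OF t s S])
  have 2: "0 \<le> Z * (?S - s)" using sel_variational[OF t s, of \<omega> x] by (simp add: Z_def algebra_simps)
  have v: "\<omega> - Ds u (t, x, s) = Z + d" by (simp add: Z_def d_def)
  have "\<sigma> * \<bar>?S - s\<bar> * \<bar>?S - s\<bar> \<le> (Z + d) * (?S - s)"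
    using 1 2 by (simp add: algebra_simps power2_eq_square)
  also have "\<dots> \<le> \<bar>Z + d\<bar> * \<bar>?S - s\<bar>" by (simp add: abs_mult[symmetric])
  finally show "\<sigma> * \<bar>?S - s\<bar> \<le> \<bar>\<omega> - Ds u (t, x, s)\<bar>"
    unfolding v by (cases "?S = s") (auto simp: mult_le_cancel_right)
  have "0 \<le> \<sigma> * (?S - s)\<^sup>2" using \<sigma> by simp
  then have 3: "0 \<le> d * (?S - s)" using 1 by linarith
  have "\<bar>Z\<bar> \<le> \<bar>Z + d\<bar>"
  proof (cases "?S = s")
    case True
    then show ?thesis by (simp add: d_def)
  next
    case False
    then show ?thesis using 2 3 by (auto simp: zero_le_mult_iff)
  qed
  then show "\<bar>\<omega> - Ds u (t, x, ?S)\<bar> \<le> \<bar>\<omega> - Ds u (t, x, s)\<bar>" unfolding v Z_def[symmetric] .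
qed

text \<open>The last term is the quadratic extension of the Legendre transform. Without it the gap
  would vanish at s = 1/2 for every \<omega> above the range of w.\<close>

definition gap :: "real \<Rightarrow> real \<Rightarrow> real \<Rightarrow> real \<Rightarrow> real" where
  "gap t x s \<omega> = sel t x \<omega> * \<omega> - u (t, x, sel t x \<omega>) + u (t, x, s) - s * \<omega> + (\<omega> - Ds u (t, x, sel t x \<omega>))\<^sup>2 / 2"

text \<open>With Z and q as below the gap is Z (S - s) + q + Z^2 / 2, a sum of nonnegative terms:
  the first by the variational inequality, q as a Bregman distance of the convex u. The lower bound
  measures 2 Z^2 + 2 d^2 against this sum; the three summands of the upper constant bound the three
  terms by \<open>sel_close\<close>.\<close>

lemma
  assumes t: "t \<in> {0..T}" and x: "x \<in> {0..1}" and s: "s \<in> {0..1/2}"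
  shows gap_lower: "(\<omega> - Ds u (t, x, s))\<^sup>2 \<le> (4 + 4 * M\<^sup>2 / \<sigma>) * gap t x s \<omega>"
    and gap_upper: "gap t x s \<omega> \<le> (1 / \<sigma> + M / (2 * \<sigma>\<^sup>2) + 1/2) * (\<omega> - Ds u (t, x, s))\<^sup>2"
proof -
  let ?S = "sel t x \<omega>"
  define Z where "Z = \<omega> - Ds u (t, x, ?S)"
  define d where "d = Ds u (t, x, ?S) - Ds u (t, x, s)"
  define q where "q = u (t, x, s) - u (t, x, ?S) - Ds u (t, x, ?S) * (s - ?S)"
  have S: "?S \<in> {0..1/2}" by (rule sel_mem[OF t])
  have v: "\<omega> - Ds u (t, x, s) = Z + d" by (simp add: Z_def d_def)
  have g: "gap t x s \<omega> = Z * (?S - s) + q + Z\<^sup>2 / 2"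
    by (simp add: gap_def Z_def q_def algebra_simps)
  have q1: "\<sigma> / 2 * (s - ?S)\<^sup>2 \<le> q"
    unfolding q_def
    by (rule taylor2_lower[OF has_Ds[OF smooth_u] has_Ds[OF smooth_partials(3)[OF smooth_u]] S s convex]) (use t in auto)
  have q2: "q \<le> M / 2 * (s - ?S)\<^sup>2"
    unfolding q_def
    by (rule taylor2_upper[OF has_Ds[OF smooth_u] has_Ds[OF smooth_partials(3)[OF smooth_u]] S s])
       (use t x M in \<open>auto simp: abs_le_iff\<close>)
  have 2: "0 \<le> Z * (?S - s)" using sel_variational[OF t s, of \<omega> x] by (simp add: Z_def algebra_simps)
  have "\<bar>d\<bar> \<le> M * \<bar>?S - s\<bar>" unfolding d_def
    by (rule increment_abs[OF has_Ds[OF smooth_partials(3)[OF smooth_u]] s S]) (use t x M in auto)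
  then have "\<bar>d\<bar>\<^sup>2 \<le> (M * \<bar>?S - s\<bar>)\<^sup>2" by (rule power_mono) simp
  then have d2: "d\<^sup>2 \<le> M\<^sup>2 * (s - ?S)\<^sup>2" by (simp add: power_mult_distrib power2_commute)
  have "(Z + d)\<^sup>2 \<le> 2 * Z\<^sup>2 + 2 * d\<^sup>2"
    using zero_le_power2[of "Z - d"] by (simp add: power2_eq_square algebra_simps)
  also have "2 * d\<^sup>2 \<le> (4 * M\<^sup>2 / \<sigma>) * (\<sigma> / 2 * (s - ?S)\<^sup>2)" using d2 \<sigma> by simp
  also have "\<dots> \<le> (4 * M\<^sup>2 / \<sigma>) * gap t x s \<omega>"
  proof (rule mult_left_mono)
    show "\<sigma> / 2 * (s - ?S)\<^sup>2 \<le> gap t x s \<omega>" unfolding g using q1 2 zero_le_power2[of Z] by linarith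
  qed (use \<sigma> in simp)
  also have "2 * Z\<^sup>2 \<le> 4 * gap t x s \<omega>"
  proof -
    have "0 \<le> \<sigma> / 2 * (s - ?S)\<^sup>2" using \<sigma> by simp
    then show ?thesis using q1 2 unfolding g distrib_left by linarith
  qed
  finally show "(\<omega> - Ds u (t, x, s))\<^sup>2 \<le> (4 + 4 * M\<^sup>2 / \<sigma>) * gap t x s \<omega>"
    unfolding v by (simp add: algebra_simps)
  have c: "\<sigma> * \<bar>?S - s\<bar> \<le> \<bar>Z + d\<bar>" "\<bar>Z\<bar> \<le> \<bar>Z + d\<bar>"
    using sel_close(1)[OF t s, of x \<omega>] sel_close(2)[OF t s, of \<omega> x] unfolding v Z_def[symmetric] by auto
  then have \<delta>: "\<bar>?S - s\<bar> \<le> \<bar>Z + d\<bar> / \<sigma>" using \<sigma> by (simp add: field_simps)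
  have "Z * (?S - s) \<le> \<bar>Z\<bar> * \<bar>?S - s\<bar>" by (simp add: abs_mult[symmetric])
  also have "\<dots> \<le> \<bar>Z + d\<bar> * (\<bar>Z + d\<bar> / \<sigma>)" by (rule mult_mono) (use c \<delta> in auto)
  finally have 3: "Z * (?S - s) \<le> 1 / \<sigma> * (Z + d)\<^sup>2" by (simp add: power2_eq_square)
  have "\<bar>?S - s\<bar>\<^sup>2 \<le> (\<bar>Z + d\<bar> / \<sigma>)\<^sup>2" by (rule power_mono) (use \<delta> in auto)
  then have "(s - ?S)\<^sup>2 \<le> (Z + d)\<^sup>2 / \<sigma>\<^sup>2" by (simp add: power_divide power2_commute)
  then have "M / 2 * (s - ?S)\<^sup>2 \<le> M / 2 * ((Z + d)\<^sup>2 / \<sigma>\<^sup>2)" using M_nonneg by (intro mult_left_mono) auto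
  moreover have "\<bar>Z\<bar>\<^sup>2 \<le> \<bar>Z + d\<bar>\<^sup>2" by (rule power_mono) (use c in auto)
  ultimately show "gap t x s \<omega> \<le> (1 / \<sigma> + M / (2 * \<sigma>\<^sup>2) + 1/2) * (\<omega> - Ds u (t, x, s))\<^sup>2"
    using 3 q2 unfolding g v by (simp add: algebra_simps)
qed

text \<open>Expansion about s. The increments of \<rho> and u that are of first order in s - S
  cancel each other, because \<rho>_s = -u_x and u_s = w. There remain
  \<open>\<rho> X * \<omega> - (U - u X) * Dx u X\<close> and products of two factors, each
  controlled by the vorticity or the velocity error.\<close>

lemma defect_bound:
  fixes U \<omega> :: real
  assumes t: "t \<in> {0..T}" and x: "x \<in> {0..1}" and s: "s \<in> {0..1/2}"
  defines "S \<equiv> (t, x, sel t x \<omega>)" and "X \<equiv> (t, x, s)"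
  shows "\<rho> S * Ds u S + (u S - U) * Dx u S - (\<omega> - Ds u S) * (U - u S) * Dx (Ds u) S
    \<le> (M\<^sup>2 / \<sigma>\<^sup>2 + 2 * M / \<sigma> + M + M\<^sup>2 / \<sigma>) * ((\<omega> - Ds u X)\<^sup>2 + (U - u X)\<^sup>2) + \<rho> X * \<omega> - (U - u X) * Dx u X"
proof -
  let ?S = "sel t x \<omega>"
  define Z where "Z = \<omega> - Ds u S"
  define a where "a = U - u X"
  define r where "r = \<rho> X - \<rho> S - (- Dx u S) * (s - ?S)"
  define q where "q = u X - u S - Ds u S * (s - ?S)"
  define V where "V = \<bar>\<omega> - Ds u X\<bar>"
  have Sm: "?S \<in> {0..1/2}" by (rule sel_mem[OF t])
  have MS: "\<bar>Ds u S\<bar> \<le> M" "\<bar>Dx u S\<bar> \<le> M" "\<bar>Dx (Ds u) S\<bar> \<le> M"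
    using M[of S] t x Sm by (auto simp: S_def)
  have V0: "V \<ge> 0" and V2: "V\<^sup>2 = (\<omega> - Ds u X)\<^sup>2" by (auto simp: V_def)
  have Z: "\<bar>Z\<bar> \<le> V" using sel_close(2)[OF t s, of \<omega> x] by (simp add: Z_def V_def S_def X_def)
  have \<delta>: "\<bar>?S - s\<bar> \<le> V / \<sigma>"
    using sel_close(1)[OF t s, of x \<omega>] \<sigma> by (simp add: V_def S_def X_def field_simps)
  have sq: "(s - ?S)\<^sup>2 \<le> (V / \<sigma>)\<^sup>2"
    using power_mono[OF \<delta>, of 2] by (simp add: power2_commute)
  have q: "\<bar>q\<bar> \<le> M / 2 * (V / \<sigma>)\<^sup>2"
  proof -
    have "-M / 2 * (s - ?S)\<^sup>2 \<le> q" unfolding q_def S_def X_def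
      by (rule taylor2_lower[OF has_Ds[OF smooth_u] has_Ds[OF smooth_partials(3)[OF smooth_u]] Sm s])
         (use t x M in \<open>auto simp: abs_le_iff minus_le_iff\<close>)
    moreover have "q \<le> M / 2 * (s - ?S)\<^sup>2" unfolding q_def S_def X_def
      by (rule taylor2_upper[OF has_Ds[OF smooth_u] has_Ds[OF smooth_partials(3)[OF smooth_u]] Sm s])
         (use t x M in \<open>auto simp: abs_le_iff\<close>)
    moreover have "M / 2 * (s - ?S)\<^sup>2 \<le> M / 2 * (V / \<sigma>)\<^sup>2" using sq M_nonneg by (intro mult_left_mono) auto
    ultimately show ?thesis by (simp add: abs_le_iff)
  qed
  have r: "\<bar>r\<bar> \<le> M / 2 * (V / \<sigma>)\<^sup>2"
  proof -
    have "-M / 2 * (s - ?S)\<^sup>2 \<le> r" unfolding r_def S_def X_def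
      by (rule taylor2_lower[OF \<rho>_s DERIV_minus[OF has_Ds[OF smooth_partials(2)[OF smooth_u]]] Sm s])
         (use t x M in \<open>auto simp: abs_le_iff minus_le_iff\<close>)
    moreover have "r \<le> M / 2 * (s - ?S)\<^sup>2" unfolding r_def S_def X_def
      by (rule taylor2_upper[OF \<rho>_s DERIV_minus[OF has_Ds[OF smooth_partials(2)[OF smooth_u]]] Sm s])
         (use t x M in \<open>auto simp: abs_le_iff minus_le_iff\<close>)
    moreover have "M / 2 * (s - ?S)\<^sup>2 \<le> M / 2 * (V / \<sigma>)\<^sup>2" using sq M_nonneg by (intro mult_left_mono) auto
    ultimately show ?thesis by (simp add: abs_le_iff)
  qed
  have inc: "\<bar>u X - u S\<bar> \<le> M * (V / \<sigma>)" "\<bar>\<rho> X - \<rho> S\<bar> \<le> M * (V / \<sigma>)" "\<bar>Dx u X - Dx u S\<bar> \<le> M * (V / \<sigma>)"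
  proof -
    have "M * \<bar>s - ?S\<bar> \<le> M * (V / \<sigma>)" using \<delta> M_nonneg by (intro mult_left_mono) (auto simp: abs_minus_commute)
    moreover have "\<bar>u X - u S\<bar> \<le> M * \<bar>s - ?S\<bar>" unfolding S_def X_def
      by (rule increment_abs[OF has_Ds[OF smooth_u] Sm s]) (use t x M in auto)
    moreover have "\<bar>\<rho> X - \<rho> S\<bar> \<le> M * \<bar>s - ?S\<bar>" unfolding S_def X_def
      by (rule increment_abs[OF \<rho>_s Sm s]) (use t x M in auto)
    moreover have "\<bar>Dx u X - Dx u S\<bar> \<le> M * \<bar>s - ?S\<bar>" unfolding S_def X_def
      by (rule increment_abs[OF has_Ds[OF smooth_partials(2)[OF smooth_u]] Sm s]) (use t x M in auto)
    ultimately show "\<bar>u X - u S\<bar> \<le> M * (V / \<sigma>)" "\<bar>\<rho> X - \<rho> S\<bar> \<le> M * (V / \<sigma>)" "\<bar>Dx u X - Dx u S\<bar> \<le> M * (V / \<sigma>)"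
      by linarith+
  qed
  \<comment> \<open>A nonzero excess Z forces S to an end point, where \<rho> vanishes. Thus \<rho>
    at s is an increment of \<rho>, and its product with Z is quadratic.\<close>
  have \<rho>Z: "\<bar>\<rho> X * Z\<bar> \<le> M * (V / \<sigma>) * V"
  proof (cases "Z = 0")
    case True
    then show ?thesis using V0 M_nonneg \<sigma> by simp
  next
    case False
    then have "?S = 1/2 \<or> ?S = 0"
      using sel_above[OF t, of x \<omega>] sel_below[OF t, of \<omega> x] by (auto simp: Z_def S_def neq_iff)
    then have "\<rho> S = 0"
      by (elim disjE) (simp_all only: S_def \<rho>_boundary[OF t])
    then show ?thesis
      unfolding abs_mult using inc(2) Z by (intro mult_mono) auto
  qed
  have id: "\<rho> S * Ds u S + (u S - U) * Dx u S - Z * (U - u S) * Dx (Ds u) S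
     = (- r) * Ds u S + (- q) * Dx u S + (- (\<rho> X * Z)) + a * (Dx u X - Dx u S) + (- Z) * a * Dx (Ds u) S
       + (- Z) * (u X - u S) * Dx (Ds u) S + (\<rho> X * \<omega> - a * Dx u X)"
  proof -
    have \<omega>: "\<omega> = Z + Ds u S" and U: "U = a + u X" by (simp_all add: Z_def a_def)
    show ?thesis unfolding r_def q_def \<omega> U by (simp add: algebra_simps)
  qed
  have prod2: "y * z \<le> A * B" if "\<bar>y\<bar> \<le> A" "\<bar>z\<bar> \<le> B" for y z A B :: real
  proof -
    have "\<bar>y\<bar> * \<bar>z\<bar> \<le> A * B" by (rule mult_mono) (use that in linarith)+
    then show ?thesis using abs_ge_self[of "y * z"] by (simp add: abs_mult)
  qed
  have prod3: "y * z * y' \<le> A * B * A'" if "\<bar>y\<bar> \<le> A" "\<bar>z\<bar> \<le> B" "\<bar>y'\<bar> \<le> A'" for y z y' A B A' :: real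
  proof (rule prod2[OF _ that(3)])
    show "\<bar>y * z\<bar> \<le> A * B"
      unfolding abs_mult by (rule mult_mono) (use that in linarith)+
  qed
  have "(- r) * Ds u S \<le> M / 2 * (V / \<sigma>)\<^sup>2 * M"
    by (rule prod2) (use r MS in simp_all)
  moreover have "(- q) * Dx u S \<le> M / 2 * (V / \<sigma>)\<^sup>2 * M"
    by (rule prod2) (use q MS in simp_all)
  moreover have "a * (Dx u X - Dx u S) \<le> \<bar>a\<bar> * (M * (V / \<sigma>))"
    by (rule prod2[OF order_refl inc(3)])
  moreover have "(- Z) * a * Dx (Ds u) S \<le> V * \<bar>a\<bar> * M"
    by (rule prod3[OF _ order_refl MS(3)]) (use Z in simp)
  moreover have "(- Z) * (u X - u S) * Dx (Ds u) S \<le> V * (M * (V / \<sigma>)) * M"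
    by (rule prod3[OF _ inc(1) MS(3)]) (use Z in simp)
  moreover have "- (\<rho> X * Z) \<le> M * (V / \<sigma>) * V" using \<rho>Z by linarith
  \<comment> \<open>Origin of the constant: r and q together give M^2 / \<sigma>^2, the term \<rho>
    Z and the increment of \<open>Dx u\<close> give M / \<sigma> each, the product of Z with the
    velocity error gives M, and that with the increment of u gives M^2 / \<sigma>.\<close>
  moreover have "M / 2 * (V / \<sigma>)\<^sup>2 * M + M / 2 * (V / \<sigma>)\<^sup>2 * M + M * (V / \<sigma>) * V + \<bar>a\<bar> * (M * (V / \<sigma>))
      + V * \<bar>a\<bar> * M + V * (M * (V / \<sigma>)) * M
    = M\<^sup>2 / \<sigma>\<^sup>2 * V\<^sup>2 + M / \<sigma> * V\<^sup>2 + (M / \<sigma> + M) * (V * \<bar>a\<bar>) + M\<^sup>2 / \<sigma> * V\<^sup>2"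
    by (simp add: power2_eq_square algebra_simps)
  ultimately have "\<rho> S * Ds u S + (u S - U) * Dx u S - Z * (U - u S) * Dx (Ds u) S
     \<le> M\<^sup>2 / \<sigma>\<^sup>2 * V\<^sup>2 + M / \<sigma> * V\<^sup>2 + (M / \<sigma> + M) * (V * \<bar>a\<bar>) + M\<^sup>2 / \<sigma> * V\<^sup>2 + (\<rho> X * \<omega> - a * Dx u X)"
    unfolding id by linarith
  also have "\<dots> \<le> M\<^sup>2 / \<sigma>\<^sup>2 * (V\<^sup>2 + a\<^sup>2) + M / \<sigma> * (V\<^sup>2 + a\<^sup>2) + (M / \<sigma> + M) * (V\<^sup>2 + a\<^sup>2) + M\<^sup>2 / \<sigma> * (V\<^sup>2 + a\<^sup>2)
     + (\<rho> X * \<omega> - a * Dx u X)"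
  proof -
    have "0 \<le> V * \<bar>a\<bar>" using V0 by simp
    then have Va: "V * \<bar>a\<bar> \<le> V\<^sup>2 + a\<^sup>2"
      using sum_squares_bound[of V "\<bar>a\<bar>"] by simp
    have "V\<^sup>2 \<le> V\<^sup>2 + a\<^sup>2" by simp
    note mono = mult_left_mono[OF this]
    have nn: "0 \<le> M\<^sup>2 / \<sigma>\<^sup>2" "0 \<le> M / \<sigma>" "0 \<le> M / \<sigma> + M" "0 \<le> M\<^sup>2 / \<sigma>"
      using M_nonneg \<sigma> by simp_all
    show ?thesis
      by (intro add_right_mono add_mono mono nn mult_left_mono[OF Va])
  qed
  also have "M\<^sup>2 / \<sigma>\<^sup>2 * (V\<^sup>2 + a\<^sup>2) + M / \<sigma> * (V\<^sup>2 + a\<^sup>2) + (M / \<sigma> + M) * (V\<^sup>2 + a\<^sup>2) + M\<^sup>2 / \<sigma> * (V\<^sup>2 + a\<^sup>2)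
     = (M\<^sup>2 / \<sigma>\<^sup>2 + 2 * M / \<sigma> + M + M\<^sup>2 / \<sigma>) * (V\<^sup>2 + a\<^sup>2)"
    unfolding distrib_right by simp
  finally show ?thesis unfolding Z_def a_def V2 by (simp only: add.assoc)
qed

end

section \<open>Evolution of the Casimir functional\<close>

context cylinder
begin

lemma slice_strip:
  assumes "continuous_on \<Omega> f" "t \<in> {0..T}"
  shows "continuous_on strip (\<lambda>(x, s). f (t, x, s))"
  unfolding split_beta
  by (rule continuous_on_compose2[OF assms(1)]) (use assms(2) in \<open>auto intro!: continuous_intros\<close>)

lemma integral_Q_derivative:
  fixes f ft :: "field"
  assumes d: "\<And>t x s. (t, x, s) \<in> \<Omega> \<Longrightarrow> ((\<lambda>t. f (t, x, s)) has_real_derivative ft (t, x, s)) (at t within {0..T})"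
    and c: "continuous_on \<Omega> f" "continuous_on \<Omega> ft" and t: "t \<in> {0..T}"
  shows "((\<lambda>t. integral Q (\<lambda>(x, s). f (t, x, s))) has_real_derivative integral Q (\<lambda>(x, s). ft (t, x, s))) (at t within {0..T})"
proof -
  have "((\<lambda>t. integral Q (\<lambda>X. f (t, X))) has_real_derivative integral Q (\<lambda>X. ft (t, X))) (at t within {0..T})"
  proof (rule leibniz_rule_field_derivative)
    show "((\<lambda>t. f (t, X)) has_real_derivative ft (t, X)) (at t within {0..T})" if "t \<in> {0..T}" "X \<in> Q" for t X
      using d[of t "fst X" "snd X"] that by (auto simp: cbox_Pair_eq)
    show "(\<lambda>X. f (t, X)) integrable_on Q" if "t \<in> {0..T}" for t
      using strip_integrable[OF slice_strip[OF c(1) that]] by (simp only: split_triple)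
    show "continuous_on ({0..T} \<times> Q) (\<lambda>(t, X). ft (t, X))"
      unfolding case_prod_eta by (rule continuous_on_subset[OF c(2)]) (auto simp: cbox_Pair_eq)
  qed (use t in auto)
  then show ?thesis by (simp only: split_triple)
qed

lemma euler_eqs:
  assumes "euler \<epsilon> U k P"
  shows "smooth U" "smooth k" "smooth P"
    and "(t, x, s) \<in> \<Omega> \<Longrightarrow> Dt U (t, x, s) + U (t, x, s) * Dx U (t, x, s) + 2 * s * k (t, x, s) * Ds U (t, x, s) = - Dx P (t, x, s)"
    and "(t, x, s) \<in> \<Omega> \<Longrightarrow> \<epsilon>\<^sup>2 * (Dt k (t, x, s) + U (t, x, s) * Dx k (t, x, s) + 2 * s * k (t, x, s) * Ds k (t, x, s) + (k (t, x, s))\<^sup>2)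
       = - Ds P (t, x, s)"
    and "(t, x, s) \<in> \<Omega> \<Longrightarrow> Dx U (t, x, s) + 2 * k (t, x, s) + 2 * s * Ds k (t, x, s) = 0"
  using assms by (simp_all add: euler_def)

lemma integral_Dx:
  assumes f: "smooth f" and t: "t \<in> {0..T}"
  shows "integral Q (\<lambda>(x, s). Dx f (t, x, s)) = 0"
proof (rule integral_dx_eq_0[where f = "\<lambda>x s. f (t, x, s)"])
  show "continuous_on strip (\<lambda>(x, s). Dx f (t, x, s))"
    by (intro slice_strip smooth_continuous_on smooth_partials f t)
qed (use t smooth_periodic[OF f, of t 0] in \<open>auto intro!: has_Dx[OF f]\<close>)

text \<open>Incompressibility makes the integrand the divergence of g times the velocity, and 2 s k
  vanishes at both ends. The derivatives of g are parameters because the Casimir density is C^1 but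
  in general not \<open>smooth\<close>.\<close>

lemma transport_integral:
  assumes E: "euler \<epsilon> U k P" and bc: "\<And>t x. t \<in> {0..T} \<Longrightarrow> k (t, x, 1/2) = 0" and t: "t \<in> {0..T}"
    and gx: "\<And>x s. s \<in> {0..1/2} \<Longrightarrow> ((\<lambda>x. g (t, x, s)) has_real_derivative gx (t, x, s)) (at x)"
    and gs: "\<And>x s. s \<in> {0..1/2} \<Longrightarrow> ((\<lambda>s. g (t, x, s)) has_real_derivative gs (t, x, s)) (at s within {0..1/2})"
    and c: "continuous_on \<Omega> g" "continuous_on \<Omega> gx" "continuous_on \<Omega> gs"
    and per: "\<And>s. s \<in> {0..1/2} \<Longrightarrow> g (t, 1, s) = g (t, 0, s)"
  shows "integral Q (\<lambda>(x, s). U (t, x, s) * gx (t, x, s) + 2 * s * k (t, x, s) * gs (t, x, s)) = 0"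
proof -
  note e = euler_eqs[OF E]
  note cont = smooth_continuous_on[OF e(1)] smooth_continuous_on[OF e(2)]
    smooth_partials[OF e(1), THEN smooth_continuous_on] smooth_partials[OF e(2), THEN smooth_continuous_on] c
  note ct = cont[THEN slice_strip, OF t, unfolded split_beta]
  have 1: "integral Q (\<lambda>(x, s). U (t, x, s) * gx (t, x, s) + Dx U (t, x, s) * g (t, x, s)) = 0"
  proof (rule integral_dx_eq_0)
    show "((\<lambda>x. U (t, x, s) * g (t, x, s)) has_real_derivative
        U (t, x, s) * gx (t, x, s) + Dx U (t, x, s) * g (t, x, s)) (at x)" if "s \<in> {0..1/2}" for x s
      by (rule derivative_eq_intros has_Dx[OF e(1)] gx[OF that] refl | use that t in simp)+
    show "U (t, 1, s) * g (t, 1, s) = U (t, 0, s) * g (t, 0, s)" if "s \<in> {0..1/2}" for s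
      using per[OF that] smooth_periodic[OF e(1), of t 0 s] that t by simp
  qed (unfold split_beta, intro continuous_intros ct)
  have 2: "integral Q (\<lambda>(x, s). 2 * s * k (t, x, s) * gs (t, x, s)
      + (2 * k (t, x, s) + 2 * s * Ds k (t, x, s)) * g (t, x, s)) = 0"
  proof (rule integral_ds_eq_0)
    show "((\<lambda>s. 2 * s * k (t, x, s) * g (t, x, s)) has_real_derivative
        2 * s * k (t, x, s) * gs (t, x, s) + (2 * k (t, x, s) + 2 * s * Ds k (t, x, s)) * g (t, x, s))
        (at s within {0..1/2})" if "s \<in> {0..1/2}" for x s
      by (rule derivative_eq_intros has_Ds[OF e(2)] refl)+ (use that t in \<open>auto intro!: gs simp: algebra_simps\<close>)
    show "2 * (1 / 2) * k (t, x, 1 / 2) * g (t, x, 1 / 2) = 2 * 0 * k (t, x, 0) * g (t, x, 0)" for x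
      by (simp add: bc[OF t])
  qed (unfold split_beta, intro continuous_intros ct)
  have "integral Q (\<lambda>(x, s). U (t, x, s) * gx (t, x, s) + 2 * s * k (t, x, s) * gs (t, x, s))
    = integral Q (\<lambda>X. (case X of (x, s) \<Rightarrow> U (t, x, s) * gx (t, x, s) + Dx U (t, x, s) * g (t, x, s))
      + (case X of (x, s) \<Rightarrow> 2 * s * k (t, x, s) * gs (t, x, s)
      + (2 * k (t, x, s) + 2 * s * Ds k (t, x, s)) * g (t, x, s)))"
  proof (rule integral_cong)
    fix X :: "real \<times> real" assume "X \<in> Q"
    then obtain x s where X: "X = (x, s)" "(t, x, s) \<in> \<Omega>" using t by (cases X) (auto simp: cbox_Pair_eq)
    have "2 * k (t, x, s) + 2 * s * Ds k (t, x, s) = - Dx U (t, x, s)" using e(6)[OF X(2)] by linarith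
    then show "(case X of (x, s) \<Rightarrow> U (t, x, s) * gx (t, x, s) + 2 * s * k (t, x, s) * gs (t, x, s))
      = (case X of (x, s) \<Rightarrow> U (t, x, s) * gx (t, x, s) + Dx U (t, x, s) * g (t, x, s))
      + (case X of (x, s) \<Rightarrow> 2 * s * k (t, x, s) * gs (t, x, s)
      + (2 * k (t, x, s) + 2 * s * Ds k (t, x, s)) * g (t, x, s))"
      unfolding X(1) prod.case by simp
  qed
  also have "\<dots> = 0"
    by (subst integral_add)
       (simp_all only: 1 2 add_0, (rule strip_integrable, (unfold split_beta)?, intro continuous_intros ct)+)
  finally show ?thesis .
qed

lemma transport_integral_smooth:
  assumes E: "euler \<epsilon> U k P" and bc: "\<And>t x. t \<in> {0..T} \<Longrightarrow> k (t, x, 1/2) = 0" and t: "t \<in> {0..T}"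
    and g: "smooth g"
  shows "integral Q (\<lambda>(x, s). U (t, x, s) * Dx g (t, x, s) + 2 * s * k (t, x, s) * Ds g (t, x, s)) = 0"
  by (rule transport_integral[OF E bc t, where g = g])
     (use t smooth_periodic[OF g, of t 0] in
       \<open>auto intro!: has_Dx[OF g] has_Ds[OF g] smooth_continuous_on smooth_partials g\<close>)

text \<open>Transport and pressure gradient both integrate to zero, for every \<epsilon>. The mean
  velocity is the one part of the velocity that the vorticity does not determine, so its
  conservation closes the elliptic estimate.\<close>

lemma momentum_conserved:
  assumes E: "euler \<epsilon> U k P" and bc: "\<And>t x. t \<in> {0..T} \<Longrightarrow> k (t, x, 1/2) = 0" and t: "t \<in> {0..T}"
  shows "integral Q (\<lambda>(x, s). Dt U (t, x, s)) = 0"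
proof -
  note e = euler_eqs[OF E]
  note cont = smooth_continuous_on[OF e(1)] smooth_continuous_on[OF e(2)]
    smooth_partials[OF e(1), THEN smooth_continuous_on] smooth_partials[OF e(3), THEN smooth_continuous_on]
  note ct = cont[THEN slice_strip, OF t, unfolded split_beta]
  have "integral Q (\<lambda>(x, s). Dt U (t, x, s)) =
    integral Q (\<lambda>X. - ((case X of (x, s) \<Rightarrow> U (t, x, s) * Dx U (t, x, s) + 2 * s * k (t, x, s) * Ds U (t, x, s))
      + (case X of (x, s) \<Rightarrow> Dx P (t, x, s))))"
  proof (rule integral_cong)
    fix X :: "real \<times> real" assume "X \<in> Q"
    then obtain x s where X: "X = (x, s)" "(t, x, s) \<in> \<Omega>" using t by (cases X) (auto simp: cbox_Pair_eq)
    show "(case X of (x, s) \<Rightarrow> Dt U (t, x, s)) = - ((case X of (x, s) \<Rightarrow> U (t, x, s) * Dx U (t, x, s) + 2 * s * k (t, x, s) * Ds U (t, x, s))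
      + (case X of (x, s) \<Rightarrow> Dx P (t, x, s)))"
      using e(4)[OF X(2)] unfolding X(1) prod.case by linarith
  qed
  also have "\<dots> = 0"
  proof -
    have "(\<lambda>(x, s). U (t, x, s) * Dx U (t, x, s) + 2 * s * k (t, x, s) * Ds U (t, x, s)) integrable_on Q"
      by (rule strip_integrable, unfold split_beta, intro continuous_intros ct)
    moreover have "(\<lambda>(x, s). Dx P (t, x, s)) integrable_on Q"
      by (intro strip_integrable slice_strip smooth_continuous_on smooth_partials e t)
    ultimately show ?thesis
      unfolding integral_neg
      by (subst integral_add) (simp_all only: transport_integral_smooth[OF E bc t e(1)] integral_Dx[OF e(3) t] add_0 minus_zero)
  qed
  finally show ?thesis .
qed

end

section \<open>The perturbed flow and its Casimir density\<close>

locale flow = reference +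
  fixes \<epsilon> :: real and U K P :: "field"
  assumes flow: "euler \<epsilon> U K P"
    and K_half: "\<And>t x. t \<in> {0..T} \<Longrightarrow> K (t, x, 1/2) = 0"
begin

lemmas ref = euler_eqs[OF reference] and pert = euler_eqs[OF flow]

lemmas ref_cont = ref(1-3)[THEN smooth_continuous_on]
  smooth_partials[OF ref(1), THEN smooth_continuous_on]
  smooth_partials[OF ref(2), THEN smooth_continuous_on]
  smooth_partials[OF ref(3), THEN smooth_continuous_on]
  smooth_partials[OF smooth_partials(3)[OF ref(1)], THEN smooth_continuous_on]

lemmas pert_cont = pert(1-3)[THEN smooth_continuous_on]
  smooth_partials[OF pert(1), THEN smooth_continuous_on]
  smooth_partials[OF pert(2), THEN smooth_continuous_on]
  smooth_partials[OF smooth_partials(3)[OF pert(1)], THEN smooth_continuous_on]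
  smooth_partials[OF smooth_partials(2)[OF pert(2)], THEN smooth_continuous_on]

abbreviation W :: "field" where "W \<equiv> vort \<epsilon> U K"

definition Wt :: "field" where "Wt X = Dt (Ds U) X - \<epsilon>\<^sup>2 * Dt (Dx K) X"
definition Wx :: "field" where "Wx X = Dx (Ds U) X - \<epsilon>\<^sup>2 * Dx (Dx K) X"
definition Ws :: "field" where "Ws X = Ds (Ds U) X - \<epsilon>\<^sup>2 * Ds (Dx K) X"

lemma
  assumes X: "(t, x, s) \<in> \<Omega>"
  shows W_t: "((\<lambda>t. W (t, x, s)) has_real_derivative Wt (t, x, s)) (at t within {0..T})"
    and W_x: "((\<lambda>x. W (t, x, s)) has_real_derivative Wx (t, x, s)) (at x)"
    and W_s: "((\<lambda>s. W (t, x, s)) has_real_derivative Ws (t, x, s)) (at s within {0..1/2})"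
    and W_transport: "Wt (t, x, s) + U (t, x, s) * Wx (t, x, s) + 2 * s * K (t, x, s) * Ws (t, x, s) = 0"
proof -
  note sm = smooth_partials(3)[OF pert(1)] smooth_partials(2)[OF pert(2)]
  show "((\<lambda>t. W (t, x, s)) has_real_derivative Wt (t, x, s)) (at t within {0..T})"
    unfolding vort_def Wt_def by (intro DERIV_diff DERIV_cmult has_Dt sm X)
  show "((\<lambda>x. W (t, x, s)) has_real_derivative Wx (t, x, s)) (at x)"
    unfolding vort_def Wx_def by (intro DERIV_diff DERIV_cmult has_Dx sm X)
  show "((\<lambda>s. W (t, x, s)) has_real_derivative Ws (t, x, s)) (at s within {0..1/2})"
    unfolding vort_def Ws_def by (intro DERIV_diff DERIV_cmult has_Ds sm X)
  show "Wt (t, x, s) + U (t, x, s) * Wx (t, x, s) + 2 * s * K (t, x, s) * Ws (t, x, s) = 0"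
    using vorticity_transport[OF flow X] by (simp add: Wt_def Wx_def Ws_def)
qed

lemma W_cont: "continuous_on \<Omega> W" "continuous_on \<Omega> Wt" "continuous_on \<Omega> Wx" "continuous_on \<Omega> Ws"
proof -
  have *: "continuous_on \<Omega> (\<lambda>X. Ds U X - \<epsilon>\<^sup>2 * Dx K X)" by (intro continuous_intros pert_cont)
  show "continuous_on \<Omega> W" by (rule continuous_on_eq[OF *]) (simp add: vort_def)
  show "continuous_on \<Omega> Wt" "continuous_on \<Omega> Wx" "continuous_on \<Omega> Ws"
    unfolding Wt_def[abs_def] Wx_def[abs_def] Ws_def[abs_def] by (intro continuous_intros pert_cont)+
qed

lemma W_periodic: "(t, x, s) \<in> \<Omega> \<Longrightarrow> W (t, x + 1, s) = W (t, x, s)"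
  unfolding vort_def
  by (simp add: smooth_periodic[OF smooth_partials(3)[OF pert(1)]] smooth_periodic[OF smooth_partials(2)[OF pert(2)]])

definition S :: "field" where
  "S X = sel (fst X) (fst (snd X)) (W X)"

text \<open>The point over the same (t, x) at which the reference vorticity equals W, or the nearer
  end of the slice if W lies outside the range.\<close>

definition foot :: "point \<Rightarrow> point" where
  "foot X = (fst X, fst (snd X), S X)"

lemma S_mem: "X \<in> \<Omega> \<Longrightarrow> S X \<in> {0..1/2}"
  unfolding S_def by (rule sel_mem) auto

lemma foot_mem: "X \<in> \<Omega> \<Longrightarrow> foot X \<in> \<Omega>"
  using S_mem by (auto simp: foot_def)

lemma S_cont: "continuous_on \<Omega> S"
  using sel_continuous[OF W_cont(1)] by (simp add: S_def[abs_def] split_beta)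

lemma foot_cont: "continuous_on \<Omega> foot"
  unfolding foot_def[abs_def] by (intro continuous_intros S_cont)

lemma comp_foot_cont:
  assumes f: "continuous_on \<Omega> f"
  shows "continuous_on \<Omega> (\<lambda>X. f (foot X))"
proof (rule continuous_on_compose2[OF f foot_cont])
  show "foot ` \<Omega> \<subseteq> \<Omega>" using foot_mem by blast
qed

definition top_excess :: "field" where
  "top_excess X = max 0 (W X - Ds u (fst X, fst (snd X), 1/2))"

definition bot_excess :: "field" where
  "bot_excess X = max 0 (Ds u (fst X, fst (snd X), 0) - W X)"

lemma excess_diff:
  assumes "X \<in> \<Omega>"
  shows "W X - Ds u (foot X) = top_excess X - bot_excess X"
    and "(W X - Ds u (foot X))\<^sup>2 = (top_excess X)\<^sup>2 + (bot_excess X)\<^sup>2"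
  using assms sel_gap[of "fst X" "W X" "fst (snd X)"]
  by (auto simp: foot_def S_def top_excess_def bot_excess_def)

text \<open>A positive excess forces the maximizer to the top of the slice, so wall values
  multiplied by the excess may be read at the foot point.\<close>

lemma top_excess_foot:
  assumes X: "X \<in> \<Omega>"
  shows "top_excess X * f (fst X, fst (snd X), 1/2) = top_excess X * f (foot X)"
proof (cases "top_excess X = 0")
  case False
  then have "0 < top_excess X" by (auto simp: top_excess_def)
  then have W: "Ds u (fst X, fst (snd X), 1/2) < W X" by (auto simp: top_excess_def)
  have t: "fst X \<in> {0..T}" using X by auto
  have "0 \<le> \<sigma> * (1/2 - S X)" using \<sigma> S_mem[OF X] by auto
  then have "Ds u (foot X) \<le> Ds u (fst X, fst (snd X), 1/2)"
    using w_increasing[OF t S_mem[OF X], of "1/2" "fst (snd X)"] S_mem[OF X] by (auto simp: foot_def)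
  then have "S X = 1/2"
    unfolding S_def by (intro sel_above[OF t]) (use W in \<open>simp add: foot_def S_def\<close>)
  then show ?thesis by (simp only: foot_def)
qed simp

lemma bot_excess_foot:
  assumes X: "X \<in> \<Omega>"
  shows "bot_excess X * f (fst X, fst (snd X), 0) = bot_excess X * f (foot X)"
proof (cases "bot_excess X = 0")
  case False
  then have "0 < bot_excess X" by (auto simp: bot_excess_def)
  then have W: "W X < Ds u (fst X, fst (snd X), 0)" by (auto simp: bot_excess_def)
  have t: "fst X \<in> {0..T}" using X by auto
  have "0 \<le> \<sigma> * (S X - 0)" using \<sigma> S_mem[OF X] by auto
  then have "Ds u (fst X, fst (snd X), 0) \<le> Ds u (foot X)"
    using w_increasing[OF t _ S_mem[OF X], of 0 "fst (snd X)"] S_mem[OF X] by (auto simp: foot_def)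
  then have "S X = 0"
    unfolding S_def by (intro sel_below[OF t]) (use W in \<open>simp add: foot_def S_def\<close>)
  then show ?thesis by (simp only: foot_def)
qed simp

lemma excess_cont: "continuous_on \<Omega> top_excess" "continuous_on \<Omega> bot_excess"
  unfolding top_excess_def[abs_def] bot_excess_def[abs_def]
  by (intro continuous_intros W_cont continuous_on_compose2[OF ref_cont(6)]; auto)+

text \<open>The Casimir density is the Legendre transform of \<open>u (t, x, \<cdot>)\<close> at the vorticity, extended
  quadratically beyond the range of \<open>w\<close>; subtracting \<open>s W\<close> makes it a Fenchel gap up to \<open>u\<close>.\<close>
definition G :: "field" where
  "G X = S X * W X - u (foot X) + (top_excess X)\<^sup>2 / 2 + (bot_excess X)\<^sup>2 / 2 - snd (snd X) * W X"

text \<open>By the envelope theorem no derivative of S occurs, neither here nor in \<open>Gx\<close>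
  and \<open>Gs\<close>.\<close>

definition Gt :: "field" where
  "Gt X = S X * Wt X - Dt u (foot X) + top_excess X * (Wt X - Dt (Ds u) (fst X, fst (snd X), 1/2))
    + bot_excess X * (Dt (Ds u) (fst X, fst (snd X), 0) - Wt X) - snd (snd X) * Wt X"

definition Gx :: "field" where
  "Gx X = S X * Wx X - Dx u (foot X) + top_excess X * (Wx X - Dx (Ds u) (fst X, fst (snd X), 1/2))
    + bot_excess X * (Dx (Ds u) (fst X, fst (snd X), 0) - Wx X) - snd (snd X) * Wx X"

definition Gs :: "field" where
  "Gs X = S X * Ws X + top_excess X * Ws X + bot_excess X * (- Ws X) - (W X + snd (snd X) * Ws X)"

lemma Legendre_max: "X \<in> \<Omega> \<Longrightarrow> \<tau> \<in> {0..1/2} \<Longrightarrow>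
    \<tau> * W X - u (fst X, fst (snd X), \<tau>) \<le> S X * W X - u (fst X, fst (snd X), S X)"
  unfolding S_def by (rule sel_max) auto

lemma G_t:
  assumes X: "(t, x, s) \<in> \<Omega>"
  shows "((\<lambda>t. G (t, x, s)) has_real_derivative Gt (t, x, s)) (at t within {0..T})"
proof -
  have mem: "(\<tau>, x, s) \<in> \<Omega>" if "\<tau> \<in> {0..T}" for \<tau> using X that by auto
  have "((\<lambda>\<tau>. S (\<tau>, x, s) * W (\<tau>, x, s) - u (\<tau>, x, S (\<tau>, x, s))) has_real_derivative
      S (t, x, s) * Wt (t, x, s) - Dt u (t, x, S (t, x, s))) (at t within {0..T})"
  proof (rule danskin[where K = "{0..1/2}" and S = "\<lambda>\<tau>. S (\<tau>, x, s)" and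
        \<psi> = "\<lambda>\<tau> \<sigma>. \<sigma> * W (\<tau>, x, s) - u (\<tau>, x, \<sigma>)" and \<psi>' = "\<lambda>\<tau> \<sigma>. \<sigma> * Wt (\<tau>, x, s) - Dt u (\<tau>, x, \<sigma>)"])
    show "((\<lambda>\<tau>. \<sigma> * W (\<tau>, x, s) - u (\<tau>, x, \<sigma>)) has_real_derivative \<sigma> * Wt (\<tau>, x, s) - Dt u (\<tau>, x, \<sigma>)) (at \<tau> within {0..T})"
      if "\<tau> \<in> {0..T}" "\<sigma> \<in> {0..1/2}" for \<tau> \<sigma>
      by (intro DERIV_diff DERIV_cmult W_t has_Dt ref mem) (use that in auto)
    show "continuous_on {0..T} (\<lambda>\<tau>. S (\<tau>, x, s))"
      by (rule continuous_on_compose2[OF S_cont]) (use X in \<open>auto intro!: continuous_intros\<close>)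
    show "continuous_on ({0..T} \<times> {0..1/2}) (\<lambda>(\<tau>, \<sigma>). \<sigma> * Wt (\<tau>, x, s) - Dt u (\<tau>, x, \<sigma>))"
      unfolding split_beta
      by (intro continuous_intros continuous_on_compose2[OF W_cont(2)] continuous_on_compose2[OF ref_cont(4)])
         (use X in auto)
  qed (use X S_mem[OF mem] Legendre_max[OF mem] in auto)
  moreover have "((\<lambda>t. (top_excess (t, x, s))\<^sup>2 / 2) has_real_derivative
      top_excess (t, x, s) * (Wt (t, x, s) - Dt (Ds u) (t, x, 1/2))) (at t within {0..T})"
    unfolding top_excess_def fst_conv snd_conv
    by (intro half_square_pos_part DERIV_diff W_t has_Dt smooth_partials ref) (use X in auto)
  moreover have "((\<lambda>t. (bot_excess (t, x, s))\<^sup>2 / 2) has_real_derivative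
      bot_excess (t, x, s) * (Dt (Ds u) (t, x, 0) - Wt (t, x, s))) (at t within {0..T})"
    unfolding bot_excess_def fst_conv snd_conv
    by (intro half_square_pos_part DERIV_diff W_t has_Dt smooth_partials ref) (use X in auto)
  ultimately show ?thesis
    unfolding G_def Gt_def foot_def fst_conv snd_conv
    by (intro DERIV_diff[OF DERIV_add[OF DERIV_add] DERIV_cmult[OF W_t]]) (use X in auto)
qed

lemma G_x:
  assumes X: "(t, x, s) \<in> \<Omega>"
  shows "((\<lambda>x. G (t, x, s)) has_real_derivative Gx (t, x, s)) (at x)"
proof -
  have mem: "(t, y, s) \<in> \<Omega>" for y using X by auto
  have "((\<lambda>y. S (t, y, s) * W (t, y, s) - u (t, y, S (t, y, s))) has_real_derivative
      S (t, x, s) * Wx (t, x, s) - Dx u (t, x, S (t, x, s))) (at x)"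
  proof (rule danskin[where A = UNIV and K = "{0..1/2}" and S = "\<lambda>y. S (t, y, s)" and
        \<psi> = "\<lambda>y \<sigma>. \<sigma> * W (t, y, s) - u (t, y, \<sigma>)" and \<psi>' = "\<lambda>y \<sigma>. \<sigma> * Wx (t, y, s) - Dx u (t, y, \<sigma>)"])
    show "((\<lambda>y. \<sigma> * W (t, y, s) - u (t, y, \<sigma>)) has_real_derivative \<sigma> * Wx (t, y, s) - Dx u (t, y, \<sigma>)) (at y)"
      if "\<sigma> \<in> {0..1/2}" for y \<sigma>
      by (intro DERIV_diff DERIV_cmult W_x has_Dx ref mem) (use that X in auto)
    show "continuous_on UNIV (\<lambda>y. S (t, y, s))"
      by (rule continuous_on_compose2[OF S_cont]) (use X in \<open>auto intro!: continuous_intros\<close>)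
    show "continuous_on (UNIV \<times> {0..1/2}) (\<lambda>(y, \<sigma>). \<sigma> * Wx (t, y, s) - Dx u (t, y, \<sigma>))"
      unfolding split_beta
      by (intro continuous_intros continuous_on_compose2[OF W_cont(3)] continuous_on_compose2[OF ref_cont(5)])
         (use X in auto)
  qed (use S_mem[OF mem] Legendre_max[OF mem] in auto)
  moreover have "((\<lambda>x. (top_excess (t, x, s))\<^sup>2 / 2) has_real_derivative
      top_excess (t, x, s) * (Wx (t, x, s) - Dx (Ds u) (t, x, 1/2))) (at x)"
    unfolding top_excess_def fst_conv snd_conv
    by (intro half_square_pos_part DERIV_diff W_x has_Dx smooth_partials ref) (use X in auto)
  moreover have "((\<lambda>x. (bot_excess (t, x, s))\<^sup>2 / 2) has_real_derivative
      bot_excess (t, x, s) * (Dx (Ds u) (t, x, 0) - Wx (t, x, s))) (at x)"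
    unfolding bot_excess_def fst_conv snd_conv
    by (intro half_square_pos_part DERIV_diff W_x has_Dx smooth_partials ref) (use X in auto)
  ultimately show ?thesis
    unfolding G_def Gx_def foot_def fst_conv snd_conv
    by (intro DERIV_diff[OF DERIV_add[OF DERIV_add] DERIV_cmult[OF W_x]]) (use X in auto)
qed

lemma G_s:
  assumes X: "(t, x, s) \<in> \<Omega>"
  shows "((\<lambda>s. G (t, x, s)) has_real_derivative Gs (t, x, s)) (at s within {0..1/2})"
proof -
  have mem: "(t, x, y) \<in> \<Omega>" if "y \<in> {0..1/2}" for y using X that by auto
  have "((\<lambda>y. S (t, x, y) * W (t, x, y) - u (t, x, S (t, x, y))) has_real_derivative
      S (t, x, s) * Ws (t, x, s)) (at s within {0..1/2})"
  proof (rule danskin[where K = "{0..1/2}" and S = "\<lambda>y. S (t, x, y)" and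
        \<psi> = "\<lambda>y \<sigma>. \<sigma> * W (t, x, y) - u (t, x, \<sigma>)" and \<psi>' = "\<lambda>y \<sigma>. \<sigma> * Ws (t, x, y)"])
    show "((\<lambda>y. \<sigma> * W (t, x, y) - u (t, x, \<sigma>)) has_real_derivative \<sigma> * Ws (t, x, y)) (at y within {0..1/2})"
      if "y \<in> {0..1/2}" "\<sigma> \<in> {0..1/2}" for y \<sigma>
      using DERIV_diff[OF DERIV_cmult[OF W_s[OF mem[OF that(1)]]] DERIV_const, of \<sigma> "u (t, x, \<sigma>)"] by simp
    show "continuous_on {0..1/2} (\<lambda>y. S (t, x, y))"
      by (rule continuous_on_compose2[OF S_cont]) (use X in \<open>auto intro!: continuous_intros\<close>)
    show "continuous_on ({0..1/2} \<times> {0..1/2}) (\<lambda>(y, \<sigma>). \<sigma> * Ws (t, x, y))"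
      unfolding split_beta
      by (intro continuous_intros continuous_on_compose2[OF W_cont(4)]) (use X in auto)
  qed (use X S_mem[OF mem] Legendre_max[OF mem] in auto)
  moreover have "((\<lambda>s. (top_excess (t, x, s))\<^sup>2 / 2) has_real_derivative
      top_excess (t, x, s) * Ws (t, x, s)) (at s within {0..1/2})"
    unfolding top_excess_def fst_conv snd_conv
    using half_square_pos_part[OF DERIV_diff[OF W_s[OF X] DERIV_const]] by simp
  moreover have "((\<lambda>s. (bot_excess (t, x, s))\<^sup>2 / 2) has_real_derivative
      bot_excess (t, x, s) * (- Ws (t, x, s))) (at s within {0..1/2})"
    unfolding bot_excess_def fst_conv snd_conv
    using half_square_pos_part[OF DERIV_diff[OF DERIV_const W_s[OF X]]] by simp
  moreover have "((\<lambda>s. s * W (t, x, s)) has_real_derivative W (t, x, s) + s * Ws (t, x, s)) (at s within {0..1/2})"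
    using DERIV_mult[OF DERIV_ident W_s[OF X]] by (simp add: algebra_simps)
  ultimately show ?thesis
    unfolding G_def Gs_def foot_def fst_conv snd_conv
    by (intro DERIV_diff DERIV_add)
qed

lemma G_cont: "continuous_on \<Omega> G" "continuous_on \<Omega> Gt" "continuous_on \<Omega> Gx" "continuous_on \<Omega> Gs"
proof -
  have b: "continuous_on \<Omega> (\<lambda>X. f (fst X, fst (snd X), 1/2))" "continuous_on \<Omega> (\<lambda>X. f (fst X, fst (snd X), 0))"
    if "continuous_on \<Omega> f" for f :: "field"
    by (rule continuous_on_compose2[OF that]; auto intro!: continuous_intros)+
  show "continuous_on \<Omega> G" "continuous_on \<Omega> Gt" "continuous_on \<Omega> Gx" "continuous_on \<Omega> Gs"
    unfolding G_def[abs_def] Gt_def[abs_def] Gx_def[abs_def] Gs_def[abs_def]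
    by (intro continuous_intros S_cont W_cont excess_cont comp_foot_cont b ref_cont; simp)+
qed

end

text \<open>With this notion an identity between integrals reduces to a pointwise algebraic identity
  modulo an explicit sum of exact derivatives.\<close>

definition null :: "(real \<times> real \<Rightarrow> real) \<Rightarrow> bool" where
  "null f \<longleftrightarrow> continuous_on strip f \<and> integral Q f = 0"

lemma null_add:
  assumes "null f" "null g"
  shows "null (\<lambda>X. f X + g X)"
proof -
  have "integral Q (\<lambda>X. f X + g X) = integral Q f + integral Q g"
    by (rule integral_add) (use assms in \<open>auto simp: null_def intro: strip_integrable\<close>)
  then show ?thesis using assms by (auto simp: null_def intro!: continuous_intros)
qed

lemma null_mult: "null f \<Longrightarrow> null (\<lambda>X. r * f X)"
  by (auto simp: null_def intro!: continuous_intros)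

lemma integral_Q_modulo_null:
  assumes "continuous_on strip g" "null n"
    and eq: "\<And>x s. s \<in> {0..1/2} \<Longrightarrow> f (x, s) = g (x, s) + n (x, s)"
  shows "integral Q f = integral Q g"
proof -
  have "integral Q f = integral Q (\<lambda>X. g X + n X)"
    by (rule integral_cong) (use eq in \<open>auto simp: cbox_Pair_eq\<close>)
  also have "\<dots> = integral Q g + integral Q n"
    by (rule integral_add) (use assms in \<open>auto simp: null_def intro: strip_integrable\<close>)
  finally show ?thesis using assms by (simp add: null_def)
qed

lemma null_cong:
  assumes "null f" "\<And>x s. s \<in> {0..1/2} \<Longrightarrow> g (x, s) = f (x, s)"
  shows "null g"
proof -
  have "continuous_on strip g"
    by (rule continuous_on_eq[of strip f]) (use assms in \<open>auto simp: null_def\<close>)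
  moreover have "integral Q g = integral Q f"
    by (rule integral_cong) (use assms in \<open>auto simp: cbox_Pair_eq\<close>)
  ultimately show ?thesis using assms by (simp add: null_def)
qed

context cylinder
begin

lemma null_parts:
  assumes f: "smooth f" and g: "smooth g" and t: "t \<in> {0..T}" and \<phi>: "continuous_on {0..1/2} \<phi>"
  shows "null (\<lambda>(x, s). \<phi> s * (Dx f (t, x, s) * g (t, x, s) + f (t, x, s) * Dx g (t, x, s)))"
  unfolding null_def
proof
  note ct = smooth_continuous_on[OF f, THEN slice_strip, OF t, unfolded split_beta]
    smooth_continuous_on[OF g, THEN slice_strip, OF t, unfolded split_beta]
    smooth_continuous_on[OF smooth_partials(2)[OF f], THEN slice_strip, OF t, unfolded split_beta]
    smooth_continuous_on[OF smooth_partials(2)[OF g], THEN slice_strip, OF t, unfolded split_beta]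
    continuous_on_compose2[OF \<phi> continuous_on_snd[OF continuous_on_id], of strip]
  show c: "continuous_on strip (\<lambda>(x, s). \<phi> s * (Dx f (t, x, s) * g (t, x, s) + f (t, x, s) * Dx g (t, x, s)))"
    unfolding split_beta by (intro continuous_intros ct) auto
  show "integral Q (\<lambda>(x, s). \<phi> s * (Dx f (t, x, s) * g (t, x, s) + f (t, x, s) * Dx g (t, x, s))) = 0"
  proof (rule integral_dx_eq_0[OF _ c])
    fix x s :: real assume s: "s \<in> {0..1/2}"
    then have X: "(t, x, s) \<in> \<Omega>" using t by auto
    from DERIV_cmult[OF DERIV_mult[OF has_Dx[OF f X] has_Dx[OF g X]], of "\<phi> s"]
    show "((\<lambda>x. \<phi> s * (f (t, x, s) * g (t, x, s))) has_real_derivative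
       \<phi> s * (Dx f (t, x, s) * g (t, x, s) + f (t, x, s) * Dx g (t, x, s))) (at x)"
      by (simp add: algebra_simps)
  next
    fix s :: real assume "s \<in> {0..1/2}"
    then show "\<phi> s * (f (t, 1, s) * g (t, 1, s)) = \<phi> s * (f (t, 0, s) * g (t, 0, s))"
      using t smooth_periodic[OF f, of t 0 s] smooth_periodic[OF g, of t 0 s] by simp
  qed
qed

lemma null_transport:
  assumes E: "euler \<epsilon> U k P" and bc: "\<And>t x. t \<in> {0..T} \<Longrightarrow> k (t, x, 1/2) = 0" and t: "t \<in> {0..T}"
    and g: "smooth g"
  shows "null (\<lambda>(x, s). U (t, x, s) * Dx g (t, x, s) + 2 * s * k (t, x, s) * Ds g (t, x, s))"
  unfolding null_def
proof
  note cont = euler_eqs(1,2)[OF E, THEN smooth_continuous_on] smooth_partials[OF g, THEN smooth_continuous_on]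
  note ct = cont[THEN slice_strip, OF t, unfolded split_beta]
  show "continuous_on strip (\<lambda>(x, s). U (t, x, s) * Dx g (t, x, s) + 2 * s * k (t, x, s) * Ds g (t, x, s))"
    unfolding split_beta by (intro continuous_intros ct)
qed (rule transport_integral_smooth[OF E bc t g])

end

context flow
begin

text \<open>The hydrostatic pressure does not depend on s, so its gradient at the foot point equals
  that at the original point, where it integrates to zero.\<close>

lemma Dx_p_const:
  assumes X: "(t, x, s) \<in> \<Omega>" and Y: "(t, x, s') \<in> \<Omega>"
  shows "Dx p (t, x, s) = Dx p (t, x, s')"
proof (rule DERIV_unique)
  have eq: "p (t, y, s) = p (t, y, s')" for y
  proof -
    have "Ds p (t, y, z) = 0" if "z \<in> {0..1/2}" for z
      using ref(5)[of t y z] X that by simp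
    then have "\<bar>p (t, y, s') - p (t, y, s)\<bar> \<le> 0 * \<bar>s' - s\<bar>"
      by (intro increment_abs[OF has_Ds[OF ref(3)]]) (use X Y in auto)
    then show ?thesis by simp
  qed
  show "((\<lambda>y. p (t, y, s)) has_real_derivative Dx p (t, x, s)) (at x)"
    by (rule has_Dx[OF ref(3) X])
  show "((\<lambda>y. p (t, y, s)) has_real_derivative Dx p (t, x, s')) (at x)"
    unfolding eq by (rule has_Dx[OF ref(3) Y])
qed

lemma gap_eq:
  assumes "(t, x, s) \<in> \<Omega>"
  shows "gap t x s (W (t, x, s)) = G (t, x, s) + u (t, x, s)"
proof -
  have "gap t x s (W (t, x, s)) = S (t, x, s) * W (t, x, s) - u (foot (t, x, s)) + u (t, x, s) - s * W (t, x, s)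
      + (W (t, x, s) - Ds u (foot (t, x, s)))\<^sup>2 / 2"
    by (simp add: gap_def foot_def S_def)
  then show ?thesis unfolding excess_diff(2)[OF assms] by (simp add: G_def add_divide_distrib)
qed

text \<open>What the explicit t and x dependence of the Casimir density contributes along a particle
  path, with \<open>Dt u\<close> replaced by the hydrostatic momentum equation and the pressure
  gradient split off. The last term is due to the quadratic extension, since the end values of w
  evolve too.\<close>

definition N :: "field" where
  "N X = \<rho> (foot X) * Ds u (foot X) + (u (foot X) - U X) * Dx u (foot X)
    - (W X - Ds u (foot X)) * (U X - u (foot X)) * Dx (Ds u) (foot X)"

lemma N_cont: "continuous_on \<Omega> N"
  unfolding N_def[abs_def] \<rho>_def[abs_def]
  by (intro continuous_intros comp_foot_cont W_cont pert_cont ref_cont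
      comp_foot_cont[where f = "\<lambda>X. snd (snd X)"])

text \<open>\<open>W\<close> is transported, so only the explicit dependence of the Casimir density on \<open>t\<close> and \<open>x\<close>
  contributes; by the envelope theorem it is \<open>- u\<^sub>t - U u\<^sub>x\<close> at the foot point.\<close>
lemma material_derivative:
  assumes X: "(t, x, s) \<in> \<Omega>"
  shows "Gt (t, x, s) + (U (t, x, s) * Gx (t, x, s) + 2 * s * K (t, x, s) * Gs (t, x, s))
    = N (t, x, s) + Dx p (t, x, s) - 2 * s * K (t, x, s) * W (t, x, s)"
proof -
  let ?X = "(t, x, s)" and ?h = "(t, x, 1/2) :: point" and ?z = "(t, x, 0) :: point"
  have t: "t \<in> {0..T}" using X by auto
  have h: "?h \<in> \<Omega>" and z: "?z \<in> \<Omega>" using X by auto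
  \<comment> \<open>At both ends 2 s k = 0, so the transport of w along the boundary involves x
    only.\<close>
  have bt: "Dt (Ds u) ?h = - u ?h * Dx (Ds u) ?h" "Dt (Ds u) ?z = - u ?z * Dx (Ds u) ?z"
    using vorticity_transport[OF reference h] vorticity_transport[OF reference z] k_half[OF t] by simp_all
  have tp: "top_excess ?X * ((U ?X - u ?h) * Dx (Ds u) ?h) = top_excess ?X * ((U ?X - u (foot ?X)) * Dx (Ds u) (foot ?X))"
    using top_excess_foot[OF X, of "\<lambda>Y. (U ?X - u Y) * Dx (Ds u) Y"] by simp
  have bp: "bot_excess ?X * ((U ?X - u ?z) * Dx (Ds u) ?z) = bot_excess ?X * ((U ?X - u (foot ?X)) * Dx (Ds u) (foot ?X))"
    using bot_excess_foot[OF X, of "\<lambda>Y. (U ?X - u Y) * Dx (Ds u) Y"] by simp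
  have F: "(t, x, S ?X) \<in> \<Omega>" using foot_mem[OF X] by (simp add: foot_def)
  have ft: "- Dt u (foot ?X) = u (foot ?X) * Dx u (foot ?X) + \<rho> (foot ?X) * Ds u (foot ?X) + Dx p ?X"
    using ref(4)[OF F] Dx_p_const[OF X F] by (simp add: foot_def \<rho>_def)
  \<comment> \<open>All derivatives of W collect into one multiple of its transport equation. The
    last term is left over because s W depends on s explicitly.\<close>
  have "Gt ?X + (U ?X * Gx ?X + 2 * s * K ?X * Gs ?X)
    = (S ?X + top_excess ?X - bot_excess ?X - s) * (Wt ?X + U ?X * Wx ?X + 2 * s * K ?X * Ws ?X)
      + (- Dt u (foot ?X)) - U ?X * Dx u (foot ?X)
      - top_excess ?X * ((U ?X - u ?h) * Dx (Ds u) ?h) + bot_excess ?X * ((U ?X - u ?z) * Dx (Ds u) ?z)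
      - 2 * s * K ?X * W ?X"
    by (simp add: Gt_def Gx_def Gs_def bt algebra_simps)
  also have "\<dots> = N ?X + Dx p ?X - 2 * s * K ?X * W ?X"
    unfolding W_transport[OF X] tp bp ft N_def excess_diff(1)[OF X] by (simp add: algebra_simps)
  finally show ?thesis .
qed

text \<open>Expanding W, the function is the transport of U minus the x-derivatives of U^2 / 2 and
  of \<open>\<epsilon>\<^sup>2 * s * K\<^sup>2\<close>.\<close>

lemma null_K_W:
  assumes t: "t \<in> {0..T}"
  shows "null (\<lambda>(x, s). 2 * s * K (t, x, s) * W (t, x, s))"
proof (rule null_cong[OF null_add[OF null_transport[OF flow K_half t pert(1)]
        null_add[OF null_mult[OF null_parts[OF pert(1,1) t continuous_on_const[of _ "1 / 2"]], of "-1"]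
          null_mult[OF null_parts[OF pert(2,2) t continuous_on_id], of "- \<epsilon>\<^sup>2"]]]])
qed (simp_all add: vort_def algebra_simps)

text \<open>Transport of G integrates to zero, so its time derivative may be replaced by the
  material derivative. Beside N this contains only the pressure gradient and 2 s K W, both null, and
  the added u has conserved integral.\<close>

lemma gap_derivative:
  assumes t: "t \<in> {0..T}"
  shows "((\<lambda>t. integral Q (\<lambda>(x, s). gap t x s (W (t, x, s)))) has_real_derivative
    integral Q (\<lambda>(x, s). N (t, x, s))) (at t within {0..T})"
proof -
  have eq: "integral Q (\<lambda>(x, s). gap t x s (W (t, x, s))) = integral Q (\<lambda>(x, s). G (t, x, s) + u (t, x, s))"
    if "t \<in> {0..T}" for t
    by (rule integral_cong) (use that gap_eq in \<open>auto simp: cbox_Pair_eq\<close>)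
  have "((\<lambda>t. integral Q (\<lambda>(x, s). G (t, x, s) + u (t, x, s))) has_real_derivative
    integral Q (\<lambda>(x, s). Gt (t, x, s) + Dt u (t, x, s))) (at t within {0..T})"
    by (rule integral_Q_derivative[where f = "\<lambda>X. G X + u X" and ft = "\<lambda>X. Gt X + Dt u X", OF _ _ _ t])
       (auto intro!: DERIV_add G_t has_Dt ref continuous_intros G_cont ref_cont)
  moreover have "integral Q (\<lambda>(x, s). Gt (t, x, s) + Dt u (t, x, s)) = integral Q (\<lambda>(x, s). N (t, x, s))"
  proof (rule integral_Q_modulo_null)
    show "continuous_on strip (\<lambda>(x, s). N (t, x, s))" by (rule slice_strip[OF N_cont t])
    have 1: "null (\<lambda>(x, s). Dt u (t, x, s))"
      unfolding null_def using momentum_conserved[OF reference k_half t] slice_strip[OF ref_cont(4) t] by simp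
    have 2: "null (\<lambda>(x, s). Dx p (t, x, s))"
      unfolding null_def using integral_Dx[OF ref(3) t]
        slice_strip[OF smooth_continuous_on[OF smooth_partials(2)[OF ref(3)]] t] by simp
    have 3: "null (\<lambda>(x, s). U (t, x, s) * Gx (t, x, s) + 2 * s * K (t, x, s) * Gs (t, x, s))"
      unfolding null_def
    proof
      note cont = pert_cont(1,2) G_cont
      note ct = cont[THEN slice_strip, OF t, unfolded split_beta]
      show "continuous_on strip (\<lambda>(x, s). U (t, x, s) * Gx (t, x, s) + 2 * s * K (t, x, s) * Gs (t, x, s))"
        unfolding split_beta by (intro continuous_intros ct)
      show "integral Q (\<lambda>(x, s). U (t, x, s) * Gx (t, x, s) + 2 * s * K (t, x, s) * Gs (t, x, s)) = 0"
      proof (rule transport_integral[OF flow K_half t _ _ G_cont(1,3,4)])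
        show "G (t, 1, s) = G (t, 0, s)" if s: "s \<in> {0..1/2}" for s
        proof -
          have X: "(t, 0, s) \<in> \<Omega>" using t s by auto
          have per: "f (t, 1, z) = f (t, 0, z)" if "smooth f" "z \<in> {0..1/2}" for f z
            using smooth_periodic[OF that(1), of t 0 z] t that(2) by simp
          have W: "W (t, 1, s) = W (t, 0, s)" using W_periodic[OF X] by simp
          \<comment> \<open>\<open>sel\<close> is an arbitrary choice, so its periodicity is
            obtained from equality of the predicates from which it chooses.\<close>
          have "variational t 1 \<omega> = variational t 0 \<omega>" for \<omega>
            unfolding variational_def using per[OF smooth_partials(3)[OF ref(1)]] by (auto simp: fun_eq_iff)
          then have "S (t, 1, s) = S (t, 0, s)" unfolding S_def sel_def by (simp add: W)
          then show ?thesis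
            using per[OF ref(1) S_mem[OF X]] per[OF smooth_partials(3)[OF ref(1)], of "1/2"]
              per[OF smooth_partials(3)[OF ref(1)], of 0]
            by (simp add: G_def foot_def top_excess_def bot_excess_def W)
        qed
      qed (use t in \<open>auto intro!: G_x G_s\<close>)
    qed
    show "null (\<lambda>X. (case X of (x, s) \<Rightarrow> Dt u (t, x, s)) + ((case X of (x, s) \<Rightarrow> Dx p (t, x, s))
       + (-1 * (case X of (x, s) \<Rightarrow> 2 * s * K (t, x, s) * W (t, x, s))
       + -1 * (case X of (x, s) \<Rightarrow> U (t, x, s) * Gx (t, x, s) + 2 * s * K (t, x, s) * Gs (t, x, s)))))"
      by (intro null_add null_mult 1 2 3 null_K_W[OF t])
    fix x s :: real assume "s \<in> {0..1/2}"
    then have "(t, x, s) \<in> \<Omega>" using t by auto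
    from material_derivative[OF this]
    show "(case (x, s) of (x, s) \<Rightarrow> Gt (t, x, s) + Dt u (t, x, s)) = (case (x, s) of (x, s) \<Rightarrow> N (t, x, s)) +
      ((case (x, s) of (x, s) \<Rightarrow> Dt u (t, x, s)) + ((case (x, s) of (x, s) \<Rightarrow> Dx p (t, x, s))
       + (-1 * (case (x, s) of (x, s) \<Rightarrow> 2 * s * K (t, x, s) * W (t, x, s))
       + -1 * (case (x, s) of (x, s) \<Rightarrow> U (t, x, s) * Gx (t, x, s) + 2 * s * K (t, x, s) * Gs (t, x, s)))))"
      by simp
  qed
  ultimately show ?thesis
    by (intro real_derivative_within_transform[OF _ t eq]) auto
qed

lemma perturbation:
  assumes t: "t \<in> {0..T}"
  shows "perturbation (\<lambda>x s. U (t, x, s) - u (t, x, s)) (\<lambda>x s. Dx U (t, x, s) - Dx u (t, x, s))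
    (\<lambda>x s. Ds U (t, x, s) - Ds u (t, x, s)) (\<lambda>x s. K (t, x, s) - k (t, x, s))
    (\<lambda>x s. Dx K (t, x, s) - Dx k (t, x, s)) (\<lambda>x s. Ds K (t, x, s) - Ds k (t, x, s))
    (\<lambda>x s. Dx k (t, x, s)) (\<lambda>x s. Dx (Dx k) (t, x, s)) (\<epsilon>\<^sup>2) m"
proof
  fix x s :: real assume s: "s \<in> {0..1/2}"
  then have X: "(t, x, s) \<in> \<Omega>" using t by auto
  show "((\<lambda>x. U (t, x, s) - u (t, x, s)) has_real_derivative Dx U (t, x, s) - Dx u (t, x, s)) (at x)"
    by (intro DERIV_diff has_Dx pert ref X)
  show "((\<lambda>s. U (t, x, s) - u (t, x, s)) has_real_derivative Ds U (t, x, s) - Ds u (t, x, s)) (at s within {0..1/2})"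
    by (intro DERIV_diff has_Ds pert ref X)
  show "((\<lambda>x. K (t, x, s) - k (t, x, s)) has_real_derivative Dx K (t, x, s) - Dx k (t, x, s)) (at x)"
    by (intro DERIV_diff has_Dx pert ref X)
  show "((\<lambda>s. K (t, x, s) - k (t, x, s)) has_real_derivative Ds K (t, x, s) - Ds k (t, x, s)) (at s within {0..1/2})"
    by (intro DERIV_diff has_Ds pert ref X)
  show "((\<lambda>x. Dx k (t, x, s)) has_real_derivative Dx (Dx k) (t, x, s)) (at x)"
    by (intro has_Dx smooth_partials ref X)
  show "U (t, x + 1, s) - u (t, x + 1, s) = U (t, x, s) - u (t, x, s) \<and>
      K (t, x + 1, s) - k (t, x + 1, s) = K (t, x, s) - k (t, x, s) \<and> Dx k (t, x + 1, s) = Dx k (t, x, s)"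
    using smooth_periodic[OF pert(1) X] smooth_periodic[OF pert(2) X] smooth_periodic[OF ref(1) X]
      smooth_periodic[OF ref(2) X] smooth_periodic[OF smooth_partials(2)[OF ref(2)] X] by simp
  show "Dx U (t, x, s) - Dx u (t, x, s) + 2 * (K (t, x, s) - k (t, x, s)) + 2 * s * (Ds K (t, x, s) - Ds k (t, x, s)) = 0"
    using pert(6)[OF X] ref(6)[OF X] by (simp add: algebra_simps)
  show "\<bar>Dx k (t, x, s)\<bar> \<le> m \<and> \<bar>Dx (Dx k) (t, x, s)\<bar> \<le> m" if "x \<in> {0..1}"
    using m[of "(t, x, s)"] t s that by auto
next
  note cont = pert_cont ref_cont smooth_partials(2)[OF smooth_partials(2)[OF ref(2)], THEN smooth_continuous_on]
  note ct = cont[THEN slice_strip, OF t, unfolded split_beta]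
  show "continuous_on strip (\<lambda>(x, s). U (t, x, s) - u (t, x, s))"
    "continuous_on strip (\<lambda>(x, s). Dx U (t, x, s) - Dx u (t, x, s))"
    "continuous_on strip (\<lambda>(x, s). Ds U (t, x, s) - Ds u (t, x, s))"
    "continuous_on strip (\<lambda>(x, s). K (t, x, s) - k (t, x, s))"
    "continuous_on strip (\<lambda>(x, s). Dx K (t, x, s) - Dx k (t, x, s))"
    "continuous_on strip (\<lambda>(x, s). Ds K (t, x, s) - Ds k (t, x, s))"
    "continuous_on strip (\<lambda>(x, s). Dx k (t, x, s))"
    "continuous_on strip (\<lambda>(x, s). Dx (Dx k) (t, x, s))"
    unfolding split_beta by (intro continuous_intros ct)+
qed (use K_half[OF t] k_half[OF t] in auto)

end

section \<open>The energy estimate\<close>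

context reference
begin

definition C_gap :: real where "C_gap = 4 + 4 * M\<^sup>2 / \<sigma>"
definition C_quad :: real where "C_quad = 1 / \<sigma> + M / (2 * \<sigma>\<^sup>2) + 1/2"
definition C_defect :: real where "C_defect = M\<^sup>2 / \<sigma>\<^sup>2 + 2 * M / \<sigma> + M + M\<^sup>2 / \<sigma>"
text \<open>The 3: vorticity and velocity error together are at most three times the sum of
  vorticity error, forcing and mean. The 2: the linear terms are at most the forcing plus the
  centred velocity error. The last factor passes from the vorticity error to the gap.\<close>

definition C_rate :: real where "C_rate = (3 * C_defect + 2) * (C_gap + 1)"
text \<open>The first factor bounds the energy by the gap at time t, the second bounds the gap by
  the energy at time 0, both up to forcing and mean; the exponential is Gronwall's.\<close>

definition C_core :: real where "C_core = (3 * C_gap + 1) * (C_quad + 1) * exp (C_rate * T)"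

lemma constants_nonneg: "0 \<le> C_gap" "0 \<le> C_quad" "0 \<le> C_defect" "0 \<le> C_rate" "0 \<le> C_core"
  using M_nonneg \<sigma> by (simp_all add: C_gap_def C_quad_def C_defect_def C_rate_def C_core_def)

end

context flow
begin

abbreviation vort_sq :: "real \<Rightarrow> real" where
  "vort_sq t \<equiv> integral Q (\<lambda>(x, s). (W (t, x, s) - Ds u (t, x, s))\<^sup>2)"
abbreviation vel_sq :: "real \<Rightarrow> real" where
  "vel_sq t \<equiv> integral Q (\<lambda>(x, s). (U (t, x, s) - u (t, x, s))\<^sup>2)"
abbreviation rad_sq :: "real \<Rightarrow> real" where
  "rad_sq t \<equiv> integral Q (\<lambda>(x, s). 2 * s * \<epsilon>\<^sup>2 * (K (t, x, s) - k (t, x, s))\<^sup>2)"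
abbreviation mean :: "real \<Rightarrow> real" where
  "mean t \<equiv> integral Q (\<lambda>(x, s). U (t, x, s) - u (t, x, s))"
abbreviation centred_sq :: "real \<Rightarrow> real" where
  "centred_sq t \<equiv> integral Q (\<lambda>(x, s). (U (t, x, s) - u (t, x, s) - 2 * mean t)\<^sup>2)"
abbreviation total_gap :: "real \<Rightarrow> real" where
  "total_gap t \<equiv> integral Q (\<lambda>(x, s). gap t x s (W (t, x, s)))"

lemma gap_continuous: "t \<in> {0..T} \<Longrightarrow> continuous_on strip (\<lambda>(x, s). gap t x s (W (t, x, s)))"
  by (rule continuous_on_eq[OF slice_strip[where f = "\<lambda>X. G X + u X"]])
     (auto intro!: continuous_intros G_cont ref_cont simp: gap_eq)

lemma mean_conserved:
  assumes t: "t \<in> {0..T}"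
  shows "mean t = mean 0"
proof -
  have "(mean has_real_derivative 0) (at t within {0..T})" if t: "t \<in> {0..T}" for t
  proof -
    have "(mean has_real_derivative integral Q (\<lambda>(x, s). Dt U (t, x, s) - Dt u (t, x, s))) (at t within {0..T})"
      by (rule integral_Q_derivative[where f = "\<lambda>X. U X - u X" and ft = "\<lambda>X. Dt U X - Dt u X", OF _ _ _ t])
         (auto intro!: DERIV_diff has_Dt ref pert continuous_intros ref_cont pert_cont)
    moreover have "integral Q (\<lambda>(x, s). Dt U (t, x, s) - Dt u (t, x, s))
        = integral Q (\<lambda>(x, s). Dt U (t, x, s)) - integral Q (\<lambda>(x, s). Dt u (t, x, s))"
      using integral_diff[OF strip_integrable strip_integrable, OF slice_strip[OF pert_cont(4) t] slice_strip[OF ref_cont(4) t]]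
      by (simp only: case_prod_unfold)
    ultimately show ?thesis
      using momentum_conserved[OF flow K_half t] momentum_conserved[OF reference k_half t] by simp
  qed
  from has_field_derivative_zero_constant[OF convex_real_interval(5) this] obtain c where "\<And>t. t \<in> {0..T} \<Longrightarrow> mean t = c"
    by blast
  then show ?thesis using t T by auto
qed

lemma elliptic_estimates:
  assumes t: "t \<in> {0..T}"
  shows "centred_sq t + rad_sq t \<le> 2 * vort_sq t + \<epsilon> ^ 4 * m\<^sup>2"
    and "\<bar>\<epsilon>\<^sup>2 * integral Q (\<lambda>(x, s). 2 * s * Dx k (t, x, s) * (K (t, x, s) - k (t, x, s)))\<bar> \<le> \<epsilon> ^ 4 * m\<^sup>2 + centred_sq t"
    and "2 * (mean t)\<^sup>2 \<le> vel_sq t" and "vel_sq t \<le> centred_sq t + 2 * (mean t)\<^sup>2"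
proof -
  note p = perturbation[OF t]
  have e: "(\<epsilon>\<^sup>2)\<^sup>2 = \<epsilon> ^ 4" by simp
  have W: "Ds U (t, x, s) - Ds u (t, x, s) - \<epsilon>\<^sup>2 * (Dx K (t, x, s) - Dx k (t, x, s)) - \<epsilon>\<^sup>2 * Dx k (t, x, s)
    = W (t, x, s) - Ds u (t, x, s)" for x s
    by (simp add: vort_def algebra_simps)
  note c = perturbation.c_def[OF p]
  show "centred_sq t + rad_sq t \<le> 2 * vort_sq t + \<epsilon> ^ 4 * m\<^sup>2"
    using perturbation.velocity_estimate[OF p] unfolding c e W .
  show "\<bar>\<epsilon>\<^sup>2 * integral Q (\<lambda>(x, s). 2 * s * Dx k (t, x, s) * (K (t, x, s) - k (t, x, s)))\<bar> \<le> \<epsilon> ^ 4 * m\<^sup>2 + centred_sq t"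
    using perturbation.forcing_estimate[OF p] unfolding c e .
  show "2 * (mean t)\<^sup>2 \<le> vel_sq t" "vel_sq t \<le> centred_sq t + 2 * (mean t)\<^sup>2"
    using perturbation.mean_estimate[OF p] perturbation.centre_estimate[OF p] unfolding c .
qed

lemma sq_continuous:
  assumes t: "t \<in> {0..T}"
  shows "continuous_on strip (\<lambda>(x, s). (W (t, x, s) - Ds u (t, x, s))\<^sup>2)"
    and "continuous_on strip (\<lambda>(x, s). (U (t, x, s) - u (t, x, s))\<^sup>2)"
    and "continuous_on strip (\<lambda>(x, s). 2 * s * \<epsilon>\<^sup>2 * (K (t, x, s) - k (t, x, s))\<^sup>2)"
proof -
  note cont = pert_cont ref_cont W_cont
  note ct = cont[THEN slice_strip, OF t, unfolded split_beta]
  show "continuous_on strip (\<lambda>(x, s). (W (t, x, s) - Ds u (t, x, s))\<^sup>2)"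
    "continuous_on strip (\<lambda>(x, s). (U (t, x, s) - u (t, x, s))\<^sup>2)"
    "continuous_on strip (\<lambda>(x, s). 2 * s * \<epsilon>\<^sup>2 * (K (t, x, s) - k (t, x, s))\<^sup>2)"
    unfolding split_beta by (intro continuous_intros ct)+
qed

lemma sq_nonneg: "t \<in> {0..T} \<Longrightarrow> 0 \<le> vort_sq t" "t \<in> {0..T} \<Longrightarrow> 0 \<le> vel_sq t" "t \<in> {0..T} \<Longrightarrow> 0 \<le> rad_sq t"
  by (rule integral_Q_nonneg[OF sq_continuous(1)]; simp)
     (rule integral_Q_nonneg[OF sq_continuous(2)] integral_Q_nonneg[OF sq_continuous(3)]; simp)+

lemma energy_eq:
  assumes t: "t \<in> {0..T}"
  shows "energy \<epsilon> U K u k t = vel_sq t + rad_sq t + vort_sq t"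
proof -
  note i = sq_continuous[OF t, THEN strip_integrable]
  have "energy \<epsilon> U K u k t = integral Q (\<lambda>X. ((case X of (x, s) \<Rightarrow> (U (t, x, s) - u (t, x, s))\<^sup>2)
     + (case X of (x, s) \<Rightarrow> 2 * s * \<epsilon>\<^sup>2 * (K (t, x, s) - k (t, x, s))\<^sup>2))
     + (case X of (x, s) \<Rightarrow> (W (t, x, s) - Ds u (t, x, s))\<^sup>2))"
    by (simp only: energy_def case_prod_unfold)
  also have "\<dots> = vel_sq t + rad_sq t + vort_sq t"
    by (subst integral_add[OF integrable_add[OF i(2,3)] i(1)], subst integral_add[OF i(2,3)]) simp
  finally show ?thesis .
qed

lemma gap_integral_bounds:
  assumes t: "t \<in> {0..T}"
  shows "vort_sq t \<le> C_gap * total_gap t" "total_gap t \<le> C_quad * vort_sq t"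
proof -
  have "vort_sq t \<le> integral Q (\<lambda>X. C_gap * (case X of (x, s) \<Rightarrow> gap t x s (W (t, x, s))))"
    by (rule integral_Q_le[OF sq_continuous(1)[OF t] continuous_on_mult_left[OF gap_continuous[OF t]]])
       (use gap_lower[OF t] in \<open>simp add: C_gap_def\<close>)
  then show "vort_sq t \<le> C_gap * total_gap t" by simp
  have "total_gap t \<le> integral Q (\<lambda>X. C_quad * (case X of (x, s) \<Rightarrow> (W (t, x, s) - Ds u (t, x, s))\<^sup>2))"
    by (rule integral_Q_le[OF gap_continuous[OF t] continuous_on_mult_left[OF sq_continuous(1)[OF t]]])
       (use gap_upper[OF t] in \<open>simp add: C_quad_def\<close>)
  then show "total_gap t \<le> C_quad * vort_sq t" by (simp only: integral_mult_right)
qed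

lemma total_gap_nonneg:
  assumes t: "t \<in> {0..T}"
  shows "0 \<le> total_gap t"
proof (rule ccontr)
  assume "\<not> 0 \<le> total_gap t"
  then have "C_gap * total_gap t < 0" using \<sigma> by (intro mult_pos_neg) (auto simp: C_gap_def add_pos_nonneg)
  then show False using gap_integral_bounds(1)[OF t] sq_nonneg(1)[OF t] by linarith
qed

text \<open>Here the linear terms cancel: the integrand is exact up to the forcing, by transport of
  U along the reference and the x-derivatives of u U, u^2, s k K and s k^2. What survives comes from
  \<open>\<epsilon>\<^sup>2 * Dx K\<close> in W, with the derivative moved onto k.\<close>

lemma linear_terms:
  assumes t: "t \<in> {0..T}"
  shows "integral Q (\<lambda>(x, s). \<rho> (t, x, s) * W (t, x, s) - (U (t, x, s) - u (t, x, s)) * Dx u (t, x, s))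
    = \<epsilon>\<^sup>2 * integral Q (\<lambda>(x, s). 2 * s * Dx k (t, x, s) * (K (t, x, s) - k (t, x, s)))"
proof -
  let ?g = "\<lambda>X. \<epsilon>\<^sup>2 * (case X of (x, s) \<Rightarrow> 2 * s * Dx k (t, x, s) * (K (t, x, s) - k (t, x, s)))"
  note cont = pert_cont ref_cont
  note ct = cont[THEN slice_strip, OF t, unfolded split_beta]
  have "integral Q (\<lambda>(x, s). \<rho> (t, x, s) * W (t, x, s) - (U (t, x, s) - u (t, x, s)) * Dx u (t, x, s)) = integral Q ?g"
  proof (rule integral_Q_modulo_null)
    show "continuous_on strip ?g"
      unfolding split_beta by (intro continuous_intros ct)
    show "null (\<lambda>X. (case X of (x, s) \<Rightarrow> u (t, x, s) * Dx U (t, x, s) + 2 * s * k (t, x, s) * Ds U (t, x, s))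
      + (-1 * (case X of (x, s) \<Rightarrow> 1 * (Dx u (t, x, s) * U (t, x, s) + u (t, x, s) * Dx U (t, x, s)))
      + ((case X of (x, s) \<Rightarrow> 1/2 * (Dx u (t, x, s) * u (t, x, s) + u (t, x, s) * Dx u (t, x, s)))
      + ((- 2 * \<epsilon>\<^sup>2) * (case X of (x, s) \<Rightarrow> s * (Dx k (t, x, s) * K (t, x, s) + k (t, x, s) * Dx K (t, x, s)))
      + \<epsilon>\<^sup>2 * (case X of (x, s) \<Rightarrow> s * (Dx k (t, x, s) * k (t, x, s) + k (t, x, s) * Dx k (t, x, s)))))))"
      by (intro null_add null_mult null_transport[OF reference k_half t pert(1)]
          null_parts[OF ref(1) pert(1) t] null_parts[OF ref(1,1) t] null_parts[OF ref(2) pert(2) t]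
          null_parts[OF ref(2,2) t] continuous_intros)
  qed (simp add: \<rho>_def vort_def algebra_simps)
  then show ?thesis by simp
qed

lemma gap_rate:
  assumes t: "t \<in> {0..T}"
  shows "integral Q (\<lambda>(x, s). N (t, x, s)) \<le> C_rate * (total_gap t + \<epsilon> ^ 4 * m\<^sup>2 + 2 * (mean 0)\<^sup>2)"
proof -
  note cont = pert_cont ref_cont W_cont
  note ct = cont[THEN slice_strip, OF t, unfolded split_beta]
  have lc: "continuous_on strip (\<lambda>(x, s). \<rho> (t, x, s) * W (t, x, s) - (U (t, x, s) - u (t, x, s)) * Dx u (t, x, s))"
    unfolding split_beta \<rho>_def snd_conv by (intro continuous_intros ct)
  have vc: "continuous_on strip (\<lambda>X. (case X of (x, s) \<Rightarrow> (W (t, x, s) - Ds u (t, x, s))\<^sup>2)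
      + (case X of (x, s) \<Rightarrow> (U (t, x, s) - u (t, x, s))\<^sup>2))"
    by (intro continuous_on_add sq_continuous t)
  have "integral Q (\<lambda>(x, s). N (t, x, s)) \<le> integral Q (\<lambda>X. C_defect * ((case X of (x, s) \<Rightarrow> (W (t, x, s) - Ds u (t, x, s))\<^sup>2)
      + (case X of (x, s) \<Rightarrow> (U (t, x, s) - u (t, x, s))\<^sup>2))
      + (case X of (x, s) \<Rightarrow> \<rho> (t, x, s) * W (t, x, s) - (U (t, x, s) - u (t, x, s)) * Dx u (t, x, s)))"
  proof (rule integral_Q_le[OF slice_strip[OF N_cont t]])
    fix x s :: real assume "x \<in> {0..1}" "s \<in> {0..1/2}"
    from defect_bound[OF t this, of "W (t, x, s)" "U (t, x, s)"]
    show "(case (x, s) of (x, s) \<Rightarrow> N (t, x, s)) \<le> C_defect * ((case (x, s) of (x, s) \<Rightarrow> (W (t, x, s) - Ds u (t, x, s))\<^sup>2)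
      + (case (x, s) of (x, s) \<Rightarrow> (U (t, x, s) - u (t, x, s))\<^sup>2))
      + (case (x, s) of (x, s) \<Rightarrow> \<rho> (t, x, s) * W (t, x, s) - (U (t, x, s) - u (t, x, s)) * Dx u (t, x, s))"
      by (simp add: N_def foot_def S_def C_defect_def)
  qed (intro continuous_on_add continuous_on_mult_left vc lc)
  also have "\<dots> = C_defect * (vort_sq t + vel_sq t)
      + \<epsilon>\<^sup>2 * integral Q (\<lambda>(x, s). 2 * s * Dx k (t, x, s) * (K (t, x, s) - k (t, x, s)))"
    by (subst integral_add[OF strip_integrable[OF continuous_on_mult_left[OF vc]] strip_integrable[OF lc]],
        subst integral_mult_right, subst integral_add[OF strip_integrable strip_integrable, OF sq_continuous(1,2)[OF t]])
       (simp only: linear_terms[OF t])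
  also have "\<dots> \<le> (3 * C_defect + 2) * (vort_sq t + \<epsilon> ^ 4 * m\<^sup>2 + 2 * (mean 0)\<^sup>2)"
  proof -
    define V where "V = vort_sq t"
    define E where "E = \<epsilon> ^ 4 * m\<^sup>2"
    define c where "c = 2 * (mean 0)\<^sup>2"
    have nn: "0 \<le> V" "0 \<le> E" "0 \<le> c" using sq_nonneg(1)[OF t] by (simp_all add: V_def E_def c_def)
    define A where "A = centred_sq t"
    have est: "A \<le> 2 * V + E"
      "\<epsilon>\<^sup>2 * integral Q (\<lambda>(x, s). 2 * s * Dx k (t, x, s) * (K (t, x, s) - k (t, x, s))) \<le> E + A"
      "vel_sq t \<le> A + c"
      using elliptic_estimates[OF t] sq_nonneg(3)[OF t] mean_conserved[OF t]
      by (simp_all add: A_def V_def E_def c_def abs_le_iff)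
    have "C_defect * (V + vel_sq t) \<le> C_defect * (3 * (V + E + c))"
      using est nn constants_nonneg(3) by (intro mult_left_mono) auto
    moreover have "E + A \<le> 2 * (V + E + c)"
    proof -
      have "E + A \<le> 2 * V + 2 * E" using est(1) by simp
      also have "\<dots> \<le> 2 * (V + E + c)" using nn(3) by simp
      finally show ?thesis .
    qed
    ultimately show ?thesis
      using est(2) unfolding V_def[symmetric] E_def[symmetric] c_def[symmetric] by (simp add: algebra_simps)
  qed
  also have "\<dots> \<le> (3 * C_defect + 2) * ((C_gap + 1) * (total_gap t + \<epsilon> ^ 4 * m\<^sup>2 + 2 * (mean 0)\<^sup>2))"
  proof (rule mult_left_mono)
    have g: "vort_sq t \<le> C_gap * total_gap t" by (rule gap_integral_bounds(1)[OF t])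
    note total_gap_nonneg[OF t]
    moreover have "0 \<le> C_gap * (\<epsilon> ^ 4 * m\<^sup>2 + 2 * (mean 0)\<^sup>2)"
      using constants_nonneg(1) by (intro mult_nonneg_nonneg) auto
    ultimately show "vort_sq t + \<epsilon> ^ 4 * m\<^sup>2 + 2 * (mean 0)\<^sup>2 \<le> (C_gap + 1) * (total_gap t + \<epsilon> ^ 4 * m\<^sup>2 + 2 * (mean 0)\<^sup>2)"
      using g by (simp add: algebra_simps)
  qed (use constants_nonneg in simp)
  finally show ?thesis by (simp add: C_rate_def mult.assoc)
qed

text \<open>Gronwall by an integrating factor. Forcing and mean are constant in time and can be
  added to the gap, so the differential inequality becomes homogeneous.\<close>

lemma total_gap_growth:
  assumes t: "t \<in> {0..T}"
  shows "total_gap t + \<epsilon> ^ 4 * m\<^sup>2 + 2 * (mean 0)\<^sup>2 \<le> (total_gap 0 + \<epsilon> ^ 4 * m\<^sup>2 + 2 * (mean 0)\<^sup>2) * exp (C_rate * T)"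
proof -
  let ?c = "\<epsilon> ^ 4 * m\<^sup>2 + 2 * (mean 0)\<^sup>2"
  have d: "((\<lambda>t. - ((total_gap t + ?c) * exp (- C_rate * t))) has_real_derivative
      (C_rate * (total_gap t + ?c) - integral Q (\<lambda>(x, s). N (t, x, s))) * exp (- C_rate * t)) (at t within {0..T})"
    if "t \<in> {0..T}" for t
    by (rule derivative_eq_intros gap_derivative[OF that] refl)+ (simp add: algebra_simps)
  have "0 * (t - 0) \<le> - ((total_gap t + ?c) * exp (- C_rate * t)) - - ((total_gap 0 + ?c) * exp (- C_rate * 0))"
    by (rule increment_lower[OF d]) (use t T gap_rate in \<open>auto simp: add.assoc\<close>)
  then have "(total_gap t + ?c) * exp (- C_rate * t) \<le> total_gap 0 + ?c" by simp
  then have "(total_gap t + ?c) * exp (- C_rate * t) * exp (C_rate * t) \<le> (total_gap 0 + ?c) * exp (C_rate * t)"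
    by (rule mult_right_mono) simp
  then have "total_gap t + ?c \<le> (total_gap 0 + ?c) * exp (C_rate * t)"
    by (simp add: mult.assoc flip: exp_add)
  also have "\<dots> \<le> (total_gap 0 + ?c) * exp (C_rate * T)"
  proof (rule mult_left_mono)
    show "exp (C_rate * t) \<le> exp (C_rate * T)" using t constants_nonneg by (simp add: mult_left_mono)
    have "0 \<le> total_gap 0" by (rule total_gap_nonneg) (use T in auto)
    then show "0 \<le> total_gap 0 + ?c" by simp
  qed
  finally show ?thesis by (simp add: add.assoc)
qed

theorem energy_estimate:
  assumes t: "t \<in> {0..T}"
  shows "energy \<epsilon> U K u k t \<le> C_core * (energy \<epsilon> U K u k 0 + \<epsilon> ^ 4 * m\<^sup>2)"
proof -
  define E where "E = \<epsilon> ^ 4 * m\<^sup>2"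
  define c where "c = 2 * (mean 0)\<^sup>2"
  define Y where "Y t = total_gap t" for t
  have z: "0 \<in> {0..T}" using T by auto
  have nn: "0 \<le> E" "0 \<le> c" by (simp_all add: E_def c_def)
  \<comment> \<open>By the elliptic estimate the centred and the radial velocity error together cost
    twice the vorticity error and E; the mean costs c.\<close>
  have "energy \<epsilon> U K u k t \<le> 3 * vort_sq t + E + c"
    using elliptic_estimates[OF t] mean_conserved[OF t] unfolding energy_eq[OF t] E_def c_def by simp
  also have "\<dots> \<le> 3 * (C_gap * Y t) + E + c" using gap_integral_bounds(1)[OF t] by (simp add: Y_def)
  also have "\<dots> \<le> (3 * C_gap + 1) * (Y t + E + c)"
  proof -
    have "0 \<le> C_gap * (E + c)" using constants_nonneg(1) nn by simp
    moreover have "0 \<le> Y t" unfolding Y_def by (rule total_gap_nonneg[OF t])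
    ultimately show ?thesis by (simp add: algebra_simps)
  qed
  also have "\<dots> \<le> (3 * C_gap + 1) * ((Y 0 + E + c) * exp (C_rate * T))"
    using total_gap_growth[OF t] constants_nonneg(1) unfolding Y_def E_def c_def by (intro mult_left_mono) auto
  also have "\<dots> \<le> (3 * C_gap + 1) * (((C_quad + 1) * (energy \<epsilon> U K u k 0 + E)) * exp (C_rate * T))"
  proof (intro mult_left_mono mult_right_mono)
    have "Y 0 \<le> C_quad * vort_sq 0" unfolding Y_def by (rule gap_integral_bounds(2)[OF z])
    also have "\<dots> \<le> C_quad * energy \<epsilon> U K u k 0"
      using energy_eq[OF z] sq_nonneg[OF z] constants_nonneg(2) by (intro mult_left_mono) auto
    finally have "Y 0 \<le> C_quad * energy \<epsilon> U K u k 0" .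
    moreover have "c \<le> energy \<epsilon> U K u k 0"
      using elliptic_estimates(3)[OF z] energy_eq[OF z] sq_nonneg[OF z] by (simp add: c_def)
    moreover have "0 \<le> C_quad * E" using constants_nonneg(2) nn by simp
    ultimately show "Y 0 + E + c \<le> (C_quad + 1) * (energy \<epsilon> U K u k 0 + E)" by (simp add: algebra_simps)
  qed (use constants_nonneg in auto)
  finally show ?thesis by (simp add: C_core_def E_def mult_ac)
qed

end

section \<open>Comparison with shear flows\<close>

context cylinder
begin

lemma smooth_shear:
  assumes f: "smooth f"
  shows "smooth (\<lambda>(t, x, s). f (0, 0, s))"
proof -
  let ?L = "\<lambda>X :: point. (0 :: real, 0 :: real, snd (snd X))"
  have "bounded_linear ?L"
    by (intro bounded_linear_intros bounded_linear_compose[OF bounded_linear_snd bounded_linear_snd])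
  moreover have "?L ` \<Omega> \<subseteq> \<Omega>" using T by auto
  ultimately have "smooth_upto \<Omega> (\<lambda>X. f (?L X))"
    by (rule smooth_upto_comp_linear[OF smooth_D[OF f]])
  then have "smooth_upto \<Omega> (\<lambda>(t, x, s). f (0, 0, s))"
    by (rule smooth_upto_cong) auto
  then show ?thesis by (simp add: smooth_def)
qed

lemma partial_unique:
  assumes f: "smooth f" and X: "(t, x, s) \<in> \<Omega>"
  shows "((\<lambda>t. f (t, x, s)) has_real_derivative d) (at t within {0..T}) \<Longrightarrow> Dt f (t, x, s) = d"
    and "((\<lambda>x. f (t, x, s)) has_real_derivative d) (at x) \<Longrightarrow> Dx f (t, x, s) = d"
    and "((\<lambda>s. f (t, x, s)) has_real_derivative d) (at s within {0..1/2}) \<Longrightarrow> Ds f (t, x, s) = d"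
  using has_real_derivative_unique_Icc[OF has_Dt[OF f X] _ T] DERIV_unique[OF has_Dx[OF f X]]
    has_real_derivative_unique_Icc[OF has_Ds[OF f X]] X by auto

lemma smooth_zero: "smooth (\<lambda>X. 0)"
  by (simp add: smooth_def smooth_upto_const)

lemma partials_zero:
  assumes "X \<in> \<Omega>"
  shows "Dt (\<lambda>X. 0) X = 0" "Dx (\<lambda>X. 0) X = 0" "Ds (\<lambda>X. 0) X = 0"
  using partial_unique[OF smooth_zero, of "fst X" "fst (snd X)" "snd (snd X)" 0] assms by auto

lemma shear_partials:
  assumes f: "smooth f" and X: "(t, x, s) \<in> \<Omega>"
  shows "Dt (\<lambda>(t, x, s). f (0, 0, s)) (t, x, s) = 0" "Dx (\<lambda>(t, x, s). f (0, 0, s)) (t, x, s) = 0"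
    "Ds (\<lambda>(t, x, s). f (0, 0, s)) (t, x, s) = Ds f (0, 0, s)"
  using partial_unique[OF smooth_shear[OF f] X, of 0] partial_unique(3)[OF smooth_shear[OF f] X, of "Ds f (0, 0, s)"]
    has_Ds[OF f, of 0 0 s] X T by auto

lemma Dx_eqI:
  assumes f: "smooth f" and X: "(t, x, s) \<in> \<Omega>" and c: "\<And>y. f (t, y, s) = c"
  shows "Dx f (t, x, s) = 0"
  by (rule partial_unique(2)[OF f X]) (simp add: c)

lemma bounded_on_cell:
  assumes f: "smooth f"
  shows "\<exists>B. \<forall>X\<in>cell. \<bar>f X\<bar> \<le> B"
proof -
  have "continuous_on (cell) f"
    by (rule continuous_on_subset[OF smooth_continuous_on[OF f]]) auto
  then have "bounded (f ` (cell))"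
    by (intro compact_imp_bounded compact_continuous_image compact_Times compact_Icc)
  then show ?thesis unfolding bounded_iff by force
qed

lemma shear_smooth_derivs:
  assumes f: "smooth f" and X: "(t, x, s) \<in> \<Omega>"
  shows "Ds (Ds (\<lambda>(t, x, s). f (0, 0, s))) (t, x, s) = Ds (Ds f) (0, 0, s)"
    and "Ds (Dx (\<lambda>(t, x, s). f (0, 0, s))) (t, x, s) = 0"
    and "Dx (Ds (\<lambda>(t, x, s). f (0, 0, s))) (t, x, s) = 0"
proof -
  let ?f = "\<lambda>(t, x, s). f (0, 0, s)"
  note sf = smooth_shear[OF f]
  note sp = smooth_partials[OF sf]
  have Y: "(0, 0, s) \<in> \<Omega>" using X T by auto
  show "Ds (Ds ?f) (t, x, s) = Ds (Ds f) (0, 0, s)"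
  proof (rule partial_unique(3)[OF sp(3) X])
    show "((\<lambda>s. Ds ?f (t, x, s)) has_real_derivative Ds (Ds f) (0, 0, s)) (at s within {0..1/2})"
      by (rule real_derivative_within_transform[OF has_Ds[OF smooth_partials(3)[OF f] Y]])
         (use X shear_partials(3)[OF f] in auto)
  qed
  show "Ds (Dx ?f) (t, x, s) = 0"
  proof (rule partial_unique(3)[OF sp(2) X])
    show "((\<lambda>s. Dx ?f (t, x, s)) has_real_derivative 0) (at s within {0..1/2})"
      by (rule real_derivative_within_transform[OF DERIV_const])
         (use X shear_partials(2)[OF f] in auto)
  qed
  show "Dx (Ds ?f) (t, x, s) = 0"
    by (rule Dx_eqI[OF sp(3) X]) (use X shear_partials(3)[OF f] in auto)
qed

lemma euler_shear:
  assumes f: "smooth f"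
  shows "euler 0 (\<lambda>(t, x, s). f (0, 0, s)) (\<lambda>X. 0) (\<lambda>X. 0)"
  unfolding euler_def
  by (simp add: smooth_shear[OF f] smooth_zero shear_partials[OF f] partials_zero)

section \<open>Stability constants and changes of reference\<close>

lemma reference_exists:
  assumes E: "euler 0 u k p" and bc: "\<And>t x. t \<in> {0..T} \<Longrightarrow> k (t, x, 1/2) = 0"
    and \<sigma>: "\<sigma> > 0" "\<And>X. X \<in> \<Omega> \<Longrightarrow> Ds (Ds u) X \<ge> \<sigma>"
    and m: "\<And>X. X \<in> cell \<Longrightarrow> \<bar>Dx k X\<bar> \<le> m \<and> \<bar>Dx (Dx k) X\<bar> \<le> m"
  obtains M where "reference T u k p \<sigma> M m"
proof -
  have u: "smooth u" using E by (simp add: euler_def)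
  obtain B1 where B1: "\<And>X. X \<in> cell \<Longrightarrow> \<bar>Ds u X\<bar> \<le> B1"
    using bounded_on_cell[OF smooth_partials(3)[OF u]] by blast
  obtain B2 where B2: "\<And>X. X \<in> cell \<Longrightarrow> \<bar>Ds (Ds u) X\<bar> \<le> B2"
    using bounded_on_cell[OF smooth_partials(3)[OF smooth_partials(3)[OF u]]] by blast
  obtain B3 where B3: "\<And>X. X \<in> cell \<Longrightarrow> \<bar>Dx u X\<bar> \<le> B3"
    using bounded_on_cell[OF smooth_partials(2)[OF u]] by blast
  obtain B4 where B4: "\<And>X. X \<in> cell \<Longrightarrow> \<bar>Ds (Dx u) X\<bar> \<le> B4"
    using bounded_on_cell[OF smooth_partials(3)[OF smooth_partials(2)[OF u]]] by blast
  obtain B5 where B5: "\<And>X. X \<in> cell \<Longrightarrow> \<bar>Dx (Ds u) X\<bar> \<le> B5"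
    using bounded_on_cell[OF smooth_partials(2)[OF smooth_partials(3)[OF u]]] by blast
  define M where "M = max B1 (max B2 (max B3 (max B4 B5)))"
  have M: "B1 \<le> M" "B2 \<le> M" "B3 \<le> M" "B4 \<le> M" "B5 \<le> M" unfolding M_def by simp_all
  have "reference T u k p \<sigma> M m"
  proof (unfold_locales, goal_cases)
    case 1 show ?case by (rule E)
  next
    case 2 then show ?case by (rule bc)
  next
    case 3 show ?case by (rule \<sigma>)
  next
    case 4 then show ?case by (rule \<sigma>)
  next
    case (5 X)
    show ?case
      using B1[OF 5] B2[OF 5] B3[OF 5] B4[OF 5] B5[OF 5] M by (intro conjI) (erule order_trans, assumption)+
  next
    case 6 then show ?case by (rule m)
  qed
  then show ?thesis by (rule that)
qed

text \<open>The constant is obtained before the perturbed flow and \<epsilon> are introduced, hence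
  is uniform in them. The bound m stays explicit so that it can be set to 0. The second estimate is
  the radial part of the elliptic one, with a constant independent of the reference.\<close>

lemma stability:
  assumes E: "euler 0 u k p" and bc: "\<And>t x. t \<in> {0..T} \<Longrightarrow> k (t, x, 1/2) = 0"
    and \<sigma>: "\<sigma> > 0" "\<And>X. X \<in> \<Omega> \<Longrightarrow> Ds (Ds u) X \<ge> \<sigma>"
    and m: "\<And>X. X \<in> cell \<Longrightarrow> \<bar>Dx k X\<bar> \<le> m \<and> \<bar>Dx (Dx k) X\<bar> \<le> m"
  obtains C where "C \<ge> 0" "\<And>\<epsilon> U K P t. euler \<epsilon> U K P \<Longrightarrow> (\<And>t x. t \<in> {0..T} \<Longrightarrow> K (t, x, 1/2) = 0) \<Longrightarrow>
      t \<in> {0..T} \<Longrightarrow> energy \<epsilon> U K u k t \<le> C * (energy \<epsilon> U K u k 0 + \<epsilon> ^ 4 * m\<^sup>2)"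
    "\<And>\<epsilon> U K P t. euler \<epsilon> U K P \<Longrightarrow> (\<And>t x. t \<in> {0..T} \<Longrightarrow> K (t, x, 1/2) = 0) \<Longrightarrow>
      t \<in> {0..T} \<Longrightarrow> integral Q (\<lambda>(x, s). 2 * s * \<epsilon>\<^sup>2 * (K (t, x, s) - k (t, x, s))\<^sup>2)
        \<le> 2 * integral Q (\<lambda>(x, s). (vort \<epsilon> U K (t, x, s) - Ds u (t, x, s))\<^sup>2) + \<epsilon> ^ 4 * m\<^sup>2"
proof -
  obtain M where r: "reference T u k p \<sigma> M m" by (rule reference_exists[OF assms])
  interpret r: reference T u k p \<sigma> M m by (rule r)
  show ?thesis
  proof (rule that[of r.C_core])
    show "r.C_core \<ge> 0" by (rule r.constants_nonneg)
    fix \<epsilon> U K P t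
    assume "euler \<epsilon> U K P" "\<And>t x. t \<in> {0..T} \<Longrightarrow> K (t, x, 1/2) = 0" and t: "t \<in> {0..T}"
    then interpret f: flow T u k p \<sigma> M m \<epsilon> U K P
      by unfold_locales
    show "energy \<epsilon> U K u k t \<le> r.C_core * (energy \<epsilon> U K u k 0 + \<epsilon> ^ 4 * m\<^sup>2)"
      by (rule f.energy_estimate[OF t])
    have "0 \<le> f.centred_sq t"
      by (rule integral_Q_nonneg)
         (use slice_strip[OF f.pert_cont(1) t] slice_strip[OF f.ref_cont(1) t] in
           \<open>auto simp: case_prod_unfold intro!: continuous_intros\<close>)
    then show "integral Q (\<lambda>(x, s). 2 * s * \<epsilon>\<^sup>2 * (K (t, x, s) - k (t, x, s))\<^sup>2) \<le> 2 * integral Q (\<lambda>(x, s). (vort \<epsilon> U K (t, x, s) - Ds u (t, x, s))\<^sup>2) + \<epsilon> ^ 4 * m\<^sup>2"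
      using f.elliptic_estimates(1)[OF t] by linarith
  qed
qed

lemma energy_integrand_continuous:
  assumes sm: "smooth U" "smooth K" "smooth u" "smooth k" and t: "t \<in> {0..T}"
  shows "continuous_on strip (\<lambda>(x, s). (U (t, x, s) - u (t, x, s))\<^sup>2)"
    and "continuous_on strip (\<lambda>(x, s). 2 * s * \<epsilon>\<^sup>2 * (K (t, x, s) - k (t, x, s))\<^sup>2)"
    and "continuous_on strip (\<lambda>(x, s). (vort \<epsilon> U K (t, x, s) - Ds u (t, x, s))\<^sup>2)"
    and "continuous_on strip (\<lambda>(x, s). (U (t, x, s) - u (t, x, s))\<^sup>2
      + 2 * s * \<epsilon>\<^sup>2 * (K (t, x, s) - k (t, x, s))\<^sup>2 + (vort \<epsilon> U K (t, x, s) - Ds u (t, x, s))\<^sup>2)"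
proof -
  note cont = sm[THEN smooth_continuous_on] smooth_partials[OF sm(1), THEN smooth_continuous_on]
    smooth_partials[OF sm(2), THEN smooth_continuous_on] smooth_partials[OF sm(3), THEN smooth_continuous_on]
  note ct = cont[THEN slice_strip, OF t, unfolded case_prod_unfold]
  show "continuous_on strip (\<lambda>(x, s). (U (t, x, s) - u (t, x, s))\<^sup>2)"
    "continuous_on strip (\<lambda>(x, s). 2 * s * \<epsilon>\<^sup>2 * (K (t, x, s) - k (t, x, s))\<^sup>2)"
    "continuous_on strip (\<lambda>(x, s). (vort \<epsilon> U K (t, x, s) - Ds u (t, x, s))\<^sup>2)"
    "continuous_on strip (\<lambda>(x, s). (U (t, x, s) - u (t, x, s))\<^sup>2
      + 2 * s * \<epsilon>\<^sup>2 * (K (t, x, s) - k (t, x, s))\<^sup>2 + (vort \<epsilon> U K (t, x, s) - Ds u (t, x, s))\<^sup>2)"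
    unfolding case_prod_unfold vort_def by (intro continuous_intros ct)+
qed

lemma energy_parts:
  assumes sm: "smooth U" "smooth K" "smooth u" "smooth k" and t: "t \<in> {0..T}"
  shows "integral Q (\<lambda>(x, s). 2 * s * \<epsilon>\<^sup>2 * (K (t, x, s) - k (t, x, s))\<^sup>2) \<le> energy \<epsilon> U K u k t"
    and "integral Q (\<lambda>(x, s). (vort \<epsilon> U K (t, x, s) - Ds u (t, x, s))\<^sup>2) \<le> energy \<epsilon> U K u k t"
  unfolding energy_def
  by (rule integral_Q_le[OF energy_integrand_continuous(2,4)[OF assms]]; simp)
     (rule integral_Q_le[OF energy_integrand_continuous(3,4)[OF assms]]; simp)

lemma square_shift: "(x - y)\<^sup>2 \<le> 2 * (x - z)\<^sup>2 + 2 * b\<^sup>2" if "\<bar>z - y\<bar> \<le> b" for x y z b :: real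
proof -
  have "(z - y)\<^sup>2 \<le> b\<^sup>2" using power_mono[OF that, of 2] by simp
  moreover have "(x - y)\<^sup>2 + (x - 2 * z + y)\<^sup>2 = 2 * (x - z)\<^sup>2 + 2 * (z - y)\<^sup>2"
    by (simp add: power2_eq_square algebra_simps)
  ultimately show ?thesis using zero_le_power2[of "x - 2 * z + y"] by linarith
qed

text \<open>The factor 1 + \<epsilon>^2 reflects the weight of the radial error. The vorticity part
  is stated separately without it: it serves to bound \<epsilon>^2, which would be circular with an
  \<epsilon>^2 on the right.\<close>

lemma energy_shift:
  assumes sm: "smooth U" "smooth K" "smooth u" "smooth k" "smooth u'" "smooth k'" and t: "t \<in> {0..T}"
    and b: "\<And>x s. x \<in> {0..1} \<Longrightarrow> s \<in> {0..1/2} \<Longrightarrow> \<bar>u' (t, x, s) - u (t, x, s)\<bar> \<le> b \<and>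
      \<bar>k' (t, x, s) - k (t, x, s)\<bar> \<le> b \<and> \<bar>Ds u' (t, x, s) - Ds u (t, x, s)\<bar> \<le> b"
  shows "energy \<epsilon> U K u k t \<le> 2 * energy \<epsilon> U K u' k' t + 2 * b\<^sup>2 * (1 + \<epsilon>\<^sup>2)"
    and "integral Q (\<lambda>(x, s). (vort \<epsilon> U K (t, x, s) - Ds u (t, x, s))\<^sup>2)
      \<le> 2 * integral Q (\<lambda>(x, s). (vort \<epsilon> U K (t, x, s) - Ds u' (t, x, s))\<^sup>2) + b\<^sup>2"
proof -
  let ?e = "\<lambda>X. case X of (x, s) \<Rightarrow> (U (t, x, s) - u' (t, x, s))\<^sup>2
      + 2 * s * \<epsilon>\<^sup>2 * (K (t, x, s) - k' (t, x, s))\<^sup>2 + (vort \<epsilon> U K (t, x, s) - Ds u' (t, x, s))\<^sup>2"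
  let ?v = "\<lambda>X. case X of (x, s) \<Rightarrow> (vort \<epsilon> U K (t, x, s) - Ds u' (t, x, s))\<^sup>2"
  note c = energy_integrand_continuous[OF sm(1-4) t] and c' = energy_integrand_continuous[OF sm(1,2,5,6) t]
  have split: "integral Q (\<lambda>X. 2 * f X + d) = 2 * integral Q f + d / 2" if "continuous_on strip f" for f and d :: real
    using integral_add[OF strip_integrable[OF continuous_on_mult_left[OF that]] strip_integrable[OF continuous_on_const], of 2 d]
    by (simp add: content_Pair)
  have "energy \<epsilon> U K u k t \<le> integral Q (\<lambda>X. 2 * ?e X + 4 * b\<^sup>2 * (1 + \<epsilon>\<^sup>2))"
    unfolding energy_def
  proof (rule integral_Q_le[OF c(4)])
    fix x s :: real assume xs: "x \<in> {0..1}" "s \<in> {0..1/2}"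
    note bb = b[OF xs]
    have 1: "(U (t, x, s) - u (t, x, s))\<^sup>2 \<le> 2 * (U (t, x, s) - u' (t, x, s))\<^sup>2 + 2 * b\<^sup>2"
      and 2: "(K (t, x, s) - k (t, x, s))\<^sup>2 \<le> 2 * (K (t, x, s) - k' (t, x, s))\<^sup>2 + 2 * b\<^sup>2"
      and 3: "(vort \<epsilon> U K (t, x, s) - Ds u (t, x, s))\<^sup>2 \<le> 2 * (vort \<epsilon> U K (t, x, s) - Ds u' (t, x, s))\<^sup>2 + 2 * b\<^sup>2"
      using bb by (auto intro: square_shift)
    have "2 * s * \<epsilon>\<^sup>2 * (K (t, x, s) - k (t, x, s))\<^sup>2 \<le> 2 * s * \<epsilon>\<^sup>2 * (2 * (K (t, x, s) - k' (t, x, s))\<^sup>2 + 2 * b\<^sup>2)"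
      using 2 xs by (intro mult_left_mono) auto
    also have "\<dots> = 2 * (2 * s * \<epsilon>\<^sup>2 * (K (t, x, s) - k' (t, x, s))\<^sup>2) + 2 * s * (2 * (\<epsilon>\<^sup>2 * b\<^sup>2))"
      by (simp add: algebra_simps)
    also have "2 * s * (2 * (\<epsilon>\<^sup>2 * b\<^sup>2)) \<le> 1 * (2 * (\<epsilon>\<^sup>2 * b\<^sup>2))"
      using xs by (intro mult_right_mono) auto
    finally have 4: "2 * s * \<epsilon>\<^sup>2 * (K (t, x, s) - k (t, x, s))\<^sup>2
      \<le> 2 * (2 * s * \<epsilon>\<^sup>2 * (K (t, x, s) - k' (t, x, s))\<^sup>2) + 2 * (\<epsilon>\<^sup>2 * b\<^sup>2)" by simp
    have 5: "0 \<le> \<epsilon>\<^sup>2 * b\<^sup>2" by simp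
    show "(case (x, s) of (x, s) \<Rightarrow> (U (t, x, s) - u (t, x, s))\<^sup>2
      + 2 * s * \<epsilon>\<^sup>2 * (K (t, x, s) - k (t, x, s))\<^sup>2 + (vort \<epsilon> U K (t, x, s) - Ds u (t, x, s))\<^sup>2)
      \<le> 2 * ?e (x, s) + 4 * b\<^sup>2 * (1 + \<epsilon>\<^sup>2)"
    proof -
      have "4 * b\<^sup>2 * (1 + \<epsilon>\<^sup>2) = 4 * b\<^sup>2 + 4 * (\<epsilon>\<^sup>2 * b\<^sup>2)" by (simp add: algebra_simps)
      then show ?thesis using 1 3 4 5 unfolding prod.case distrib_left by linarith
    qed
  qed (intro continuous_intros c'(4))
  then show "energy \<epsilon> U K u k t \<le> 2 * energy \<epsilon> U K u' k' t + 2 * b\<^sup>2 * (1 + \<epsilon>\<^sup>2)"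
    unfolding split[OF c'(4)] energy_def by simp
  have "integral Q (\<lambda>(x, s). (vort \<epsilon> U K (t, x, s) - Ds u (t, x, s))\<^sup>2) \<le> integral Q (\<lambda>X. 2 * ?v X + 2 * b\<^sup>2)"
  proof (rule integral_Q_le[OF c(3)])
    fix x s :: real assume "x \<in> {0..1}" "s \<in> {0..1/2}"
    from b[OF this] show "(case (x, s) of (x, s) \<Rightarrow> (vort \<epsilon> U K (t, x, s) - Ds u (t, x, s))\<^sup>2) \<le> 2 * ?v (x, s) + 2 * b\<^sup>2"
      by (simp add: square_shift)
  qed (intro continuous_intros c'(3))
  then show "integral Q (\<lambda>(x, s). (vort \<epsilon> U K (t, x, s) - Ds u (t, x, s))\<^sup>2)
      \<le> 2 * integral Q (\<lambda>(x, s). (vort \<epsilon> U K (t, x, s) - Ds u' (t, x, s))\<^sup>2) + b\<^sup>2"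
    unfolding split[OF c'(3)] by simp
qed

lemma integral_Q_eq_0D:
  fixes f :: "real \<times> real \<Rightarrow> real"
  assumes c: "continuous_on strip f" and nn: "\<And>x s. x \<in> {0..1} \<Longrightarrow> s \<in> {0..1/2} \<Longrightarrow> 0 \<le> f (x, s)"
    and 0: "integral Q f \<le> 0" and X: "x \<in> {0..1}" "s \<in> {0..1/2}"
  shows "f (x, s) = 0"
proof -
  have "box (0, 0) (1, 1/2 :: real) \<noteq> ({} :: (real \<times> real) set)"
    by (simp add: box_ne_empty Basis_prod_def)
  moreover have "integral Q f = 0" using integral_Q_nonneg[OF c nn] 0 by simp
  ultimately show ?thesis
    using integral_cbox_eq_0_iff[OF strip_continuous_Q[OF c]] nn X by (auto simp: cbox_Pair_eq)
qed

text \<open>The s-derivative of 2 s k is -\<open>Dx U\<close>, so 2 s k is constant in s and equals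
  its value 0 on the axis.\<close>

lemma div_zero:
  assumes E: "euler \<epsilon> U k P" and t: "t \<in> {0..T}" and x: "\<And>s. s \<in> {0..1/2} \<Longrightarrow> Dx U (t, x, s) = 0"
    and s: "s \<in> {0..1/2}"
  shows "s * k (t, x, s) = 0"
proof -
  have "((\<lambda>s. 2 * s * k (t, x, s)) has_real_derivative 0) (at z within {0..1/2})" if "z \<in> {0..1/2}" for z
  proof -
    have X: "(t, x, z) \<in> \<Omega>" using t that by auto
    have "((\<lambda>s. 2 * s * k (t, x, s)) has_real_derivative 2 * k (t, x, z) + Ds k (t, x, z) * (2 * z)) (at z within {0..1/2})"
      by (rule derivative_eq_intros has_Ds[OF euler_eqs(2)[OF E] X] refl)+ simp
    moreover have "2 * k (t, x, z) + Ds k (t, x, z) * (2 * z) = 0"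
      using euler_eqs(6)[OF E X] x[OF that] by (simp add: algebra_simps)
    ultimately show ?thesis by simp
  qed
  then have "\<bar>2 * s * k (t, x, s) - 2 * 0 * k (t, x, 0)\<bar> \<le> 0 * \<bar>s - 0\<bar>"
    by (rule increment_abs) (use s in auto)
  then show ?thesis by simp
qed

text \<open>The stability estimate with \<open>\<epsilon> = 0\<close> is applied to the hydrostatic solution itself, the reference
  being the steady shear \<open>u (0, 0, \<cdot>)\<close>.\<close>
lemma shear_rigidity:
  assumes E: "euler 0 u k p" and bc: "\<And>t x. t \<in> {0..T} \<Longrightarrow> k (t, x, 1/2) = 0"
    and C: "\<And>t. t \<in> {0..T} \<Longrightarrow> energy 0 u k (\<lambda>(t, x, s). u (0, 0, s)) (\<lambda>X. 0) t
      \<le> C * energy 0 u k (\<lambda>(t, x, s). u (0, 0, s)) (\<lambda>X. 0) 0"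
    and k0: "\<And>x s. x \<in> {0..1} \<Longrightarrow> s \<in> {0..1/2} \<Longrightarrow> s * k (0, x, s) = 0"
    and X: "X \<in> cell"
  shows "Dx k X = 0" "Dx (Dx k) X = 0"
proof -
  note e = euler_eqs[OF E]
  let ?u = "\<lambda>(t, x, s). u (0, 0, s)"
  \<comment> \<open>The s-derivative of s k is -\<open>Dx u\<close> / 2, so the initial data do not
    depend on x; they agree with the shear and the initial energy vanishes.\<close>
  have Dx0: "Dx u (0, x, s) = 0" if xs: "x \<in> {0..1}" "s \<in> {0..1/2}" for x s
  proof -
    have X: "(0, x, s) \<in> \<Omega>" using xs T by auto
    have "((\<lambda>s. s * k (0, x, s)) has_real_derivative k (0, x, s) + Ds k (0, x, s) * s) (at s within {0..1/2})"
      by (rule derivative_eq_intros has_Ds[OF e(2) X] refl)+ simp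
    moreover have "((\<lambda>s. s * k (0, x, s)) has_real_derivative 0) (at s within {0..1/2})"
      by (rule real_derivative_within_transform[OF DERIV_const[of 0]]) (use xs k0 in auto)
    ultimately have "k (0, x, s) + Ds k (0, x, s) * s = 0"
      by (rule has_real_derivative_unique_Icc) (use xs in auto)
    then show ?thesis using e(6)[OF X] by (simp add: algebra_simps)
  qed
  have u0: "u (0, x, s) = u (0, 0, s)" if xs: "x \<in> {0..1}" "s \<in> {0..1/2}" for x s
  proof -
    have "\<bar>u (0, x, s) - u (0, 0, s)\<bar> \<le> 0 * \<bar>x - 0\<bar>"
      by (rule increment_abs[of 0 1, OF has_field_derivative_at_within[OF has_Dx[OF e(1)]]])
         (use xs T Dx0 in auto)
    then show ?thesis by simp
  qed
  have Ds0: "Ds u (0, x, s) = Ds u (0, 0, s)" if xs: "x \<in> {0..1}" "s \<in> {0..1/2}" for x s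
  proof (rule partial_unique(3)[OF e(1)])
    show "((\<lambda>s. u (0, x, s)) has_real_derivative Ds u (0, 0, s)) (at s within {0..1/2})"
    proof (rule real_derivative_within_transform[OF has_Ds[OF e(1)]])
      show "u (0, x, z) = u (0, 0, z)" if "z \<in> {0..1/2}" for z by (rule u0[OF xs(1) that])
    qed (use xs T in auto)
  qed (use xs T in auto)
  have "energy 0 u k ?u (\<lambda>X. 0) 0 = integral Q (\<lambda>X. 0)"
    unfolding energy_def
  proof (rule integral_cong)
    fix Y :: "real \<times> real" assume "Y \<in> Q"
    then obtain x s where Y: "Y = (x, s)" "x \<in> {0..1}" "s \<in> {0..1/2}" by (cases Y) (auto simp: cbox_Pair_eq)
    then have "(0, x, s) \<in> \<Omega>" using T by auto
    from shear_partials(3)[OF e(1) this] Ds0[OF Y(2,3)] u0[OF Y(2,3)]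
    show "(case Y of (x, s) \<Rightarrow> (u (0, x, s) - ?u (0, x, s))\<^sup>2 + 2 * s * 0\<^sup>2 * (k (0, x, s) - 0)\<^sup>2
      + (vort 0 u k (0, x, s) - Ds ?u (0, x, s))\<^sup>2) = 0"
      by (simp add: Y(1) vort_def)
  qed
  then have Et: "energy 0 u k ?u (\<lambda>X. 0) t \<le> 0" if "t \<in> {0..T}" for t
    using C[OF that] by simp
  have ut: "u (t, x, s) = u (0, 0, s)" if t: "t \<in> {0..T}" and xs: "x \<in> {0..1}" "s \<in> {0..1/2}" for t x s
  proof -
    have "(case (x, s) of (x, s) \<Rightarrow> (u (t, x, s) - ?u (t, x, s))\<^sup>2 + 2 * s * 0\<^sup>2 * (k (t, x, s) - 0)\<^sup>2
      + (vort 0 u k (t, x, s) - Ds ?u (t, x, s))\<^sup>2) = 0"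
      by (rule integral_Q_eq_0D[OF energy_integrand_continuous(4)[OF e(1,2) smooth_shear[OF e(1)] smooth_zero t]])
         (use Et[OF t] xs in \<open>auto simp: energy_def\<close>)
    then show ?thesis by (simp add: sum_power2_eq_zero_iff)
  qed
  \<comment> \<open>At \<epsilon> = 0 the energy has no radial term, so k is recovered from
    incompressibility: u no longer depends on x, whence s k = 0.\<close>
  have k: "k (t, x, s) = 0" if t: "t \<in> {0..T}" and xs: "x \<in> {0<..<1}" "s \<in> {0<..1/2}" for t x s
  proof -
    have "Dx u (t, x, s) = 0" if s: "s \<in> {0..1/2}" for s
    proof (rule partial_unique(2)[OF e(1)])
      show "((\<lambda>x. u (t, x, s)) has_real_derivative 0) (at x)"
        by (rule has_field_derivative_transform_within_open[OF DERIV_const[of "u (0, 0, s)"], of "{0<..<1}"])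
           (use xs(1) in \<open>auto intro!: ut[OF t _ s, symmetric]\<close>)
    qed (use t s in auto)
    from div_zero[OF E t this, of s] xs show ?thesis by auto
  qed
  \<comment> \<open>For s > 0 and x strictly inside the period, k vanishes on a neighbourhood in x.
    Its x-derivatives vanish there and, by continuity, on the closed cell.\<close>
  let ?A = "{0..T} \<times> {0<..<1 :: real} \<times> {0<..1/2 :: real}"
  have cl: "closure ?A = cell"
    by (simp add: closure_Times)
  have Dk: "Dx k Y = 0" if "Y \<in> ?A" for Y
  proof -
    obtain t x s where Y: "Y = (t, x, s)" by (cases Y)
    show ?thesis unfolding Y
    proof (rule partial_unique(2)[OF e(2)])
      show "((\<lambda>x. k (t, x, s)) has_real_derivative 0) (at x)"
        by (rule has_field_derivative_transform_within_open[OF DERIV_const[of 0], of "{0<..<1}"])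
           (use that k in \<open>auto simp: Y\<close>)
    qed (use that in \<open>auto simp: Y\<close>)
  qed
  have DDk: "Dx (Dx k) Y = 0" if "Y \<in> ?A" for Y
  proof -
    obtain t x s where Y: "Y = (t, x, s)" by (cases Y)
    show ?thesis unfolding Y
    proof (rule partial_unique(2)[OF smooth_partials(2)[OF e(2)]])
      show "((\<lambda>x. Dx k (t, x, s)) has_real_derivative 0) (at x)"
        by (rule has_field_derivative_transform_within_open[OF DERIV_const[of 0], of "{0<..<1}"])
           (use that Dk in \<open>auto simp: Y\<close>)
    qed (use that in \<open>auto simp: Y\<close>)
  qed
  have sub: "closure ?A \<subseteq> \<Omega>" unfolding cl by auto
  show "Dx k X = 0"
    by (rule continuous_constant_on_closure[OF continuous_on_subset[OF smooth_continuous_on[OF smooth_partials(2)[OF e(2)]] sub] Dk])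
       (use X cl in auto)
  show "Dx (Dx k) X = 0"
    by (rule continuous_constant_on_closure[OF continuous_on_subset[OF smooth_continuous_on[OF
          smooth_partials(2)[OF smooth_partials(2)[OF e(2)]]] sub] DDk])
       (use X cl in auto)
qed

text \<open>For \<open>\<epsilon> > 1\<close> the forcing \<open>\<epsilon>\<^sup>4 m\<^sup>2\<close> is not dominated by \<open>\<epsilon>\<^sup>\<beta>\<close>. Either \<open>k\<close> vanishes initially, hence
  always, and there is no forcing; or the elliptic estimate turns the initial bound into
  \<open>\<epsilon>\<^sup>2 \<le> D \<epsilon>\<^sup>\<beta>\<close>, and the comparison with the steady shear, which is not forced, suffices.\<close>
lemma energy_bound_uniform:
  assumes E: "euler 0 u k p" and bc: "\<And>t x. t \<in> {0..T} \<Longrightarrow> k (t, x, 1/2) = 0"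
    and \<sigma>: "\<sigma> > 0" "\<And>X. X \<in> \<Omega> \<Longrightarrow> Ds (Ds u) X \<ge> \<sigma>" and "C0 > 0"
  shows "\<exists>C. \<forall>\<epsilon>>0. \<forall>\<beta>\<in>{0<..4}. \<forall>U K P. euler \<epsilon> U K P \<longrightarrow> (\<forall>t\<in>{0..T}. \<forall>x. K (t, x, 1/2) = 0) \<longrightarrow>
    energy \<epsilon> U K u k 0 \<le> C0 * \<epsilon> powr \<beta> \<longrightarrow> (\<forall>t\<in>{0..T}. energy \<epsilon> U K u k t \<le> C * \<epsilon> powr \<beta>)"
proof -
  note e = euler_eqs[OF E]
  have z: "0 \<in> {0..T}" using T by auto
  let ?u = "\<lambda>(t, x, s). u (0, 0, s)" and ?k = "\<lambda>X :: point. 0 :: real"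
  have shear_convex: "Ds (Ds ?u) X \<ge> \<sigma>" if "X \<in> \<Omega>" for X
    using shear_smooth_derivs(1)[OF e(1), of "fst X" "fst (snd X)" "snd (snd X)"] \<sigma>(2)[of "(0, 0, snd (snd X))"] that T
    by auto
  have shear_m: "\<bar>Dx ?k X\<bar> \<le> 0 \<and> \<bar>Dx (Dx ?k) X\<bar> \<le> 0" if "X \<in> cell" for X
  proof -
    obtain t x s where X: "X = (t, x, s)" by (cases X)
    have "(t, y, s) \<in> \<Omega>" for y using that X by auto
    then show ?thesis
      using partials_zero(2) Dx_eqI[OF smooth_partials(2)[OF smooth_zero], of t x s 0] by (simp add: X)
  qed
  obtain C2 where C2: "C2 \<ge> 0"
    and s2: "\<And>\<epsilon> U K P t. euler \<epsilon> U K P \<Longrightarrow> (\<And>t x. t \<in> {0..T} \<Longrightarrow> K (t, x, 1/2) = 0) \<Longrightarrow>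
      t \<in> {0..T} \<Longrightarrow> energy \<epsilon> U K ?u ?k t \<le> C2 * (energy \<epsilon> U K ?u ?k 0 + \<epsilon> ^ 4 * 0\<^sup>2)"
    and r2: "\<And>\<epsilon> U K P t. euler \<epsilon> U K P \<Longrightarrow> (\<And>t x. t \<in> {0..T} \<Longrightarrow> K (t, x, 1/2) = 0) \<Longrightarrow>
      t \<in> {0..T} \<Longrightarrow> integral Q (\<lambda>(x, s). 2 * s * \<epsilon>\<^sup>2 * (K (t, x, s) - ?k (t, x, s))\<^sup>2)
        \<le> 2 * integral Q (\<lambda>(x, s). (vort \<epsilon> U K (t, x, s) - Ds ?u (t, x, s))\<^sup>2) + \<epsilon> ^ 4 * 0\<^sup>2"
    by (rule stability[OF euler_shear[OF e(1)] refl \<sigma>(1) shear_convex shear_m]) blast+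
  show ?thesis
  proof (cases "\<forall>x\<in>{0..1}. \<forall>s\<in>{0..1/2}. s * k (0, x, s) = 0")
    case True
    have m0: "\<bar>Dx k X\<bar> \<le> 0 \<and> \<bar>Dx (Dx k) X\<bar> \<le> 0" if "X \<in> cell" for X
    proof -
      have "energy 0 u k ?u ?k t \<le> C2 * energy 0 u k ?u ?k 0" if "t \<in> {0..T}" for t
        using s2[OF E bc that] by simp
      from shear_rigidity[OF E bc this _ that] True show ?thesis by simp
    qed
    obtain C1 where C1: "C1 \<ge> 0"
      and s1: "\<And>\<epsilon> U K P t. euler \<epsilon> U K P \<Longrightarrow> (\<And>t x. t \<in> {0..T} \<Longrightarrow> K (t, x, 1/2) = 0) \<Longrightarrow>
        t \<in> {0..T} \<Longrightarrow> energy \<epsilon> U K u k t \<le> C1 * (energy \<epsilon> U K u k 0 + \<epsilon> ^ 4 * 0\<^sup>2)"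
      by (rule stability[OF E bc \<sigma> m0]) blast+
    show ?thesis
    proof (intro exI[of _ "C1 * C0"] allI impI ballI)
      fix \<epsilon> \<beta> :: real and U K P t
      assume EU: "euler \<epsilon> U K P" and bK: "\<forall>t\<in>{0..T}. \<forall>x. K (t, x, 1/2) = 0" and t: "t \<in> {0..T}"
        and init: "energy \<epsilon> U K u k 0 \<le> C0 * \<epsilon> powr \<beta>"
      have "energy \<epsilon> U K u k t \<le> C1 * (energy \<epsilon> U K u k 0 + \<epsilon> ^ 4 * 0\<^sup>2)"
        by (rule s1[OF EU _ t]) (use bK in blast)
      also have "\<dots> \<le> C1 * (C0 * \<epsilon> powr \<beta>)" using init C1 by (intro mult_left_mono) auto
      finally show "energy \<epsilon> U K u k t \<le> C1 * C0 * \<epsilon> powr \<beta>" by (simp add: mult.assoc)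
    qed
  next
    case False
    obtain B1 B2 where B: "\<And>X. X \<in> cell \<Longrightarrow> \<bar>Dx k X\<bar> \<le> B1"
        "\<And>X. X \<in> cell \<Longrightarrow> \<bar>Dx (Dx k) X\<bar> \<le> B2"
      using bounded_on_cell[OF smooth_partials(2)[OF e(2)]]
        bounded_on_cell[OF smooth_partials(2)[OF smooth_partials(2)[OF e(2)]]] by blast
    define m where "m = max B1 B2"
    have m: "\<bar>Dx k X\<bar> \<le> m \<and> \<bar>Dx (Dx k) X\<bar> \<le> m" if "X \<in> cell" for X
      using B[OF that] by (simp add: m_def le_max_iff_disj)
    obtain C1 where C1: "C1 \<ge> 0"
      and s1: "\<And>\<epsilon> U K P t. euler \<epsilon> U K P \<Longrightarrow> (\<And>t x. t \<in> {0..T} \<Longrightarrow> K (t, x, 1/2) = 0) \<Longrightarrow>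
        t \<in> {0..T} \<Longrightarrow> energy \<epsilon> U K u k t \<le> C1 * (energy \<epsilon> U K u k 0 + \<epsilon> ^ 4 * m\<^sup>2)"
      by (rule stability[OF E bc \<sigma> m]) blast+
    obtain b1 b2 b3 where bb: "\<And>X. X \<in> cell \<Longrightarrow> \<bar>u X\<bar> \<le> b1"
        "\<And>X. X \<in> cell \<Longrightarrow> \<bar>k X\<bar> \<le> b2"
        "\<And>X. X \<in> cell \<Longrightarrow> \<bar>Ds u X\<bar> \<le> b3"
      using bounded_on_cell[OF e(1)] bounded_on_cell[OF e(2)] bounded_on_cell[OF smooth_partials(3)[OF e(1)]] by blast
    define b where "b = 2 * max b1 (max b2 b3)"
    have b: "\<bar>u (t, x, s) - ?u (t, x, s)\<bar> \<le> b \<and> \<bar>k (t, x, s) - ?k (t, x, s)\<bar> \<le> b \<and> \<bar>Ds u (t, x, s) - Ds ?u (t, x, s)\<bar> \<le> b"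
      if t: "t \<in> {0..T}" and xs: "x \<in> {0..1}" "s \<in> {0..1/2}" for t x s
    proof -
      have X: "(t, x, s) \<in> cell" "(0, 0, s) \<in> {0..T} \<times> {0..1 :: real} \<times> {0..1/2 :: real}"
        using t xs T by auto
      have "(t, x, s) \<in> \<Omega>" using t xs by auto
      note d = shear_partials(3)[OF e(1) this]
      have "b1 \<le> b / 2" "b2 \<le> b / 2" "b3 \<le> b / 2" unfolding b_def by simp_all
      then show ?thesis
        using bb(1)[OF X(1)] bb(1)[OF X(2)] bb(2)[OF X(1)] bb(3)[OF X(1)] bb(3)[OF X(2)] unfolding d prod.case by linarith
    qed
    have b': "\<bar>?u (t, x, s) - u (t, x, s)\<bar> \<le> b \<and> \<bar>?k (t, x, s) - k (t, x, s)\<bar> \<le> b \<and> \<bar>Ds ?u (t, x, s) - Ds u (t, x, s)\<bar> \<le> b"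
      if "t \<in> {0..T}" "x \<in> {0..1}" "s \<in> {0..1/2}" for t x s
      using b[OF that] by (simp only: abs_minus_commute)
    \<comment> \<open>The radial content of the hydrostatic data, positive in this case. A perturbed
      flow close to these data has to carry it at the price \<epsilon>^2 \<kappa>, which limits
      \<epsilon>^2.\<close>
    define \<kappa> where "\<kappa> = integral Q (\<lambda>(x, s). 2 * s * (k (0, x, s))\<^sup>2)"
    have kc: "continuous_on strip (\<lambda>(x, s). 2 * s * (k (0, x, s))\<^sup>2)"
      using slice_strip[OF smooth_continuous_on[OF e(2)] z] unfolding case_prod_unfold by (intro continuous_intros)
    have \<kappa>: "\<kappa> > 0"
    proof (rule ccontr)
      assume "\<not> \<kappa> > 0"
      then have 0: "integral Q (\<lambda>(x, s). 2 * s * (k (0, x, s))\<^sup>2) \<le> 0" by (simp add: \<kappa>_def)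
      have "s * k (0, x, s) = 0" if "x \<in> {0..1}" "s \<in> {0..1/2}" for x s
        using integral_Q_eq_0D[OF kc _ 0 that] by auto
      then show False using False by blast
    qed
    \<comment> \<open>For \<epsilon> > 1 and q = \<epsilon>^\<beta>, splitting k as (k - K) + K
      gives \<epsilon>^2 \<kappa> \<le> 2 R + 2 R', with R \<le> C0 q by the hypothesis and R' \<le>
      4 C0 q + 2 b^2 by the elliptic estimate about the shear.\<close>
    define D where "D = (10 * C0 + 4 * b\<^sup>2) / \<kappa>"
    \<comment> \<open>The first summand serves \<epsilon> \<le> 1, the second \<epsilon> > 1:
      passing to the shear and back costs a factor 2 and 2 b^2 (1 + \<epsilon>^2) each time, and 1 +
      \<epsilon>^2 \<le> (1 + D) q.\<close>
    define C where "C = C1 * (C0 + m\<^sup>2) + (4 * C2 * C0 + (4 * C2 + 2) * b\<^sup>2 * (1 + D))"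
    have D: "D \<ge> 0" using \<kappa> \<open>C0 > 0\<close> by (simp add: D_def)
    have parts: "0 \<le> C1 * (C0 + m\<^sup>2)" "0 \<le> 4 * C2 * C0 + (4 * C2 + 2) * b\<^sup>2 * (1 + D)"
      using C1 C2 D \<open>C0 > 0\<close> by simp_all
    show ?thesis
    proof (intro exI[of _ C] allI impI ballI)
      fix \<epsilon> \<beta> :: real and U K P t
      assume \<epsilon>: "\<epsilon> > 0" and \<beta>: "\<beta> \<in> {0<..4}" and EU: "euler \<epsilon> U K P"
        and bK': "\<forall>t\<in>{0..T}. \<forall>x. K (t, x, 1/2) = 0"
        and init: "energy \<epsilon> U K u k 0 \<le> C0 * \<epsilon> powr \<beta>" and t: "t \<in> {0..T}"
      have bK: "\<And>t x. t \<in> {0..T} \<Longrightarrow> K (t, x, 1/2) = 0" using bK' by blast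
      note eU = euler_eqs[OF EU]
      show "energy \<epsilon> U K u k t \<le> C * \<epsilon> powr \<beta>"
      proof (cases "\<epsilon> \<le> 1")
        case True
        \<comment> \<open>Here \<beta> \<le> 4 enters: the forcing is dominated by
          \<epsilon>^\<beta>.\<close>
        have "\<epsilon> ^ 4 = \<epsilon> powr 4" using \<epsilon> by (simp add: powr_numeral)
        also have "\<dots> \<le> \<epsilon> powr \<beta>" using \<epsilon> \<beta> True by (intro powr_mono') auto
        finally have "\<epsilon> ^ 4 * m\<^sup>2 \<le> \<epsilon> powr \<beta> * m\<^sup>2" by (rule mult_right_mono) simp
        then have "energy \<epsilon> U K u k 0 + \<epsilon> ^ 4 * m\<^sup>2 \<le> (C0 + m\<^sup>2) * \<epsilon> powr \<beta>"
          using init by (simp add: algebra_simps)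
        then have "energy \<epsilon> U K u k t \<le> C1 * ((C0 + m\<^sup>2) * \<epsilon> powr \<beta>)"
          using order_trans[OF s1[OF EU bK t] mult_left_mono[OF _ C1]] by blast
        also have "\<dots> \<le> C * \<epsilon> powr \<beta>"
          unfolding C_def distrib_right mult.assoc[symmetric] using mult_nonneg_nonneg[OF parts(2), of "\<epsilon> powr \<beta>"] by (simp add: algebra_simps)
        finally show ?thesis .
      next
        case False
        define q where "q = \<epsilon> powr \<beta>"
        \<comment> \<open>Additive constants can be absorbed into multiples of q.\<close>
        have q1: "q \<ge> 1" unfolding q_def using False \<beta> by (intro ge_one_powr_ge_zero) auto
        note sh = smooth_shear[OF e(1)]
        define V where "V = integral Q (\<lambda>(x, s). (vort \<epsilon> U K (0, x, s) - Ds ?u (0, x, s))\<^sup>2)"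
        define R where "R = integral Q (\<lambda>(x, s). 2 * s * \<epsilon>\<^sup>2 * (K (0, x, s) - k (0, x, s))\<^sup>2)"
        define R' where "R' = integral Q (\<lambda>(x, s). 2 * s * \<epsilon>\<^sup>2 * (K (0, x, s) - ?k (0, x, s))\<^sup>2)"
        have V: "V \<le> 2 * (C0 * q) + b\<^sup>2"
        proof -
          have "V \<le> 2 * integral Q (\<lambda>(x, s). (vort \<epsilon> U K (0, x, s) - Ds u (0, x, s))\<^sup>2) + b\<^sup>2"
            unfolding V_def by (rule energy_shift(2)[OF eU(1,2) sh smooth_zero e(1,2) z b[OF z]])
          then show ?thesis
            using energy_parts(2)[OF eU(1,2) e(1,2) z, of \<epsilon>] init unfolding q_def by linarith
        qed
        have R: "R \<le> C0 * q"
          using energy_parts(1)[OF eU(1,2) e(1,2) z, of \<epsilon>] init unfolding R_def q_def by linarith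
        have R': "R' \<le> 2 * V" using r2[OF EU bK z] unfolding R'_def V_def by simp
        have "\<epsilon>\<^sup>2 * \<kappa> \<le> 2 * R + 2 * R'"
        proof -
          note c = energy_integrand_continuous(2)[OF eU(1,2) e(1,2) z, of \<epsilon>]
          note c' = energy_integrand_continuous(2)[OF eU(1,2) sh smooth_zero z, of \<epsilon>]
          have "\<epsilon>\<^sup>2 * \<kappa> = integral Q (\<lambda>X. \<epsilon>\<^sup>2 * (case X of (x, s) \<Rightarrow> 2 * s * (k (0, x, s))\<^sup>2))"
            unfolding \<kappa>_def by (simp only: integral_mult_right)
          also have "\<dots> \<le> integral Q (\<lambda>X. 2 * (case X of (x, s) \<Rightarrow> 2 * s * \<epsilon>\<^sup>2 * (K (0, x, s) - k (0, x, s))\<^sup>2)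
             + 2 * (case X of (x, s) \<Rightarrow> 2 * s * \<epsilon>\<^sup>2 * (K (0, x, s) - ?k (0, x, s))\<^sup>2))"
          proof (rule integral_Q_le)
            fix x s :: real assume "s \<in> {0..1/2}"
            have "(k (0, x, s))\<^sup>2 \<le> 2 * (K (0, x, s) - k (0, x, s))\<^sup>2 + 2 * (K (0, x, s))\<^sup>2"
              using zero_le_power2[of "2 * K (0, x, s) - k (0, x, s)"] by (simp add: power2_eq_square algebra_simps)
            then have "2 * s * \<epsilon>\<^sup>2 * (k (0, x, s))\<^sup>2 \<le> 2 * s * \<epsilon>\<^sup>2 * (2 * (K (0, x, s) - k (0, x, s))\<^sup>2 + 2 * (K (0, x, s))\<^sup>2)"
              using \<open>s \<in> _\<close> by (intro mult_left_mono) auto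
            then show "\<epsilon>\<^sup>2 * (case (x, s) of (x, s) \<Rightarrow> 2 * s * (k (0, x, s))\<^sup>2)
              \<le> 2 * (case (x, s) of (x, s) \<Rightarrow> 2 * s * \<epsilon>\<^sup>2 * (K (0, x, s) - k (0, x, s))\<^sup>2)
               + 2 * (case (x, s) of (x, s) \<Rightarrow> 2 * s * \<epsilon>\<^sup>2 * (K (0, x, s) - ?k (0, x, s))\<^sup>2)"
              by (simp add: algebra_simps)
          qed (intro continuous_intros kc c c')+
          also have "\<dots> = 2 * R + 2 * R'"
            unfolding R_def R'_def integral_mult_right[symmetric]
            by (intro integral_add strip_integrable continuous_intros c c')
          finally show ?thesis .
        qed
        also have "\<dots> \<le> 10 * (C0 * q) + 4 * b\<^sup>2" using R R' V by linarith
        also have "\<dots> \<le> (10 * C0 + 4 * b\<^sup>2) * q"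
          using mult_left_mono[OF q1, of "4 * b\<^sup>2"] by (simp add: algebra_simps)
        finally have "\<epsilon>\<^sup>2 \<le> D * q" using \<kappa> by (simp add: D_def field_simps)
        then have 1: "1 + \<epsilon>\<^sup>2 \<le> (1 + D) * q" using q1 by (simp add: algebra_simps)
        have "energy \<epsilon> U K u k t \<le> 2 * energy \<epsilon> U K ?u ?k t + 2 * b\<^sup>2 * (1 + \<epsilon>\<^sup>2)"
          by (rule energy_shift(1)[OF eU(1,2) e(1,2) sh smooth_zero t b'[OF t]])
        also have "\<dots> \<le> 2 * (C2 * energy \<epsilon> U K ?u ?k 0) + 2 * b\<^sup>2 * (1 + \<epsilon>\<^sup>2)"
          using s2[OF EU bK t] by simp
        also have "\<dots> \<le> 2 * (C2 * (2 * (C0 * q) + 2 * b\<^sup>2 * (1 + \<epsilon>\<^sup>2))) + 2 * b\<^sup>2 * (1 + \<epsilon>\<^sup>2)"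
        proof -
          have "energy \<epsilon> U K ?u ?k 0 \<le> 2 * energy \<epsilon> U K u k 0 + 2 * b\<^sup>2 * (1 + \<epsilon>\<^sup>2)"
            by (rule energy_shift(1)[OF eU(1,2) sh smooth_zero e(1,2) z b[OF z]])
          then have "energy \<epsilon> U K ?u ?k 0 \<le> 2 * (C0 * q) + 2 * b\<^sup>2 * (1 + \<epsilon>\<^sup>2)"
            using init unfolding q_def by linarith
          from mult_left_mono[OF this C2] show ?thesis by simp
        qed
        also have "\<dots> = 4 * C2 * C0 * q + (4 * C2 + 2) * b\<^sup>2 * (1 + \<epsilon>\<^sup>2)" by (simp add: algebra_simps)
        also have "\<dots> \<le> 4 * C2 * C0 * q + (4 * C2 + 2) * b\<^sup>2 * ((1 + D) * q)"
          using mult_left_mono[OF 1, of "(4 * C2 + 2) * b\<^sup>2"] C2 by simp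
        also have "\<dots> = (4 * C2 * C0 + (4 * C2 + 2) * b\<^sup>2 * (1 + D)) * q" by (simp add: algebra_simps)
        also have "\<dots> \<le> C * q"
          using parts(1) q1 by (intro mult_right_mono) (auto simp: C_def)
        finally show ?thesis by (simp only: q_def)
      qed
    qed
  qed
qed

end

section \<open>Return to the original fields\<close>

theorem theorem2p4:
  fixes T \<sigma> C0 :: real
    and ux ur :: "real \<Rightarrow> real \<Rightarrow> real \<Rightarrow> real"
  assumes "T > 0" and "\<sigma> > 0" and "C0 > 0"
    and sign: "\<forall>t\<in>{0..T}. \<forall>x. \<forall>r\<in>{0<..<1}.
                 (1 / r) * dr (\<lambda>t x r. (1 / r) * dr ux t x r) t x r \<ge> \<sigma>"
  shows "\<exists>C :: real. \<forall>ux0 p. AHEE_solution T ux0 ux ur p \<longrightarrow>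
           (\<forall>\<epsilon>>0. \<forall>\<beta>\<in>{0<..4}. \<forall>uxe0 uxe ure pe.
              AREE_solution \<epsilon> T uxe0 uxe ure pe \<longrightarrow>
              error_energy \<epsilon> uxe ure ux ur 0 \<le> C0 * \<epsilon> powr \<beta> \<longrightarrow>
              (\<forall>t\<in>{0..T}. error_energy \<epsilon> uxe ure ux ur t \<le> C * \<epsilon> powr \<beta>))"
proof (cases "\<exists>ux0 p. AHEE_solution T ux0 ux ur p")
  case False
  then show ?thesis by blast
next
  case True
  \<comment> \<open>The constant has to be fixed before the pressure. One solution supplies it, and
    it serves for every other pressure, since the error energy involves only \<open>ux\<close> and
    \<open>ur\<close> of the reference.\<close>
  then obtain ux0 p where sol: "AHEE_solution T ux0 ux ur p" by blast
  interpret cylinder T by unfold_locales (rule \<open>T > 0\<close>)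
  obtain u k P where E: "euler 0 u k P" and rep: "represents u k ux ur"
    and bc: "\<And>t x. t \<in> {0..T} \<Longrightarrow> k (t, x, 1/2) = 0"
    by (rule AHEE_euler[OF sol], rule that)
  note e = euler_eqs[OF E]
  have convex: "Ds (Ds u) X \<ge> \<sigma>" if "X \<in> \<Omega>" for X
    by (rule sign_condition[OF e(1,2) rep _ that]) (use sign in blast)
  have "\<exists>C. \<forall>\<epsilon>>0. \<forall>\<beta>\<in>{0<..4}. \<forall>U K P. euler \<epsilon> U K P \<longrightarrow> (\<forall>t\<in>{0..T}. \<forall>x. K (t, x, 1/2) = 0) \<longrightarrow>
    energy \<epsilon> U K u k 0 \<le> C0 * \<epsilon> powr \<beta> \<longrightarrow> (\<forall>t\<in>{0..T}. energy \<epsilon> U K u k t \<le> C * \<epsilon> powr \<beta>)"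
    by (rule energy_bound_uniform[OF E bc \<open>\<sigma> > 0\<close> convex \<open>C0 > 0\<close>])
  then obtain C where C: "\<forall>\<epsilon>>0. \<forall>\<beta>\<in>{0<..4}. \<forall>U K P. euler \<epsilon> U K P \<longrightarrow> (\<forall>t\<in>{0..T}. \<forall>x. K (t, x, 1/2) = 0) \<longrightarrow>
    energy \<epsilon> U K u k 0 \<le> C0 * \<epsilon> powr \<beta> \<longrightarrow> (\<forall>t\<in>{0..T}. energy \<epsilon> U K u k t \<le> C * \<epsilon> powr \<beta>)" ..
  show ?thesis
  proof (intro exI[of _ C] allI impI ballI)
    fix \<epsilon> \<beta> :: real and uxe0 uxe ure pe t
    assume \<epsilon>: "\<epsilon> > 0" and \<beta>: "\<beta> \<in> {0<..4}" and sol': "AREE_solution \<epsilon> T uxe0 uxe ure pe"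
      and init: "error_energy \<epsilon> uxe ure ux ur 0 \<le> C0 * \<epsilon> powr \<beta>" and t: "t \<in> {0..T}"
    obtain U K P' where EU: "euler \<epsilon> U K P'" and rep': "represents U K uxe ure"
      and bK: "\<And>t x. t \<in> {0..T} \<Longrightarrow> K (t, x, 1/2) = 0"
      by (rule AREE_euler[OF sol'], rule that)
    note eU = euler_eqs[OF EU]
    have eq: "error_energy \<epsilon> uxe ure ux ur t = energy \<epsilon> U K u k t" if "t \<in> {0..T}" for t
      by (rule error_energy_eq[OF eU(1,2) e(1,2) rep' rep that])
    have "energy \<epsilon> U K u k 0 \<le> C0 * \<epsilon> powr \<beta>" using init eq[of 0] T by simp
    then have "energy \<epsilon> U K u k t \<le> C * \<epsilon> powr \<beta>"
      using C[rule_format, OF \<epsilon> \<beta> EU _ _ t] bK by simp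
    then show "error_energy \<epsilon> uxe ure ux ur t \<le> C * \<epsilon> powr \<beta>"
      unfolding eq[OF t] .
  qed
qed

end
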